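(* Let $\Omega\subset\mathbb{R}^n$ be bounded and open and $m\le n$. Assume: (1) $K:\overline\Omega\times\mathbb{R}\times\mathbb{R}^n\times S^n\to\mathbb{R}$ is continuous and $K(x,r,p,X)\le K(x,s,p,Y)$ for all $x\in\overline\Omega$, $p\in\mathbb{R}^n$, $r\le s$, $Y\le X$; (2) for some modulus $\omega$, $$K\Big(y,r,\frac{x-y}{\epsilon},Y\Big)-K\Big(x,r,\frac{x-y}{\epsilon},X\Big)\le\omega\Big(|x-y|\Big(1+\frac{|x-y|}{\epsilon}\Big)\Big)$$ for all $\epsilon>0$, $x,y\in\overline\Omega$, $r\in\mathbb{R}$ and $X,Y\in S^n$ satisfying $$-\frac3\epsilon\begin{pmatrix}I&0\\0&I\end{pmatrix}\le\begin{pmatrix}X&0\\0&-Y\end{pmatrix}\le\frac3\epsilon\begin{pmatrix}I&-I\\-I&I\end{pmatrix};$$ (3) $\sigma$ is a Lipschitz continuous $n\times m$ matrix-valued function on $\overline\Omega$; (4) $A:\overline\Omega\times\mathbb{R}^n\to S^m$ is continuous and for some constant $C_1$, $-C_1|x-y|(1+|p|)I\le A(x,p)-A(y,p)\le C_1|x-y|(1+|p|)I$ for all $x,y\in\overline\Omega$, $p\in\mathbb{R}^n$. Consider the equation $$( * )\qquad-\log\det\big(\sigma^T(x)D^2u\,\sigma(x)+A(x,Du)\big)+K(x,u,Du,D^2u)=0\quad\text{in }\Omega.$$ (a) Let $u\in USC(\overline\Omega)$ be a bounded viscosity subsolution of $( * )$ which, for some $\gamma>0$, is also a viscosity subsolution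 of $-\sigma^T(x)D^2u\,\sigma(x)-A(x,Du)\le-\gamma I$ in $\Omega$, and let $v\in LSC(\overline\Omega)$ be a bounded viscosity supersolution of $( * )$. Suppose that for some $C>0$, with $M:=\max\{\|u\|_\infty,\|v\|_\infty\}$, $$K(x,r,p,X)-K(x,s,p,X)\ge C(r-s)\qquad\forall\,-M\le s\le r\le M,\ x\in\overline\Omega,\ p\in\mathbb{R}^n,\ X\in S^n.$$ Then $\sup_\Omega(u-v)\le\max_{\partial\Omega}(u-v)^+$. (b) Under this condition there is at most one viscosity solution $u\in C(\overline\Omega)$ of $( * )$ satisfying $-\sigma^T(x)D^2u\,\sigma(x)-A(x,Du)\le-\gamma I$ in $\Omega$ and having prescribed continuous boundary data on $\partial\Omega$; that is, if $u_1,u_2$ are two such solutions with $u_1=u_2$ on $\partial\Omega$ and the inequality for $K$ in (a) holds with $M=\max\{\|u_1\|_\infty,\|u_2\|_\infty\}$, then $u_1=u_2$.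
   Context: $S^k$ is the set of symmetric $k\times k$ matrices with the usual partial order; $s^+=\max\{s,0\}$. A modulus is a nondecreasing function $\omega:[0,\infty)\to[0,\infty)$ with $\omega(s)\to\omega(0)=0$ as $s\to0^+$. For $\Psi:\overline\Omega\times\mathbb{R}^n\times S^n\to S^m$ and $N\in S^m$, $u$ is a viscosity subsolution of (or satisfies) the matrix inequality $\Psi(x,Du,D^2u)\le N$ in $\Omega$ if $u$ is USC and $\Psi(x,D\varphi(x),D^2\varphi(x))\le N$ for all $\varphi\in C^2(\Omega)$ and all maximum points $x\in\Omega$ of $u-\varphi$. A function $u\in USC(\overline\Omega)$ satisfying the matrix inequality is a viscosity subsolution of $( * )$ if for all $\varphi\in C^2(\overline\Omega)$ and all maximum points $x_0\in\Omega$ of $u-\varphi$, $-\log\det(\sigma^T(x_0)D^2\varphi(x_0)\sigma(x_0)+A(x_0,D\varphi(x_0)))+K(x_0,u(x_0),D\varphi(x_0),D^2\varphi(x_0))\le0$. A function $v\in LSC(\overline\Omega)$ is a viscosity supersolution of $( * )$ if for all $\varphi\in C^2(\overline\Omega)$ and all minimum points $x_0\in\Omega$ of $v-\varphi$ such that $\sigma^T(x_0)D^2\varphi(x_0)\sigma(x_0)+A(x_0,D\varphi(x_0))$ is positive definite, $-\log\det(\sigma^T(x_0)D^2\varphi(x_0)\sigma(x_0)+A(x_0,D\varphi(x_0)))+K(x_0,v(x_0),D\varphi(x_0),D^2\varphi(x_0))\ge0$. A viscosity solution is both a subsolution and a supersolution. *)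

theory Defs
  imports "HOL-Analysis.Analysis"
begin

definition sym_mats :: "(real^'k^'k) set" where
  "sym_mats = {X. transpose X = X}"

text \<open>The order and positive definiteness are only ever meant for symmetric matrices;
  symmetry is not part of the definitions.\<close>

definition mat_le :: "real^'k^'k \<Rightarrow> real^'k^'k \<Rightarrow> bool"  (infix "\<preceq>" 50) where
  "X \<preceq> Y \<longleftrightarrow> (\<forall>\<xi>. \<xi> \<bullet> (X *v \<xi>) \<le> \<xi> \<bullet> (Y *v \<xi>))"

definition pos_definite :: "real^'k^'k \<Rightarrow> bool" where
  "pos_definite X \<longleftrightarrow> (\<forall>\<xi>. \<xi> \<noteq> 0 \<longrightarrow> 0 < \<xi> \<bullet> (X *v \<xi>))"

definition block_mat ::
  "real^'k^'k \<Rightarrow> real^'k^'k \<Rightarrow> real^'k^'k \<Rightarrow> real^'k^'k \<Rightarrow> real^('k + 'k)^('k + 'k)" where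
  "block_mat P Q R S = (\<chi> i j. case i of
      Inl a \<Rightarrow> (case j of Inl b \<Rightarrow> P $ a $ b | Inr b \<Rightarrow> Q $ a $ b)
    | Inr a \<Rightarrow> (case j of Inl b \<Rightarrow> R $ a $ b | Inr b \<Rightarrow> S $ a $ b))"

definition modulus :: "(real \<Rightarrow> real) \<Rightarrow> bool" where
  "modulus \<omega> \<longleftrightarrow> mono_on {0..} \<omega> \<and> (\<forall>s\<ge>0. 0 \<le> \<omega> s) \<and> \<omega> 0 = 0 \<and> (\<omega> \<longlongrightarrow> 0) (at_right 0)"

definition usc_on :: "'a::topological_space set \<Rightarrow> ('a \<Rightarrow> real) \<Rightarrow> bool" where
  "usc_on S u \<longleftrightarrow> (\<forall>x\<in>S. \<forall>c. u x < c \<longrightarrow> (\<forall>\<^sub>F y in at x within S. u y < c))"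

definition lsc_on :: "'a::topological_space set \<Rightarrow> ('a \<Rightarrow> real) \<Rightarrow> bool" where
  "lsc_on S v \<longleftrightarrow> (\<forall>x\<in>S. \<forall>c. c < v x \<longrightarrow> (\<forall>\<^sub>F y in at x within S. c < v y))"

definition sup_norm :: "'a set \<Rightarrow> ('a \<Rightarrow> real) \<Rightarrow> real" where
  "sup_norm S u = (SUP x\<in>S. \<bar>u x\<bar>)"

definition grad :: "(real^'n \<Rightarrow> real) \<Rightarrow> real^'n \<Rightarrow> real^'n" where
  "grad \<phi> x = (\<chi> i. frechet_derivative \<phi> (at x) (axis i 1))"

definition hessian :: "(real^'n \<Rightarrow> real) \<Rightarrow> real^'n \<Rightarrow> real^'n^'n" where
  "hessian \<phi> x = jacobian (grad \<phi>) (at x)"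

definition C2_on :: "(real^'n) set \<Rightarrow> (real^'n \<Rightarrow> real) \<Rightarrow> bool" where
  "C2_on \<Omega> \<phi> \<longleftrightarrow> (\<forall>x\<in>\<Omega>. \<phi> differentiable (at x)) \<and> (\<forall>x\<in>\<Omega>. grad \<phi> differentiable (at x))
     \<and> continuous_on \<Omega> (hessian \<phi>)"

text \<open>\<open>C\<^sup>2\<close> up to the boundary of the open set \<open>\<Omega>\<close>: the function and its derivatives up to
  order two extend continuously from \<open>\<Omega>\<close> to its closure.\<close>

definition C2_closure :: "(real^'n) set \<Rightarrow> (real^'n \<Rightarrow> real) \<Rightarrow> bool" where
  "C2_closure \<Omega> \<phi> \<longleftrightarrow> C2_on \<Omega> \<phi> \<and> continuous_on (closure \<Omega>) \<phi>
     \<and> (\<exists>G H. continuous_on (closure \<Omega>) G \<and> continuous_on (closure \<Omega>) H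
           \<and> (\<forall>x\<in>\<Omega>. G x = grad \<phi> x \<and> H x = hessian \<phi> x))"

definition visc_matrix_subsol ::
  "(real^'n) set \<Rightarrow> (real^'n \<Rightarrow> real^'n \<Rightarrow> real^'n^'n \<Rightarrow> real^'m^'m) \<Rightarrow> real^'m^'m
     \<Rightarrow> (real^'n \<Rightarrow> real) \<Rightarrow> bool" where
  "visc_matrix_subsol \<Omega> \<Psi> N u \<longleftrightarrow> usc_on \<Omega> u
     \<and> (\<forall>\<phi> x. C2_on \<Omega> \<phi> \<and> is_arg_max (\<lambda>y. u y - \<phi> y) (\<lambda>y. y \<in> \<Omega>) x
           \<longrightarrow> \<Psi> x (grad \<phi> x) (hessian \<phi> x) \<preceq> N)"

definition MA_matrix ::
  "(real^'n \<Rightarrow> real^'m^'n) \<Rightarrow> (real^'n \<Rightarrow> real^'n \<Rightarrow> real^'m^'m)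
     \<Rightarrow> real^'n \<Rightarrow> real^'n \<Rightarrow> real^'n^'n \<Rightarrow> real^'m^'m" where
  "MA_matrix \<sigma> A x p X = transpose (\<sigma> x) ** X ** \<sigma> x + A x p"

text \<open>The convention \<open>- log 0 = \<infinity>\<close> matters: the subsolution inequality must fail where
  the matrix is only semidefinite, whereas \<open>ln 0 = 0\<close> for the library logarithm.\<close>

definition neg_log_det :: "real^'m^'m \<Rightarrow> ereal" where
  "neg_log_det B = (if 0 < det B then ereal (- ln (det B)) else \<infinity>)"

definition MA_op ::
  "(real^'n \<Rightarrow> real^'m^'n) \<Rightarrow> (real^'n \<Rightarrow> real^'n \<Rightarrow> real^'m^'m)
     \<Rightarrow> (real^'n \<Rightarrow> real \<Rightarrow> real^'n \<Rightarrow> real^'n^'n \<Rightarrow> real)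
     \<Rightarrow> real^'n \<Rightarrow> real \<Rightarrow> real^'n \<Rightarrow> real^'n^'n \<Rightarrow> ereal" where
  "MA_op \<sigma> A K x r p X = neg_log_det (MA_matrix \<sigma> A x p X) + ereal (K x r p X)"

text \<open>The matrix inequality built into the notion of subsolution is
  \<open>- \<sigma>\<^sup>T D\<^sup>2u \<sigma> - A(x,Du) \<le> 0\<close>.\<close>

definition visc_subsol ::
  "(real^'n) set \<Rightarrow> (real^'n \<Rightarrow> real^'m^'n) \<Rightarrow> (real^'n \<Rightarrow> real^'n \<Rightarrow> real^'m^'m)
     \<Rightarrow> (real^'n \<Rightarrow> real \<Rightarrow> real^'n \<Rightarrow> real^'n^'n \<Rightarrow> real) \<Rightarrow> (real^'n \<Rightarrow> real) \<Rightarrow> bool" where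
  "visc_subsol \<Omega> \<sigma> A K u \<longleftrightarrow> usc_on (closure \<Omega>) u
     \<and> visc_matrix_subsol \<Omega> (\<lambda>x p X. - MA_matrix \<sigma> A x p X) 0 u
     \<and> (\<forall>\<phi> x. C2_closure \<Omega> \<phi> \<and> x \<in> \<Omega>
           \<and> is_arg_max (\<lambda>y. u y - \<phi> y) (\<lambda>y. y \<in> closure \<Omega>) x
           \<longrightarrow> MA_op \<sigma> A K x (u x) (grad \<phi> x) (hessian \<phi> x) \<le> 0)"

definition visc_supersol ::
  "(real^'n) set \<Rightarrow> (real^'n \<Rightarrow> real^'m^'n) \<Rightarrow> (real^'n \<Rightarrow> real^'n \<Rightarrow> real^'m^'m)
     \<Rightarrow> (real^'n \<Rightarrow> real \<Rightarrow> real^'n \<Rightarrow> real^'n^'n \<Rightarrow> real) \<Rightarrow> (real^'n \<Rightarrow> real) \<Rightarrow> bool" where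
  "visc_supersol \<Omega> \<sigma> A K v \<longleftrightarrow> lsc_on (closure \<Omega>) v
     \<and> (\<forall>\<phi> x. C2_closure \<Omega> \<phi> \<and> x \<in> \<Omega>
           \<and> is_arg_min (\<lambda>y. v y - \<phi> y) (\<lambda>y. y \<in> closure \<Omega>) x
           \<and> pos_definite (MA_matrix \<sigma> A x (grad \<phi> x) (hessian \<phi> x))
           \<longrightarrow> MA_op \<sigma> A K x (v x) (grad \<phi> x) (hessian \<phi> x) \<ge> 0)"

definition visc_sol ::
  "(real^'n) set \<Rightarrow> (real^'n \<Rightarrow> real^'m^'n) \<Rightarrow> (real^'n \<Rightarrow> real^'n \<Rightarrow> real^'m^'m)
     \<Rightarrow> (real^'n \<Rightarrow> real \<Rightarrow> real^'n \<Rightarrow> real^'n^'n \<Rightarrow> real) \<Rightarrow> (real^'n \<Rightarrow> real) \<Rightarrow> bool" where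
  "visc_sol \<Omega> \<sigma> A K u \<longleftrightarrow> visc_subsol \<Omega> \<sigma> A K u \<and> visc_supersol \<Omega> \<sigma> A K u"

definition K_increasing ::
  "(real^'n) set \<Rightarrow> (real^'n \<Rightarrow> real \<Rightarrow> real^'n \<Rightarrow> real^'n^'n \<Rightarrow> real) \<Rightarrow> real \<Rightarrow> real \<Rightarrow> bool" where
  "K_increasing \<Omega> K C M \<longleftrightarrow>
     (\<forall>r s x p X. - M \<le> s \<and> s \<le> r \<and> r \<le> M \<and> x \<in> closure \<Omega> \<and> X \<in> sym_mats
        \<longrightarrow> K x r p X - K x s p X \<ge> C * (r - s))"

end

theory Submission
  imports Defs
begin

text \<open>If \<open>u - v\<close> has a positive interior maximum exceeding its boundary values, one doubles the variables
  and maximizes \<open>u x - v y - |x - y|\<^sup>2 / (2 \<epsilon>)\<close>. The theorem on sums supplies symmetric matrices \<open>X\<close>, \<open>Y\<close>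
  satisfying the inequalities of the structure condition on \<open>K\<close>. Since the matrix \<open>M\<close> of the
  subsolution is at least \<open>\<gamma> I\<close>, the matrix of the supersolution is at least \<open>M - \<delta> I \<ge> (1 - \<delta> / \<gamma>) M\<close> with
  \<open>\<delta> \<rightarrow> 0\<close>; so the two logarithms of determinants differ by at most a vanishing amount, which
  contradicts the strict monotonicity of \<open>K\<close> in \<open>u\<close>.

  The theorem on sums is obtained from sup-convolutions. Adding a quadratic turns them into convex
  functions, whose second order expansion at suitable contact points is derived from Rademacher's
  theorem for the proximal map. Rademacher's theorem in turn rests on the one-dimensional case,
  which is an application of the Vitali covering theorem.\<close>

section \<open>Rademacher's theorem\<close>

text \<open>Two features of the equation shape the argument. A supersolution may be tested only
  where its matrix is positive definite, and \<open>ln (det _)\<close> is not uniformly continuous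
  near the boundary of the positive cone. The margin \<open>\<gamma>\<close> removes both obstacles,
  since it turns an additive error \<open>\<delta>\<close> into the relative error
  \<open>\<delta> / \<gamma>\<close>. That error is built from |x - y|^2 / \<epsilon> and |x - y| (1
  + |x - y| / \<epsilon>), which vanish along the maximizers although |x - y| / \<epsilon> need not
  stay bounded.

  The functions are only semicontinuous, so the jets in the theorem on sums are attained merely
  along sequences, and the viscosity inequalities have to be carried to the limit. The constant 3 /
  \<epsilon> comes from |a + b + c|^2 \<le> 3 (|a|^2 + |b|^2 + |c|^2): the increment between the two
  points is split into the increment of the convolution variables and two regularization errors, all
  charged at the same rate, so that one constant bounds both matrices from below and their sum from
  above.\<close>

text \<open>The Vitali covering theorem selects countably many disjoint intervals, inside a slightly
  larger open set, that cover \<open>S\<close> up to a Lebesgue null set; the inequality between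
  \<open>M\<close> and \<open>N\<close> adds up over them. Domination by a multiple of Lebesgue
  measure makes the uncovered part harmless for \<open>M\<close> and the excess of the open set
  harmless for \<open>N\<close>.\<close>

lemma emeasure_le_of_fine_cover:
  fixes M N :: "real measure" and S :: "real set"
  assumes [measurable_cong]: "sets M = sets borel" "sets N = sets borel"
    and M: "\<And>B. B \<in> sets borel \<Longrightarrow> emeasure M B \<le> ennreal c * emeasure lborel B"
    and N: "\<And>B. B \<in> sets borel \<Longrightarrow> emeasure N B \<le> ennreal c * emeasure lborel B"
    and c: "c > 0"
    and S: "S \<in> sets borel"
    and fine: "\<And>x d. x \<in> S \<Longrightarrow> 0 < d \<Longrightarrow>
      \<exists>a b. a < b \<and> a \<le> x \<and> x \<le> b \<and> b - a < d \<and> emeasure M {a..b} \<le> emeasure N {a..b}"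
  shows "emeasure M S \<le> emeasure N S"
proof (rule ennreal_le_epsilon)
  fix e :: real assume e: "0 < e"
  \<comment> \<open>The excess is measured by Lebesgue measure; \<open>e / c\<close> is what the
    domination of \<open>N\<close> turns into \<open>e\<close>.\<close>
  obtain U where U: "open U" "S \<subseteq> U" "U - S \<in> lmeasurable" "emeasure lebesgue (U - S) < ennreal (e / c)"
    using sets_lebesgue_outer_open[of S "e / c"] S e c by (auto intro: lborelD)
  have "U - S \<in> sets borel" using U S by auto
  then have "emeasure N (U - S) \<le> ennreal c * emeasure lborel (U - S)" by (rule N)
  also have "\<dots> \<le> ennreal c * ennreal (e / c)"
    using U(4) \<open>U - S \<in> sets borel\<close> by (intro mult_left_mono) (auto simp: emeasure_completion)
  also have "\<dots> = ennreal e" using c e by (simp add: ennreal_mult[symmetric])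
  finally have NU': "emeasure N (U - S) \<le> ennreal e" .
  have "U = S \<union> (U - S)" using U by auto
  then have "emeasure N U \<le> emeasure N S + emeasure N (U - S)"
    using emeasure_subadditive[of S N "U - S"] S \<open>U - S \<in> sets borel\<close> assms(2) by auto
  with NU' have NU: "emeasure N U \<le> emeasure N S + ennreal e"
    by (meson add_left_mono order_trans)
  define K where "K = {(a, b). a < b \<and> {a..b} \<subseteq> U \<and> emeasure M {a..b} \<le> emeasure N {a..b}}"
  define ctr where "ctr = (\<lambda>(a::real, b). (a + b) / 2)"
  define rad where "rad = (\<lambda>(a::real, b). (b - a) / 2)"
  have cb: "cball (ctr i) (rad i) = {fst i..snd i}" for i
    by (cases i) (auto simp: ctr_def rad_def cball_eq_atLeastAtMost field_simps)
  have 1: "0 < rad i" if "i \<in> K" for i using that by (auto simp: K_def rad_def)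
  have 2: "\<exists>i. i \<in> K \<and> x \<in> cball (ctr i) (rad i) \<and> rad i < d" if xd: "x \<in> S" "0 < d" for x d
  proof -
    obtain r where r: "r > 0" "ball x r \<subseteq> U" using U \<open>x \<in> S\<close> openE by blast
    obtain a b where ab: "a < b" "a \<le> x" "x \<le> b" "b - a < min r d" "emeasure M {a..b} \<le> emeasure N {a..b}"
      using fine[of x "min r d"] xd r by auto
    have "{a..b} \<subseteq> ball x r" using ab by (auto simp: dist_real_def)
    then have "(a, b) \<in> K" using ab r by (auto simp: K_def)
    then show ?thesis using ab cb[of "(a,b)"] by (intro exI[of _ "(a,b)"]) (auto simp: rad_def)
  qed
  obtain C where C: "countable C" "C \<subseteq> K"
     "pairwise (\<lambda>i j. disjnt (cball (ctr i) (rad i)) (cball (ctr j) (rad j))) C"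
     "negligible (S - (\<Union>i \<in> C. cball (ctr i) (rad i)))"
    using Vitali_covering_theorem_cballs[of K rad S ctr] 1 2 by blast
  define V where "V = (\<Union>i\<in>C. {fst i..snd i})"
  have V[measurable]: "V \<in> sets borel" unfolding V_def using C(1) by auto
  have VU: "V \<subseteq> U" using C(2) unfolding V_def K_def by fastforce
  have dj: "disjoint_family_on (\<lambda>i. {fst i..snd i}) C"
    using C(3) unfolding disjoint_family_on_def pairwise_def disjnt_def cb by auto
  have null: "emeasure M (S - V) = 0"
  proof -
    have "emeasure lborel (S - V) = 0"
      using C(4) S V unfolding V_def[symmetric] cb
      by (auto simp: negligible_iff_null_sets null_sets_def emeasure_completion)
    then show ?thesis using M[of "S - V"] S V by simp
  qed
  have "emeasure M S \<le> emeasure M (V \<union> (S - V))"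
    using S V assms(1) by (intro emeasure_mono) auto
  also have "\<dots> \<le> emeasure M V + emeasure M (S - V)"
    using S V assms(1) by (intro emeasure_subadditive) auto
  also have "\<dots> = emeasure M V" using null by simp
  also have "\<dots> = (\<integral>\<^sup>+ i. emeasure M {fst i..snd i} \<partial>count_space C)"
    unfolding V_def using C(1) dj assms(1) by (intro emeasure_UN_countable) auto
  also have "\<dots> \<le> (\<integral>\<^sup>+ i. emeasure N {fst i..snd i} \<partial>count_space C)"
    using C(2) by (intro nn_integral_mono) (auto simp: K_def)
  also have "\<dots> = emeasure N V"
    unfolding V_def using C(1) dj assms(2) by (intro emeasure_UN_countable[symmetric]) auto
  also have "\<dots> \<le> emeasure N U"
    using VU U assms(2) by (intro emeasure_mono) auto
  finally show "emeasure M S \<le> emeasure N S + ennreal e" using NU by (rule order_trans)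
qed

text \<open>The function \<open>h x = c * x - g x\<close> is nondecreasing as well, and Stieltjes
  measures add up: those of \<open>g\<close> and \<open>h\<close> sum to \<open>c\<close> times
  Lebesgue measure. Dropping the measure of \<open>h\<close> leaves the bound.\<close>

lemma interval_measure_le_lborel:
  fixes g :: "real \<Rightarrow> real"
  assumes mono: "\<And>x y. x \<le> y \<Longrightarrow> g x \<le> g y"
    and lip: "\<And>x y. x \<le> y \<Longrightarrow> g y - g x \<le> c * (y - x)"
    and cont: "continuous_on UNIV g" and c: "c \<ge> 0"
    and B: "B \<in> sets borel"
  shows "emeasure (interval_measure g) B \<le> ennreal c * emeasure lborel B"
proof -
  define h where "h x = c * x - g x" for x
  have hm: "h x \<le> h y" if "x \<le> y" for x y
    using lip[OF that] by (simp add: h_def algebra_simps)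
  have hc: "continuous_on UNIV h" unfolding h_def by (intro continuous_intros cont)
  have rc: "continuous (at_right a) g" "continuous (at_right a) h" for a
    using cont hc by (auto simp: continuous_on_eq_continuous_at continuous_at_imp_continuous_at_within)
  have eI: "emeasure (interval_measure g) {a<..b} = ennreal (g b - g a)"
       "emeasure (interval_measure h) {a<..b} = ennreal (h b - h a)" if "a \<le> b" for a b
    using that by (auto intro!: emeasure_interval_measure_Ioc mono hm rc)
  define G where "G = interval_measure g"
  define H where "H = interval_measure h"
  have sG[simp]: "sets G = sets borel" "sets H = sets borel" "space G = UNIV" "space H = UNIV"
    by (auto simp: G_def H_def)
  \<comment> \<open>Cutting into unit cells keeps all measures finite, so that the complement step
    of the induction over half-open intervals can subtract.\<close>
  define I where "I = (\<lambda>n::int. {real_of_int n<..real_of_int n + 1})"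
  have I[measurable]: "I n \<in> sets borel" for n by (auto simp: I_def)
  have fin: "emeasure G (I n) < \<infinity>" "emeasure H (I n) < \<infinity>" for n
    unfolding I_def G_def H_def by (subst eI; simp)+
  have key: "emeasure G (B \<inter> I n) + emeasure H (B \<inter> I n) = ennreal c * emeasure lborel (B \<inter> I n)" for n
  proof -
    have Bs: "B \<in> sigma_sets UNIV (range (\<lambda>(a, b). {a<..b::real}))"
      using B unfolding borel_sigma_sets_Ioc by (simp add: image_def split: prod.split)
    have Gs: "range (\<lambda>(a, b). {a<..b::real}) \<subseteq> Pow UNIV" by simp
    have ints: "Int_stable (range (\<lambda>(a, b). {a<..b::real}))"
      unfolding Int_stable_def
    proof (intro ballI)
      fix P Q :: "real set" assume "P \<in> range (\<lambda>(a, b). {a<..b})" "Q \<in> range (\<lambda>(a, b). {a<..b})"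
      then obtain a b c d where "P = {a<..b}" "Q = {c<..d}" by force
      then have "P \<inter> Q = (\<lambda>(a, b). {a<..b}) (max a c, min b d)" by auto
      then show "P \<inter> Q \<in> range (\<lambda>(a, b). {a<..b})" by blast
    qed
    from ints Gs Bs show ?thesis
    proof (induction rule: sigma_sets_induct_disjoint)
      case (basic A)
      then obtain a b where A: "A = {a<..b}" by auto
      have An: "A \<inter> I n = {max a n<..min b (n + 1)}" by (auto simp: A I_def)
      show ?case
      proof (cases "max a n \<le> min b (n + 1)")
        case True
        have "0 \<le> g (min b (n + 1)) - g (max a n)" "0 \<le> h (min b (n + 1)) - h (max a n)"
          using mono[OF True] hm[OF True] by auto
        then show ?thesis
          unfolding An G_def H_def eI[OF True] emeasure_lborel_Ioc[OF True]
          using c True by (simp add: ennreal_plus[symmetric] ennreal_mult[symmetric] h_def algebra_simps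
             del: ennreal_plus)
      next
        case False
        then have "A \<inter> I n = {}" unfolding An by auto
        then show ?thesis by simp
      qed
    next
      case empty then show ?case by simp
    next
      case (compl A)
      have A: "A \<in> sets borel"
        using compl(1) by (simp add: borel_sigma_sets_Ioc image_def split: prod.split)
      have le: "emeasure G (A \<inter> I n) \<le> emeasure G (I n)" "emeasure H (A \<inter> I n) \<le> emeasure H (I n)"
           "emeasure lborel (A \<inter> I n) \<le> emeasure lborel (I n)"
        using A by (auto intro!: emeasure_mono)
      have finl: "emeasure lborel (I n) < \<infinity>" by (simp add: I_def)
      have fin': "emeasure G (A \<inter> I n) \<noteq> \<infinity>" "emeasure H (A \<inter> I n) \<noteq> \<infinity>" "emeasure lborel (A \<inter> I n) \<noteq> \<infinity>"
        using le fin[of n] finl by (auto simp: top_unique)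
      have e: "(UNIV - A) \<inter> I n = I n - A \<inter> I n" by auto
      have d: "emeasure G (I n - A \<inter> I n) = emeasure G (I n) - emeasure G (A \<inter> I n)"
         "emeasure H (I n - A \<inter> I n) = emeasure H (I n) - emeasure H (A \<inter> I n)"
         "emeasure lborel (I n - A \<inter> I n) = emeasure lborel (I n) - emeasure lborel (A \<inter> I n)"
        using A fin' by (auto intro!: emeasure_Diff)
      have nn: "0 \<le> g (n + 1) - g n" "0 \<le> h (n + 1) - h n" for n :: real
        using mono[of n "n+1"] hm[of n "n+1"] by auto
      have f: "emeasure G (I n) + emeasure H (I n) = ennreal c * emeasure lborel (I n)"
        unfolding I_def G_def H_def using nn[of n] c
        by (subst eI, simp)+ (simp add: ennreal_plus[symmetric] ennreal_mult[symmetric] h_def algebra_simps del: ennreal_plus)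
      obtain x1 y1 l1 where 1: "emeasure G (I n) = ennreal x1" "emeasure H (I n) = ennreal y1" "emeasure lborel (I n) = ennreal l1"
        "x1 \<ge> 0" "y1 \<ge> 0" "l1 \<ge> 0"
        using fin[of n] finl by (metis ennreal_cases infinity_ennreal_def less_irrefl)
      obtain x2 y2 l2 where 2: "emeasure G (A \<inter> I n) = ennreal x2" "emeasure H (A \<inter> I n) = ennreal y2" "emeasure lborel (A \<inter> I n) = ennreal l2"
        "x2 \<ge> 0" "y2 \<ge> 0" "l2 \<ge> 0"
        using fin' by (metis ennreal_cases infinity_ennreal_def)
      have "x1 + y1 = c * l1" "x2 + y2 = c * l2" "x2 \<le> x1" "y2 \<le> y1" "l2 \<le> l1"
        using f compl(2) le 1(4-6) 2(4-6) c unfolding 1 2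
        by (auto simp: ennreal_plus[symmetric] ennreal_mult[symmetric] simp del: ennreal_plus)
      then show ?case unfolding e d 1 2 using 1(4-6) 2(4-6) c
        by (simp add: ennreal_minus ennreal_plus[symmetric] ennreal_mult[symmetric] algebra_simps del: ennreal_plus)
    next
      case (union A)
      have A: "A i \<in> sets borel" for i
        using union(2) by (auto simp add: borel_sigma_sets_Ioc image_def split: prod.split)
      have dj: "disjoint_family (\<lambda>i. A i \<inter> I n)" using union(1) by (auto simp: disjoint_family_on_def)
      have e: "(\<Union>i. A i) \<inter> I n = (\<Union>i. A i \<inter> I n)" by auto
      have s: "emeasure P (\<Union>i. A i \<inter> I n) = (\<Sum>i. emeasure P (A i \<inter> I n))" if "sets P = sets borel" for P
        using A that dj by (intro suminf_emeasure[symmetric]) auto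
      have "emeasure G (\<Union>i. A i \<inter> I n) + emeasure H (\<Union>i. A i \<inter> I n)
          = (\<Sum>i. emeasure G (A i \<inter> I n) + emeasure H (A i \<inter> I n))"
        by (simp only: s[OF sG(1)] s[OF sG(2)]) (rule suminf_add; auto)
      also have "\<dots> = (\<Sum>i. ennreal c * emeasure lborel (A i \<inter> I n))" by (simp only: union(3))
      also have "\<dots> = ennreal c * emeasure lborel (\<Union>i. A i \<inter> I n)"
        by (simp only: s[OF sets_lborel] ennreal_suminf_cmult)
      finally show ?case unfolding e .
    qed
  qed
  have dj: "disjoint_family (\<lambda>n. B \<inter> I n)"
  proof -
    have "m = n" if "x \<in> I m" "x \<in> I n" for m n x
    proof -
      have "real_of_int m < real_of_int n + 1" "real_of_int n < real_of_int m + 1" using that by (auto simp: I_def)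
      then show ?thesis by linarith
    qed
    then show ?thesis unfolding disjoint_family_on_def by blast
  qed
  have U: "B = (\<Union>n. B \<inter> I n)"
  proof -
    have "x \<in> I (\<lceil>x\<rceil> - 1)" for x by (auto simp: I_def, linarith)
    then show ?thesis by blast
  qed
  have s: "emeasure P B = (\<integral>\<^sup>+ n. emeasure P (B \<inter> I n) \<partial>count_space UNIV)" if "sets P = sets borel" for P
    using B that dj by (subst U, intro emeasure_UN_countable) auto
  have "emeasure G B \<le> (\<integral>\<^sup>+ n. ennreal c * emeasure lborel (B \<inter> I n) \<partial>count_space UNIV)"
    unfolding s[OF sG(1)] by (intro nn_integral_mono) (simp add: key[symmetric])
  also have "\<dots> = ennreal c * emeasure lborel B"
    unfolding s[OF sets_lborel] by (intro nn_integral_cmult) auto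
  finally show ?thesis by (simp add: G_def)
qed

text \<open>After adding \<open>L * x\<close> the function is nondecreasing and has a Stieltjes
  measure. On the set of points lying in arbitrarily short intervals of slope below \<open>p\<close>
  and in others of slope above \<open>q\<close>, that measure is at most \<open>p\<close> and at
  least \<open>q\<close> times Lebesgue measure, which for \<open>p < q\<close> forces the set to be
  null. Off the countable union over rational \<open>p\<close>, \<open>q\<close> the slopes
  converge.\<close>

lemma negligible_not_differentiable_lipschitz_real:
  fixes f :: "real \<Rightarrow> real"
  assumes f: "L-lipschitz_on UNIV f"
  shows "negligible {x. \<not> f differentiable (at x)}"
proof -
  have L: "L \<ge> 0" using f by (rule lipschitz_on_nonneg)
  define g where "g x = f x + L * x" for x
  have fl: "\<bar>f x - f y\<bar> \<le> L * \<bar>x - y\<bar>" for x y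
    using lipschitz_onD[OF f] by (simp add: dist_real_def)
  have mono: "g x \<le> g y" if "x \<le> y" for x y
    using fl[of x y] that by (auto simp: g_def algebra_simps abs_if split: if_splits)
  have lip: "g y - g x \<le> (2 * L) * (y - x)" if "x \<le> y" for x y
    using fl[of y x] that by (auto simp: g_def algebra_simps abs_if split: if_splits)
  have cont: "continuous_on UNIV g"
    unfolding g_def by (intro continuous_intros lipschitz_on_continuous_on[OF f])
  define sl where "sl a b = (g b - g a) / (b - a)" for a b
  \<comment> \<open>Open intervals are used, so that \<open>E p q\<close> is a countable
    intersection of open sets and hence Borel.\<close>
  define E where "E p q = (\<Inter>n::nat. \<Union>{{a<..<b} |a b. a < b \<and> b - a < 1 / Suc n \<and> sl a b < p}) \<inter>
      (\<Inter>n::nat. \<Union>{{a<..<b} |a b. a < b \<and> b - a < 1 / Suc n \<and> sl a b > q})" for p q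
  have EB: "E p q \<in> sets borel" for p q
    unfolding E_def by (intro sets.Int sets.countable_INT'' borel_open) (auto intro!: open_Union)
  define M where "M = interval_measure g"
  have sM[simp]: "sets M = sets borel" by (simp add: M_def)
  have MI: "emeasure M {a..b} = ennreal (g b - g a)" if "a \<le> b" for a b
    unfolding M_def using that cont by (intro emeasure_interval_measure_Icc mono) auto
  have neg: "E p q \<in> null_sets lborel" if pq: "0 < p" "p < q" for p q
  proof -
    \<comment> \<open>One constant dominating all three densities \<open>2 * L\<close>,
      \<open>p\<close> and \<open>q\<close>, as both applications of the covering lemma
      require.\<close>
    define c where "c = 2 * L + p + q"
    have c: "c > 0" "q \<le> c" "p \<le> c" "2 * L \<le> c" using pq L by (auto simp: c_def)
    have Mc: "emeasure M B \<le> ennreal c * emeasure lborel B" if "B \<in> sets borel" for B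
    proof -
      have "emeasure M B \<le> ennreal (2 * L) * emeasure lborel B"
        unfolding M_def using L by (intro interval_measure_le_lborel mono lip cont that) auto
      also have "\<dots> \<le> ennreal c * emeasure lborel B"
        using c by (intro mult_right_mono ennreal_leI) auto
      finally show ?thesis .
    qed
    have fine: "\<exists>a b. a < b \<and> a \<le> x \<and> x \<le> b \<and> b - a < d \<and> sl a b < p" 
         "\<exists>a b. a < b \<and> a \<le> x \<and> x \<le> b \<and> b - a < d \<and> sl a b > q" if "x \<in> E p q" "0 < d" for x d
    proof -
      obtain n where n: "1 / Suc n < d" using \<open>0 < d\<close> nat_approx_posE by blast
      from that(1) obtain a b where "x \<in> {a<..<b}" "a < b" "b - a < 1 / Suc n" "sl a b < p"
        unfolding E_def by blast
      then show "\<exists>a b. a < b \<and> a \<le> x \<and> x \<le> b \<and> b - a < d \<and> sl a b < p"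
        using n by (intro exI[of _ a] exI[of _ b]) auto
      from that(1) obtain a b where "x \<in> {a<..<b}" "a < b" "b - a < 1 / Suc n" "sl a b > q"
        unfolding E_def by blast
      then show "\<exists>a b. a < b \<and> a \<le> x \<and> x \<le> b \<and> b - a < d \<and> sl a b > q"
        using n by (intro exI[of _ a] exI[of _ b]) auto
    qed
    have loc: "E p q \<inter> {-r..r} \<in> null_sets lborel" for r
    proof -
      let ?S = "E p q \<inter> {-r..r}"
      have S: "?S \<in> sets borel" using EB by auto
      have "emeasure M ?S \<le> emeasure (scale_measure (ennreal p) lborel) ?S"
      proof (rule emeasure_le_of_fine_cover[OF _ _ Mc _ c(1) S])
        show "emeasure (scale_measure (ennreal p) lborel) B \<le> ennreal c * emeasure lborel B" for B
          using c by (auto intro!: mult_right_mono ennreal_leI)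
        show "\<exists>a b. a < b \<and> a \<le> x \<and> x \<le> b \<and> b - a < d \<and> emeasure M {a..b} \<le> emeasure (scale_measure (ennreal p) lborel) {a..b}"
          if xd: "x \<in> ?S" "0 < d" for x d
        proof -
          obtain a b where "a < b" "a \<le> x" "x \<le> b" "b - a < d" "sl a b < p" using fine(1)[of x d] xd by auto
          then show ?thesis using pq MI[of a b]
            by (intro exI[of _ a] exI[of _ b]) (auto simp: sl_def ennreal_mult[symmetric] field_simps intro!: ennreal_leI)
        qed
      qed auto
      moreover have "emeasure (scale_measure (ennreal q) lborel) ?S \<le> emeasure M ?S"
      proof (rule emeasure_le_of_fine_cover[OF _ _ _ Mc c(1) S])
        show "emeasure (scale_measure (ennreal q) lborel) B \<le> ennreal c * emeasure lborel B" for B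
          using c by (auto intro!: mult_right_mono ennreal_leI)
        show "\<exists>a b. a < b \<and> a \<le> x \<and> x \<le> b \<and> b - a < d \<and> emeasure (scale_measure (ennreal q) lborel) {a..b} \<le> emeasure M {a..b}"
          if xd: "x \<in> ?S" "0 < d" for x d
        proof -
          obtain a b where "a < b" "a \<le> x" "x \<le> b" "b - a < d" "sl a b > q" using fine(2)[of x d] xd by auto
          then show ?thesis using pq MI[of a b]
            by (intro exI[of _ a] exI[of _ b]) (auto simp: sl_def ennreal_mult[symmetric] field_simps intro!: ennreal_leI)
        qed
      qed auto
      ultimately have le: "ennreal q * emeasure lborel ?S \<le> ennreal p * emeasure lborel ?S" by simp
      have "emeasure lborel ?S \<le> emeasure lborel {-r..r}" by (intro emeasure_mono) auto
      then have "emeasure lborel ?S < \<infinity>" using emeasure_lborel_cbox_finite[of "-r" r] by (auto intro: le_less_trans)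
      then obtain s where s: "emeasure lborel ?S = ennreal s" "s \<ge> 0" by (metis ennreal_cases infinity_ennreal_def less_irrefl)
      have "q * s \<le> p * s" using le s pq by (simp add: ennreal_mult[symmetric])
      then have "(q - p) * s \<le> 0" by (simp add: algebra_simps)
      then have "s = 0" using pq s(2) by (simp add: mult_le_0_iff)
      then show ?thesis using s S by (auto simp: null_sets_def)
    qed
    have "E p q = (\<Union>n::nat. E p q \<inter> {-real n..real n})"
    proof -
      have "\<exists>n::nat. x \<in> {-real n..real n}" for x
      proof -
        obtain n :: nat where "\<bar>x\<bar> \<le> real n" using real_arch_simple by blast
        then show ?thesis by (intro exI[of _ n]) auto
      qed
      then show ?thesis by blast
    qed
    moreover have "(\<Union>n::nat. E p q \<inter> {-real n..real n}) \<in> null_sets lborel"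
      by (intro null_sets_UN loc)
    ultimately show ?thesis by simp
  qed
  have sub: "{x. \<not> f differentiable (at x)} \<subseteq> (\<Union>p\<in>\<rat> \<inter> {0<..}. \<Union>q\<in>\<rat> \<inter> {p<..}. E p q)"
  proof
    fix x assume "x \<in> {x. \<not> f differentiable (at x)}"
    then have nd: "\<not> f differentiable (at x)" by simp
    show "x \<in> (\<Union>p\<in>\<rat> \<inter> {0<..}. \<Union>q\<in>\<rat> \<inter> {p<..}. E p q)"
    proof (rule ccontr)
      assume "\<not> ?thesis"
      then have nE: "x \<notin> E p q" if "p \<in> \<rat>" "q \<in> \<rat>" "0 < p" "p < q" for p q using that by auto
      \<comment> \<open>Eventual lower bounds for the slopes over intervals that shrink to the
        interior point \<open>x\<close>. The supremum of \<open>P\<close> is the lower limit of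
        these slopes and turns out to be the derivative of \<open>g\<close>.\<close>
      define P where "P = {p. \<exists>d>0. \<forall>a b. a < x \<and> x < b \<and> b - a < d \<longrightarrow> p \<le> sl a b}"
      have sl0: "0 \<le> sl a b" "sl a b \<le> 2 * L" if "a < b" for a b
        using mono[of a b] lip[of a b] that by (auto simp: sl_def divide_simps algebra_simps)
      have P0: "0 \<in> P" unfolding P_def using sl0 by (auto intro!: exI[of _ 1])
      have Pb: "p \<le> 2 * L" if "p \<in> P" for p
      proof -
        from that obtain d where d: "d > 0" "\<And>a b. a < x \<Longrightarrow> x < b \<Longrightarrow> b - a < d \<Longrightarrow> p \<le> sl a b"
          unfolding P_def by blast
        have "p \<le> sl (x - d / 4) (x + d / 4)" by (rule d(2)) (use d(1) in auto)
        also have "\<dots> \<le> 2 * L" using sl0 d(1) by auto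
        finally show ?thesis .
      qed
      have bd: "bdd_above P" using Pb by (rule bdd_aboveI)
      define l where "l = Sup P"
      have l0: "0 \<le> l" unfolding l_def by (rule cSup_upper[OF P0 bd])
      have close: "\<exists>d>0. \<forall>a b. a < x \<and> x < b \<and> b - a < d \<longrightarrow> \<bar>sl a b - l\<bar> \<le> e" if e: "e > 0" for e
      proof -
        obtain p1 where "p1 \<in> P" "l - e < p1"
          using less_cSup_iff[of P "l - e"] P0 bd e unfolding l_def by auto
        then obtain d1 where d1: "d1 > 0" "\<And>a b. a < x \<Longrightarrow> x < b \<Longrightarrow> b - a < d1 \<Longrightarrow> p1 \<le> sl a b"
          unfolding P_def by blast
        \<comment> \<open>Two rationals between \<open>l\<close> and \<open>l + e\<close>: slopes
          below \<open>p\<close> occur at every scale because \<open>p\<close> exceeds the supremum,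
          so \<open>x \<notin> E p q\<close> must exclude slopes above \<open>q\<close> at some
          scale.\<close>
        obtain p where p: "p \<in> \<rat>" "l < p" "p < l + e" using Rats_dense_in_real[of l "l + e"] e by auto
        obtain q where q: "q \<in> \<rat>" "p < q" "q < l + e" using Rats_dense_in_real[of p "l + e"] p by auto
        have "p \<notin> P" using cSup_upper[of p P] bd p unfolding l_def by auto
        have "x \<in> \<Union>{{a<..<b} |a b. a < b \<and> b - a < 1 / Suc n \<and> sl a b < p}" for n
        proof -
          have "1 / real (Suc n) > 0" by simp
          then obtain a b where ab: "a < x" "x < b" "b - a < 1 / Suc n" "\<not> p \<le> sl a b"
            using \<open>p \<notin> P\<close> unfolding P_def by blast
          then have "a < b" "sl a b < p" by auto
          with ab(3) have "{a<..<b} \<in> {{a<..<b} |a b. a < b \<and> b - a < 1 / Suc n \<and> sl a b < p}" by blast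
          moreover have "x \<in> {a<..<b}" using ab(1,2) by auto
          ultimately show ?thesis by (rule UnionI)
        qed
        moreover have "x \<notin> E p q" using nE p q l0 by auto
        ultimately obtain n where xn: "x \<notin> \<Union>{{a<..<b} |a b. a < b \<and> b - a < 1 / Suc n \<and> sl a b > q}"
          unfolding E_def by blast
        then have n: "sl a b \<le> q" if "a < x" "x < b" "b - a < 1 / Suc n" for a b
        proof -
          have "a < b" using that by auto
          show ?thesis
          proof (rule ccontr)
            assume "\<not> sl a b \<le> q"
            then have "{a<..<b} \<in> {{a<..<b} |a b. a < b \<and> b - a < 1 / Suc n \<and> sl a b > q}"
              using that \<open>a < b\<close> not_le by blast
            moreover have "x \<in> {a<..<b}" using that by auto
            ultimately show False using xn by (meson UnionI)
          qed
        qed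
        show ?thesis
        proof (intro exI[of _ "min d1 (1 / Suc n)"] conjI allI impI)
          show "0 < min d1 (1 / Suc n)" using d1 by auto
          fix a b assume "a < x \<and> x < b \<and> b - a < min d1 (1 / real (Suc n))"
          then have "p1 \<le> sl a b" "sl a b \<le> q" using d1(2) n by auto
          then show "\<bar>sl a b - l\<bar> \<le> e" using \<open>l - e < p1\<close> q by auto
        qed
      qed
      have cl: "continuous_on UNIV (\<lambda>s. g (c + k * s))" for c k
        by (intro continuous_on_compose2[OF cont]) (auto intro!: continuous_intros)
      have gl: "((\<lambda>s. g (c + k * s)) \<longlongrightarrow> g c) (at_right 0)" for c k
      proof -
        have "isCont (\<lambda>s. g (c + k * s)) 0" using cl by (simp add: continuous_on_eq_continuous_at)
        then have "((\<lambda>s. g (c + k * s)) \<longlongrightarrow> g c) (at 0)" by (simp add: isCont_def)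
        then show ?thesis by (rule filterlim_mono) (auto simp: at_le)
      qed
      have "(g has_real_derivative l) (at x)"
        unfolding DERIV_def
      proof (rule LIM_I)
        fix r :: real assume "0 < r"
        then obtain d where d: "d > 0" "\<And>a b. a < x \<Longrightarrow> x < b \<Longrightarrow> b - a < d \<Longrightarrow> \<bar>sl a b - l\<bar> \<le> r / 2"
          using close[of "r / 2"] by auto
        have "norm ((g (x + h) - g x) / h - l) < r" if h: "h \<noteq> 0" "norm (h - 0) < d" for h
        proof -
          \<comment> \<open>The intervals considered so far contain \<open>x\<close> in their
            interior. A one-sided quotient is the limit of their slopes as the other endpoint tends
            to \<open>x\<close>, by continuity of \<open>g\<close>.\<close>
          have "\<bar>(g (x + h) - g x) / h - l\<bar> \<le> r / 2"
          proof (cases "h > 0")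
            case True
            show ?thesis
            proof (rule tendsto_upperbound)
              show "((\<lambda>s. \<bar>(g (x + h) - g (x + (- 1) * s)) / (h + s) - l\<bar>) \<longlongrightarrow> \<bar>(g (x + h) - g x) / h - l\<bar>) (at_right 0)"
                using True by (intro tendsto_rabs tendsto_diff tendsto_divide gl tendsto_const) (auto intro!: tendsto_eq_intros)
              have "\<forall>\<^sub>F s in at_right 0. 0 < s \<and> s < d - h"
                using h True by (intro eventually_at_rightI[of 0 "d - h"]) auto
              then show "\<forall>\<^sub>F s in at_right 0. \<bar>(g (x + h) - g (x + (- 1) * s)) / (h + s) - l\<bar> \<le> r / 2"
              proof eventually_elim
                case (elim s)
                then show ?case using d(2)[of "x - s" "x + h"] True by (simp add: sl_def algebra_simps)
              qed
            qed simp
          next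
            case False
            then have "h < 0" using h by auto
            show ?thesis
            proof (rule tendsto_upperbound)
              have "((\<lambda>s. \<bar>(g (x + 1 * s) - g (x + h)) / (s - h) - l\<bar>) \<longlongrightarrow> \<bar>(g x - g (x + h)) / (0 - h) - l\<bar>) (at_right 0)"
                using \<open>h < 0\<close>
                by (intro tendsto_rabs tendsto_diff tendsto_divide gl tendsto_const tendsto_ident_at) auto
              moreover have "(g x - g (x + h)) / (0 - h) = (g (x + h) - g x) / h"
                using \<open>h < 0\<close> by (simp add: field_simps)
              ultimately show "((\<lambda>s. \<bar>(g (x + 1 * s) - g (x + h)) / (s - h) - l\<bar>) \<longlongrightarrow> \<bar>(g (x + h) - g x) / h - l\<bar>) (at_right 0)"
                by simp
              have "\<forall>\<^sub>F s in at_right 0. 0 < s \<and> s < d + h"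
                using h \<open>h < 0\<close> by (intro eventually_at_rightI[of 0 "d + h"]) auto
              then show "\<forall>\<^sub>F s in at_right 0. \<bar>(g (x + 1 * s) - g (x + h)) / (s - h) - l\<bar> \<le> r / 2"
              proof eventually_elim
                case (elim s)
                then show ?case using d(2)[of "x + h" "x + s"] \<open>h < 0\<close> by (simp add: sl_def algebra_simps)
              qed
            qed simp
          qed
          then show ?thesis using \<open>0 < r\<close> by simp
        qed
        then show "\<exists>s>0. \<forall>h. h \<noteq> 0 \<and> norm (h - 0) < s \<longrightarrow> norm ((g (x + h) - g x) / h - l) < r"
          using d(1) by blast
      qed
      then have "((\<lambda>y. g y - L * y) has_real_derivative l - L * 1) (at x)"
        by (intro derivative_intros) auto
      then have "(f has_real_derivative l - L) (at x)" by (simp add: g_def)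
      then show False using nd real_differentiable_def by blast
    qed
  qed
  have "(\<Union>p\<in>\<rat> \<inter> {0<..}. \<Union>q\<in>\<rat> \<inter> {p<..}. E p q) \<in> null_sets lborel"
    using countable_rat by (intro null_sets_UN' neg) (auto intro: countable_Int1)
  then show ?thesis using sub by (meson negligible_iff_null_sets negligible_subset null_sets_completionI)
qed

section \<open>Translation invariance and functions with vanishing test integrals\<close>

lemma integral_lborel_translate:
  fixes f :: "'a::euclidean_space \<Rightarrow> real"
  assumes [measurable]: "f \<in> borel_measurable borel"
  shows "integral\<^sup>L lborel (\<lambda>x. f (x + c)) = integral\<^sup>L lborel f"
proof -
  have "integral\<^sup>L lborel f = integral\<^sup>L (distr lborel borel ((+) c)) f"
    by (simp add: lborel_distr_plus)
  also have "\<dots> = integral\<^sup>L lborel (\<lambda>x. f (c + x))"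
    by (intro integral_distr) auto
  finally show ?thesis by (simp add: add.commute)
qed

lemma nn_integral_lborel_translate:
  fixes f :: "'a::euclidean_space \<Rightarrow> ennreal"
  assumes [measurable]: "f \<in> borel_measurable borel"
  shows "integral\<^sup>N lborel (\<lambda>x. f (x + c)) = integral\<^sup>N lborel f"
proof -
  have "integral\<^sup>N lborel f = integral\<^sup>N (distr lborel borel ((+) c)) f"
    by (simp add: lborel_distr_plus)
  also have "\<dots> = integral\<^sup>N lborel (\<lambda>x. f (c + x))"
    by (intro nn_integral_distr) auto
  finally show ?thesis by (simp add: add.commute)
qed

text \<open>Continuous cutoffs converge boundedly to the indicator of a compact set, so the integral
  of \<open>G\<close> over every compact set vanishes. Compact subsets of
  \<open>{x. G x > 0}\<close> are therefore null, and inner regularity carries this to the whole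
  set.\<close>

lemma AE_nonpos_of_test_integrals:
  fixes G :: "'a::euclidean_space \<Rightarrow> real"
  assumes [measurable]: "G \<in> borel_measurable borel"
    and C: "\<And>x. \<bar>G x\<bar> \<le> C"
    and test: "\<And>\<phi> R. continuous_on UNIV \<phi> \<Longrightarrow> (\<And>x. \<bar>\<phi> x\<bar> \<le> 1) \<Longrightarrow> (\<And>x. norm x > R \<Longrightarrow> \<phi> x = 0) \<Longrightarrow>
       (\<integral>x. G x * \<phi> x \<partial>lborel) = 0"
  shows "AE x in lborel. G x \<le> 0"
proof -
  have C0: "C \<ge> 0" using C[of 0] by auto
  have K0: "(\<integral>x. G x * indicator K x \<partial>lborel) = 0" if K: "compact K" "K \<noteq> {}" for K
  proof -
    obtain R where R: "K \<subseteq> cball 0 R" using compact_imp_bounded[OF K(1)] unfolding bounded_iff by (auto simp: subset_iff)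
    \<comment> \<open>These functions equal 1 on \<open>K\<close> and vanish beyond distance 1 / (j
      + 1) from it, hence all of them vanish outside one ball.\<close>
    define \<phi> where "\<phi> j x = max 0 (1 - real (Suc j) * infdist x K)" for j x
    have cont: "continuous_on UNIV (\<phi> j)" for j
      unfolding \<phi>_def by (intro continuous_intros)
    have b: "\<bar>\<phi> j x\<bar> \<le> 1" for j x by (auto simp: \<phi>_def infdist_nonneg)
    have supp: "\<phi> j x = 0" if "norm x > R + 1" for j x
    proof -
      obtain k where k: "k \<in> K" "infdist x K = dist x k"
        using infdist_attains_inf[OF compact_imp_closed[OF K(1)] K(2)] by blast
      have "norm k \<le> R" using R k by auto
      then have "dist x k \<ge> 1" using that norm_triangle_ineq2[of x k] by (simp add: dist_norm)
      then have "1 \<le> real (Suc j) * infdist x K" unfolding k(2)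
        using mult_mono[of 1 "real (Suc j)" 1 "dist x k"] by simp
      then show ?thesis by (simp add: \<phi>_def)
    qed
    have mphi[measurable]: "\<phi> j \<in> borel_measurable borel" for j
      using cont by (rule borel_measurable_continuous_onI)
    have Ks[measurable]: "K \<in> sets borel" using K by (simp add: borel_closed compact_imp_closed)
    have "(\<lambda>j. \<integral>x. G x * \<phi> j x \<partial>lborel) \<longlonglongrightarrow> (\<integral>x. G x * indicator K x \<partial>lborel)"
    proof (rule integral_dominated_convergence[where w="\<lambda>x. C * indicator (cball 0 (R + 1)) x"])
      show "integrable lborel (\<lambda>x. C * indicat_real (cball 0 (R + 1)) x)"
        by (auto intro!: integrable_mult_right integrable_real_indicator emeasure_lborel_cball_finite)
      show "AE x in lborel. (\<lambda>i. G x * \<phi> i x) \<longlonglongrightarrow> G x * indicat_real K x"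
      proof (intro AE_I2 tendsto_mult tendsto_const)
        fix x
        show "(\<lambda>i. \<phi> i x) \<longlonglongrightarrow> indicat_real K x"
        proof (cases "x \<in> K")
          case True then show ?thesis by (simp add: \<phi>_def)
        next
          case False
          then have p: "infdist x K > 0"
            using K in_closed_iff_infdist_zero[of K x] infdist_nonneg[of x K] compact_imp_closed[of K]
            by (auto simp: less_le)
          obtain n :: nat where n: "1 / infdist x K < n" using reals_Archimedean2 by blast
          have "\<phi> i x = 0" if "i \<ge> n" for i
          proof -
            have "1 / infdist x K < real (Suc i)" using n that by linarith
            then have "1 < real (Suc i) * infdist x K" using p by (simp add: field_simps)
            then show ?thesis by (simp add: \<phi>_def)
          qed
          then have "\<forall>\<^sub>F i in sequentially. \<phi> i x = indicat_real K x"
            using False eventually_sequentially by auto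
          then show ?thesis by (rule tendsto_eventually)
        qed
      qed
      show "AE x in lborel. norm (G x * \<phi> i x) \<le> C * indicat_real (cball 0 (R + 1)) x" for i
      proof (rule AE_I2)
        fix x show "norm (G x * \<phi> i x) \<le> C * indicat_real (cball 0 (R + 1)) x"
          using C[of x] b[of i x] supp[of x i] C0 mult_mono[of "\<bar>G x\<bar>" C "\<bar>\<phi> i x\<bar>" 1]
          by (cases "norm x > R + 1") (auto simp: abs_mult indicator_def)
      qed
    qed auto
    moreover have "(\<integral>x. G x * \<phi> j x \<partial>lborel) = 0" for j
      by (rule test[OF cont b supp])
    ultimately show ?thesis by (simp add: LIMSEQ_const_iff)
  qed
  have A: "{x. G x > 0} \<inter> cball 0 r \<in> null_sets lborel" for r
  proof -
    let ?A = "{x. G x > 0} \<inter> cball 0 r"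
    have As[measurable]: "?A \<in> sets borel" by measurable
    have "emeasure lborel ?A \<le> 0"
    proof (rule ennreal_le_epsilon)
      fix e :: real assume "e > 0"
      have "?A \<in> sets lebesgue" using As by (intro sets_completionI_sets) simp
      then obtain T where T: "closed T" "T \<subseteq> ?A" "?A - T \<in> lmeasurable" "emeasure lebesgue (?A - T) < ennreal e"
        using \<open>e > 0\<close> by (rule sets_lebesgue_inner_closed)
      have Tc: "compact T" using T(1,2)
        by (meson bounded_cball bounded_subset compact_eq_bounded_closed inf_le2 subset_trans)
      have Ts[measurable]: "T \<in> sets borel" using T by auto
      have "emeasure lborel T = 0"
      proof (cases "T = {}")
        case False
        have int: "integrable lborel (\<lambda>x. G x * indicat_real T x)"
        proof (rule Bochner_Integration.integrable_bound[where f="\<lambda>x. C * indicat_real T x"])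
          show "integrable lborel (\<lambda>x. C * indicat_real T x)"
            by (auto intro!: integrable_mult_right integrable_real_indicator emeasure_compact_finite Tc)
        qed (use C C0 in \<open>auto simp: indicator_def\<close>)
        have "AE x in lborel. G x * indicat_real T x = 0"
          using K0[OF Tc False] T(2)
          by (subst integral_nonneg_eq_0_iff_AE[OF int, symmetric])
            (auto simp: indicator_def intro!: AE_I2 less_imp_le)
        then have "AE x in lborel. x \<notin> T"
          by eventually_elim (use T(2) in \<open>auto simp: indicator_def\<close>)
        then show ?thesis using AE_iff_null_sets[of T lborel] Ts by (auto dest: null_setsD1)
      qed simp
      have "?A = T \<union> (?A - T)" using T by auto
      then have "emeasure lborel ?A \<le> emeasure lborel T + emeasure lborel (?A - T)"
        using emeasure_subadditive[of T lborel "?A - T"] by (auto simp: Ts As)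
      also have "\<dots> \<le> ennreal e" using \<open>emeasure lborel T = 0\<close> T(4)
        by (simp add: emeasure_completion less_imp_le)
      finally show "emeasure lborel ?A \<le> 0 + ennreal e" by simp
    qed
    then show ?thesis using As by (auto simp: null_sets_def)
  qed
  have "{x. G x > 0} = (\<Union>n::nat. {x. G x > 0} \<inter> cball 0 (real n))"
    by (auto intro: real_arch_simple)
  moreover have "(\<Union>n::nat. {x. G x > 0} \<inter> cball 0 (real n)) \<in> null_sets lborel"
    by (intro null_sets_UN A)
  ultimately have "{x. G x > 0} \<in> null_sets lborel" by simp
  then show ?thesis by (intro AE_I'[of "{x. G x > 0}"]) auto
qed

lemma AE_zero_of_test_integrals:
  fixes G :: "'a::euclidean_space \<Rightarrow> real"
  assumes [measurable]: "G \<in> borel_measurable borel"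
    and C: "\<And>x. \<bar>G x\<bar> \<le> C"
    and test: "\<And>\<phi> R. continuous_on UNIV \<phi> \<Longrightarrow> (\<And>x. \<bar>\<phi> x\<bar> \<le> 1) \<Longrightarrow> (\<And>x. norm x > R \<Longrightarrow> \<phi> x = 0) \<Longrightarrow>
       (\<integral>x. G x * \<phi> x \<partial>lborel) = 0"
  shows "AE x in lborel. G x = 0"
proof -
  have "AE x in lborel. G x \<le> 0" by (rule AE_nonpos_of_test_integrals[OF assms])
  moreover have "AE x in lborel. - G x \<le> 0"
  proof (rule AE_nonpos_of_test_integrals[where C=C])
    fix \<phi> :: "'a \<Rightarrow> real" and R
    assume "continuous_on UNIV \<phi>" "\<And>x. \<bar>\<phi> x\<bar> \<le> 1" "\<And>x. norm x > R \<Longrightarrow> \<phi> x = 0"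
    from test[OF this] show "(\<integral>x. - G x * \<phi> x \<partial>lborel) = 0" by simp
  qed (use C in auto)
  ultimately show ?thesis by eventually_elim auto
qed


section \<open>Directional derivatives and differentiability in several variables\<close>

text \<open>Only the steps 1 / (n + 1) are used: a countable family, so that the limit
  \<open>dlim\<close> is Borel on the whole space, whatever value \<open>lim\<close> returns where
  no limit exists.\<close>

definition dquot :: "('a::euclidean_space \<Rightarrow> real) \<Rightarrow> 'a \<Rightarrow> nat \<Rightarrow> 'a \<Rightarrow> real" where
  "dquot F e n x = (F (x + (1 / real (Suc n)) *\<^sub>R e) - F x) * real (Suc n)"

definition dlim :: "('a::euclidean_space \<Rightarrow> real) \<Rightarrow> 'a \<Rightarrow> 'a \<Rightarrow> real" where
  "dlim F e x = lim (\<lambda>n. dquot F e n x)"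

lemma dquot_tendsto:
  assumes "((\<lambda>t. F (x + t *\<^sub>R e)) has_real_derivative d) (at 0)"
  shows "(\<lambda>n. dquot F e n x) \<longlonglongrightarrow> d"
proof -
  have "((\<lambda>h. (F (x + (0 + h) *\<^sub>R e) - F (x + 0 *\<^sub>R e)) / h) \<longlongrightarrow> d) (at 0)"
    using assms unfolding DERIV_def .
  moreover have "filterlim (\<lambda>n. 1 / real (Suc n)) (at 0) sequentially"
    unfolding filterlim_at using LIMSEQ_inverse_real_of_nat by (auto simp: inverse_eq_divide)
  ultimately have "(\<lambda>n. (F (x + (0 + 1 / real (Suc n)) *\<^sub>R e) - F (x + 0 *\<^sub>R e)) / (1 / real (Suc n))) \<longlonglongrightarrow> d"
    by (rule filterlim_compose)
  then show ?thesis by (simp add: dquot_def[abs_def])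
qed

lemma dlim_eq:
  assumes "((\<lambda>t. F (x + t *\<^sub>R e)) has_real_derivative d) (at 0)"
  shows "dlim F e x = d"
  unfolding dlim_def using dquot_tendsto[OF assms] by (rule limI)

text \<open>The Cauchy form does not mention the derivative and uses a non-strict inequality; the
  measurability of the set of differentiability points rests on both.\<close>

lemma real_differentiable_at_0_iff_Cauchy:
  fixes f :: "real \<Rightarrow> real"
  shows "f differentiable (at 0) \<longleftrightarrow>
    (\<forall>e>0. \<exists>d>0. \<forall>s t. s \<noteq> 0 \<longrightarrow> t \<noteq> 0 \<longrightarrow> \<bar>s\<bar> < d \<longrightarrow> \<bar>t\<bar> < d \<longrightarrow> \<bar>(f s - f 0) / s - (f t - f 0) / t\<bar> \<le> e)"
    (is "_ = ?C")
proof
  assume "f differentiable (at 0)"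
  then obtain l where "(f has_real_derivative l) (at 0)" by (auto simp: real_differentiable_def)
  then have l: "((\<lambda>h. (f h - f 0) / h) \<longlongrightarrow> l) (at 0)" by (simp add: DERIV_def)
  show ?C
  proof (intro allI impI)
    fix e :: real assume "e > 0"
    then obtain d where d: "d > 0" "\<And>h. h \<noteq> 0 \<Longrightarrow> \<bar>h\<bar> < d \<Longrightarrow> \<bar>(f h - f 0) / h - l\<bar> < e / 2"
      using LIM_D[OF l, of "e / 2"] by auto
    show "\<exists>d>0. \<forall>s t. s \<noteq> 0 \<longrightarrow> t \<noteq> 0 \<longrightarrow> \<bar>s\<bar> < d \<longrightarrow> \<bar>t\<bar> < d \<longrightarrow> \<bar>(f s - f 0) / s - (f t - f 0) / t\<bar> \<le> e"
    proof (intro exI[of _ d] conjI allI impI d(1))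
      fix s t :: real assume "s \<noteq> 0" "t \<noteq> 0" "\<bar>s\<bar> < d" "\<bar>t\<bar> < d"
      then show "\<bar>(f s - f 0) / s - (f t - f 0) / t\<bar> \<le> e" using d(2)[of s] d(2)[of t] by linarith
    qed
  qed
next
  assume C: ?C
  define q where "q h = (f h - f 0) / h" for h
  have "\<exists>l. (q \<longlongrightarrow> l) (at 0)"
  proof -
    have "cauchy_filter (filtermap q (at 0))"
      unfolding cauchy_filter_metric
    proof (intro allI impI)
      fix e :: real assume "e > 0"
      then obtain d where d: "d > 0" "\<And>s t. s \<noteq> 0 \<Longrightarrow> t \<noteq> 0 \<Longrightarrow> \<bar>s\<bar> < d \<Longrightarrow> \<bar>t\<bar> < d \<Longrightarrow> \<bar>q s - q t\<bar> \<le> e / 2"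
        using C unfolding q_def by (meson half_gt_zero)
      show "\<exists>P. eventually P (filtermap q (at 0)) \<and> (\<forall>x y. P x \<and> P y \<longrightarrow> dist x y < e)"
      proof (intro exI[of _ "\<lambda>y. \<exists>s. s \<noteq> 0 \<and> \<bar>s\<bar> < d \<and> y = q s"] conjI allI impI)
        show "\<forall>\<^sub>F y in filtermap q (at 0). \<exists>s. s \<noteq> 0 \<and> \<bar>s\<bar> < d \<and> y = q s"
          unfolding eventually_filtermap eventually_at using d(1)
          by (intro exI[of _ d]) (auto simp: dist_real_def)
        fix x y assume "(\<exists>s. s \<noteq> 0 \<and> \<bar>s\<bar> < d \<and> x = q s) \<and> (\<exists>s. s \<noteq> 0 \<and> \<bar>s\<bar> < d \<and> y = q s)"
        then show "dist x y < e" using d(2) \<open>e > 0\<close> by (force simp: dist_real_def)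
      qed
    qed
    then have "\<exists>l. filtermap q (at 0) \<le> nhds l"
      using complete_uniform[of "UNIV :: real set", THEN iffD1, OF complete_UNIV, rule_format, of "filtermap q (at 0)"]
      by (simp add: filtermap_bot_iff)
    then show ?thesis by (simp add: filterlim_def)
  qed
  then show "f differentiable (at 0)" unfolding real_differentiable_def DERIV_def q_def[abs_def] by simp
qed

context
  fixes F :: "'a::euclidean_space \<Rightarrow> real" and L :: real
  assumes F: "L-lipschitz_on UNIV F"
begin

lemma lipschitz_abs_diff: "\<bar>F x - F y\<bar> \<le> L * norm (x - y)"
  using lipschitz_onD[OF F, of x y] by (simp add: dist_norm)

lemma lipschitz_const_nonneg: "L \<ge> 0" using F by (rule lipschitz_on_nonneg)

lemma lipschitz_measurable [measurable]: "F \<in> borel_measurable borel"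
  using lipschitz_on_continuous_on[OF F] by (rule borel_measurable_continuous_onI)

lemma dquot_measurable [measurable]: "dquot F e n \<in> borel_measurable borel"
  unfolding dquot_def[abs_def] by measurable

lemma dlim_measurable [measurable]: "dlim F e \<in> borel_measurable borel"
  unfolding dlim_def[abs_def] by measurable

lemma dquot_bound: "\<bar>dquot F e n x\<bar> \<le> L * norm e"
proof -
  have "\<bar>dquot F e n x\<bar> = \<bar>F (x + (1 / real (Suc n)) *\<^sub>R e) - F x\<bar> * real (Suc n)"
    by (simp add: dquot_def abs_mult)
  also have "\<dots> \<le> (L * norm ((1 / real (Suc n)) *\<^sub>R e)) * real (Suc n)"
    using lipschitz_abs_diff[of "x + (1 / real (Suc n)) *\<^sub>R e" x] by (intro mult_right_mono) auto
  also have "\<dots> = L * norm e" by simp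
  finally show ?thesis .
qed

lemma continuous_lipschitz_line: "continuous_on UNIV (\<lambda>x. F (x + t *\<^sub>R e))"
  by (intro continuous_on_compose2[OF lipschitz_on_continuous_on[OF F]] continuous_intros) auto

text \<open>The set is a countable combination of the closed sets \<open>B m k\<close>; closedness,
  unlike measurability, survives the intersection over the uncountably many step sizes in
  \<open>S k\<close>.\<close>

lemma directional_derivative_set_borel: "{x. (\<lambda>t. F (x + t *\<^sub>R e)) differentiable (at 0)} \<in> sets borel"
proof -
  define q where "q x s = (F (x + s *\<^sub>R e) - F x) / s" for x s
  have qc: "continuous_on UNIV (\<lambda>x. q x s)" if "s \<noteq> 0" for s
    unfolding q_def using that by (intro continuous_intros continuous_lipschitz_line lipschitz_on_continuous_on[OF F]) auto
  define S where "S k = {s::real. s \<noteq> 0 \<and> \<bar>s\<bar> < 1 / real (Suc k)}" for k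
  define B where "B m k = {x. \<forall>s\<in>S k. \<forall>t\<in>S k. \<bar>q x s - q x t\<bar> \<le> 1 / real (Suc m)}" for m k
  have "(\<lambda>t. F (x + t *\<^sub>R e)) differentiable (at 0) \<longleftrightarrow> (\<forall>m. \<exists>k. x \<in> B m k)" for x
  proof
    assume "(\<lambda>t. F (x + t *\<^sub>R e)) differentiable (at 0)"
    then have c: "\<forall>e>0. \<exists>d>0. \<forall>s t. s \<noteq> 0 \<longrightarrow> t \<noteq> 0 \<longrightarrow> \<bar>s\<bar> < d \<longrightarrow> \<bar>t\<bar> < d \<longrightarrow> \<bar>q x s - q x t\<bar> \<le> e"
      by (simp add: real_differentiable_at_0_iff_Cauchy q_def)
    show "\<forall>m. \<exists>k. x \<in> B m k"
    proof
      fix m :: nat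
      obtain d where d: "d > 0" "\<And>s t. s \<noteq> 0 \<Longrightarrow> t \<noteq> 0 \<Longrightarrow> \<bar>s\<bar> < d \<Longrightarrow> \<bar>t\<bar> < d \<Longrightarrow> \<bar>q x s - q x t\<bar> \<le> 1 / real (Suc m)"
        using c[rule_format, of "1 / real (Suc m)"] by auto
      obtain k where "1 / Suc k < d" using d(1) nat_approx_posE by blast
      then have "x \<in> B m k" unfolding B_def S_def using d(2) by (simp add: less_trans)
      then show "\<exists>k. x \<in> B m k" ..
    qed
  next
    assume B: "\<forall>m. \<exists>k. x \<in> B m k"
    have "\<exists>d>0. \<forall>s t. s \<noteq> 0 \<longrightarrow> t \<noteq> 0 \<longrightarrow> \<bar>s\<bar> < d \<longrightarrow> \<bar>t\<bar> < d \<longrightarrow> \<bar>q x s - q x t\<bar> \<le> e" if "e > 0" for e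
    proof -
      obtain m where m: "1 / Suc m < e" using \<open>e > 0\<close> nat_approx_posE by blast
      obtain k where k: "x \<in> B m k" using B by blast
      show ?thesis
      proof (intro exI[of _ "1 / Suc k"] conjI allI impI)
        fix s t :: real assume "s \<noteq> 0" "t \<noteq> 0" "\<bar>s\<bar> < 1 / real (Suc k)" "\<bar>t\<bar> < 1 / real (Suc k)"
        then have "\<bar>q x s - q x t\<bar> \<le> 1 / real (Suc m)" using k unfolding B_def S_def by blast
        then show "\<bar>q x s - q x t\<bar> \<le> e" using m by linarith
      qed simp
    qed
    then show "(\<lambda>t. F (x + t *\<^sub>R e)) differentiable (at 0)" by (simp add: real_differentiable_at_0_iff_Cauchy q_def)
  qed
  then have "{x. (\<lambda>t. F (x + t *\<^sub>R e)) differentiable (at 0)} = (\<Inter>m. \<Union>k. B m k)" by auto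
  also have "\<dots> \<in> sets borel"
  proof (intro sets.countable_INT'' sets.countable_UN'' borel_closed)
    fix m k :: nat
    have "B m k = (\<Inter>s\<in>S k. \<Inter>t\<in>S k. {x. \<bar>q x s - q x t\<bar> \<le> 1 / real (Suc m)})" by (auto simp: B_def)
    moreover have "closed {x. \<bar>q x s - q x t\<bar> \<le> 1 / real (Suc m)}" if "s \<in> S k" "t \<in> S k" for s t
      using that by (intro closed_Collect_le continuous_intros qc) (auto simp: S_def)
    ultimately show "closed (B m k)" by (simp add: closed_INT)
  qed auto
  finally show ?thesis .
qed

text \<open>Averaging over translates along \<open>e\<close> replaces Fubini in coordinates adapted to \<open>e\<close>.\<close>

lemma AE_directional_derivative:
  "AE x in lborel. (\<lambda>t. F (x + t *\<^sub>R e)) differentiable (at 0)"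
proof -
  define N where "N = {x. \<not> (\<lambda>t. F (x + t *\<^sub>R e)) differentiable (at 0)}"
  have "N = UNIV - {x. (\<lambda>t. F (x + t *\<^sub>R e)) differentiable (at 0)}" by (auto simp: N_def)
  then have N[measurable]: "N \<in> sets borel" using directional_derivative_set_borel by auto
  \<comment> \<open>Restricted to a line parallel to \<open>e\<close> the function is Lipschitz on
    the reals, so each line meets \<open>N\<close> in a null set of parameters.\<close>
  have sl: "(\<integral>\<^sup>+ t. indicator {0..1} t * indicator N (x + t *\<^sub>R e) \<partial>lborel) = 0" for x
  proof -
    define f where "f t = F (x + t *\<^sub>R e)" for t
    have "(L * norm e)-lipschitz_on UNIV f"
    proof (rule lipschitz_onI)
      fix s t :: real
      have "\<bar>f s - f t\<bar> \<le> L * norm ((x + s *\<^sub>R e) - (x + t *\<^sub>R e))"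
        unfolding f_def by (rule lipschitz_abs_diff)
      also have "(x + s *\<^sub>R e) - (x + t *\<^sub>R e) = (s - t) *\<^sub>R e" by (simp add: algebra_simps)
      finally show "dist (f s) (f t) \<le> L * norm e * dist s t" by (simp add: dist_real_def mult_ac)
    qed (simp add: lipschitz_const_nonneg)
    then have neg: "negligible {t. \<not> f differentiable (at t)}"
      by (rule negligible_not_differentiable_lipschitz_real)
    have sub: "{t. x + t *\<^sub>R e \<in> N} \<subseteq> {t. \<not> f differentiable (at t)}"
    proof
      fix t assume "t \<in> {t. x + t *\<^sub>R e \<in> N}"
      then have nd: "\<not> (\<lambda>s. F (x + t *\<^sub>R e + s *\<^sub>R e)) differentiable (at 0)" by (simp add: N_def)
      have "(\<lambda>s. F (x + t *\<^sub>R e + s *\<^sub>R e)) = (\<lambda>s. f (t + s))" by (auto simp: f_def algebra_simps)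
      then have "\<not> (\<lambda>s. f (t + s)) differentiable (at 0)" using nd by simp
      moreover have "(\<lambda>s. f (t + s)) differentiable (at 0)" if "f differentiable (at t)"
        using that differentiable_chain_at[of "\<lambda>s. t + s" 0 f] by (simp add: o_def)
      ultimately show "t \<in> {t. \<not> f differentiable (at t)}" by blast
    qed
    have s: "{t. x + t *\<^sub>R e \<in> N} \<in> sets borel" by measurable
    have "negligible {t. x + t *\<^sub>R e \<in> N}" using neg sub by (rule negligible_subset)
    then have "{t. x + t *\<^sub>R e \<in> N} \<in> null_sets lborel"
      using s by (auto simp: negligible_iff_null_sets null_sets_def emeasure_completion)
    then have "AE t in lborel. x + t *\<^sub>R e \<notin> N" by (rule AE_I') auto
    then have "AE t in lborel. indicator {0..1} t * indicator N (x + t *\<^sub>R e) = (0::ennreal)"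
      by eventually_elim auto
    then show ?thesis by (simp add: nn_integral_0_iff_AE)
  qed
  have "emeasure lborel N = (\<integral>\<^sup>+ t. indicator {0..1::real} t * emeasure lborel N \<partial>lborel)"
    by (simp add: nn_integral_multc)
  also have "\<dots> = (\<integral>\<^sup>+ t. (\<integral>\<^sup>+ x. indicator {0..1} t * indicator N (x + t *\<^sub>R e) \<partial>lborel) \<partial>lborel)"
  proof (rule nn_integral_cong)
    fix t :: real
    have "emeasure lborel N = (\<integral>\<^sup>+ x. indicator N (x + t *\<^sub>R e) \<partial>lborel)"
      using nn_integral_lborel_translate[of "indicator N" "t *\<^sub>R e"] N by simp
    then show "indicator {0..1} t * emeasure lborel N = (\<integral>\<^sup>+ x. indicator {0..1} t * indicator N (x + t *\<^sub>R e) \<partial>lborel)"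
      by (simp add: nn_integral_cmult)
  qed
  also have "\<dots> = (\<integral>\<^sup>+ x. (\<integral>\<^sup>+ t. indicator {0..1} t * indicator N (x + t *\<^sub>R e) \<partial>lborel) \<partial>lborel)"
    by (intro lborel_pair.Fubini') measurable
  also have "\<dots> = 0" by (simp add: sl)
  finally have "N \<in> null_sets lborel" using N by (auto simp: null_sets_def)
  then show ?thesis by (rule AE_I') (auto simp: N_def)
qed


text \<open>Dominated convergence: the quotients are bounded by \<open>L * norm e\<close>, and
  enlarging the support radius by \<open>norm c\<close> covers all the translates of
  \<open>\<phi>\<close>. The moving argument of \<open>\<phi>\<close> is what a change of variables
  leaves behind when a quotient is translated.\<close>

lemma integral_dquot_tendsto:
  assumes \<phi>: "continuous_on UNIV \<phi>" "\<And>x. \<bar>\<phi> x\<bar> \<le> 1" "\<And>x. norm x > R \<Longrightarrow> \<phi> x = 0"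
  shows "(\<lambda>n. \<integral>x. dquot F e n x * \<phi> (x - (1 / real (Suc n)) *\<^sub>R c) \<partial>lborel)
    \<longlonglongrightarrow> (\<integral>x. dlim F e x * \<phi> x \<partial>lborel)"
proof (rule integral_dominated_convergence[where w="\<lambda>x. (L * norm e) * indicator (cball 0 (R + norm c)) x"])
  have m[measurable]: "\<phi> \<in> borel_measurable borel"
    using \<phi>(1) by (rule borel_measurable_continuous_onI)
  show "(\<lambda>x. dlim F e x * \<phi> x) \<in> borel_measurable lborel" by measurable
  show "(\<lambda>x. dquot F e n x * \<phi> (x - (1 / real (Suc n)) *\<^sub>R c)) \<in> borel_measurable lborel" for n by measurable
  show "integrable lborel (\<lambda>x. (L * norm e) * indicat_real (cball 0 (R + norm c)) x)"
    by (auto intro!: integrable_mult_right integrable_real_indicator emeasure_lborel_cball_finite)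
  show "AE x in lborel. (\<lambda>n. dquot F e n x * \<phi> (x - (1 / real (Suc n)) *\<^sub>R c)) \<longlonglongrightarrow> dlim F e x * \<phi> x"
    using AE_directional_derivative[of e]
  proof eventually_elim
    case (elim x)
    then obtain d where "((\<lambda>t. F (x + t *\<^sub>R e)) has_real_derivative d) (at 0)" by (auto simp: real_differentiable_def)
    then have 1: "(\<lambda>n. dquot F e n x) \<longlonglongrightarrow> dlim F e x" using dquot_tendsto dlim_eq by metis
    have "(\<lambda>n. x - (1 / real (Suc n)) *\<^sub>R c) \<longlonglongrightarrow> x - 0 *\<^sub>R c"
      using LIMSEQ_inverse_real_of_nat by (intro tendsto_intros) (simp add: inverse_eq_divide)
    then have "(\<lambda>n. x - (1 / real (Suc n)) *\<^sub>R c) \<longlonglongrightarrow> x" by simp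
    moreover have "isCont \<phi> x" using \<phi>(1) by (simp add: continuous_on_eq_continuous_at)
    ultimately have "(\<lambda>n. \<phi> (x - (1 / real (Suc n)) *\<^sub>R c)) \<longlonglongrightarrow> \<phi> x"
      by (rule isCont_tendsto_compose[rotated])
    with 1 show ?case by (intro tendsto_mult)
  qed
  show "AE x in lborel. norm (dquot F e n x * \<phi> (x - (1 / real (Suc n)) *\<^sub>R c)) \<le> (L * norm e) * indicat_real (cball 0 (R + norm c)) x" for n
  proof (rule AE_I2)
    fix x
    let ?y = "x - (1 / real (Suc n)) *\<^sub>R c"
    have b: "\<bar>dquot F e n x\<bar> * \<bar>\<phi> ?y\<bar> \<le> (L * norm e) * 1"
      using dquot_bound \<phi>(2) lipschitz_const_nonneg by (intro mult_mono) auto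
    show "norm (dquot F e n x * \<phi> ?y) \<le> (L * norm e) * indicat_real (cball 0 (R + norm c)) x"
    proof (cases "x \<in> cball 0 (R + norm c)")
      case True then show ?thesis using b by (simp add: abs_mult)
    next
      case False
      have "norm ((1 / real (Suc n)) *\<^sub>R c) \<le> norm c" by (simp add: divide_simps) (simp add: algebra_simps)
      then have "norm ?y > R" using False norm_triangle_ineq2[of x "(1 / real (Suc n)) *\<^sub>R c"] by auto
      then show ?thesis using \<phi>(3) False by simp
    qed
  qed
qed

lemma abs_dlim_le:
  assumes "(\<lambda>t. F (x + t *\<^sub>R e)) differentiable (at 0)"
  shows "\<bar>dlim F e x\<bar> \<le> L * norm e"
proof -
  obtain d where "((\<lambda>t. F (x + t *\<^sub>R e)) has_real_derivative d) (at 0)"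
    using assms by (auto simp: real_differentiable_def)
  then have "(\<lambda>n. dquot F e n x) \<longlonglongrightarrow> dlim F e x" using dquot_tendsto dlim_eq by metis
  then have "(\<lambda>n. \<bar>dquot F e n x\<bar>) \<longlonglongrightarrow> \<bar>dlim F e x\<bar>" by (rule tendsto_rabs)
  then show ?thesis by (rule LIMSEQ_le_const2) (auto simp: dquot_bound)
qed

text \<open>The difference quotient in direction \<open>e + c\<close> is the one in direction \<open>c\<close> plus a translate of the
  one in direction \<open>e\<close>. Integrated against a continuous \<open>\<phi>\<close>, the translation moves to \<open>\<phi>\<close> and
  disappears in the limit; no derivative of \<open>\<phi>\<close> is needed.\<close>

lemma AE_dlim_add: "AE x in lborel. dlim F (e + c) x = dlim F e x + dlim F c x"
proof -
  define B where "B = L * norm (e + c) + L * norm e + L * norm c"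
  \<comment> \<open>Off the set of differentiability \<open>dlim\<close> carries no bound, so the
    difference is clamped to be bounded everywhere; almost everywhere the clamp is inactive.\<close>
  define G where "G x = max (- B) (min B (dlim F (e + c) x - dlim F e x - dlim F c x))" for x
  have B0: "B \<ge> 0" using lipschitz_const_nonneg by (simp add: B_def)
  have Gm[measurable]: "G \<in> borel_measurable borel" unfolding G_def[abs_def] by measurable
  have GE: "AE x in lborel. G x = dlim F (e + c) x - dlim F e x - dlim F c x"
    using AE_directional_derivative[of e] AE_directional_derivative[of c] AE_directional_derivative[of "e + c"]
  proof eventually_elim
    case (elim x)
    then show ?case using abs_dlim_le[of x e] abs_dlim_le[of x c] abs_dlim_le[of x "e + c"]
      unfolding G_def B_def by linarith
  qed
  have "AE x in lborel. G x = 0"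
  proof (rule AE_zero_of_test_integrals[OF Gm, where C=B])
    show "\<bar>G x\<bar> \<le> B" for x unfolding G_def using B0 by linarith
    fix \<phi> :: "'a \<Rightarrow> real" and R
    assume \<phi>: "continuous_on UNIV \<phi>" "\<And>x. \<bar>\<phi> x\<bar> \<le> 1" "\<And>x. norm x > R \<Longrightarrow> \<phi> x = 0"
    have m[measurable]: "\<phi> \<in> borel_measurable borel"
      using \<phi>(1) by (rule borel_measurable_continuous_onI)
    have int: "integrable lborel (\<lambda>x. f x * \<phi> (x - b))"
      if [measurable]: "f \<in> borel_measurable borel" and f: "AE x in lborel. \<bar>f x\<bar> \<le> C" for f C b
    proof (rule Bochner_Integration.integrable_bound[where f="\<lambda>x. C * indicat_real (cball 0 (R + norm b)) x"])
      show "integrable lborel (\<lambda>x. C * indicat_real (cball 0 (R + norm b)) x)"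
        by (auto intro!: integrable_mult_right integrable_real_indicator emeasure_lborel_cball_finite)
      show "AE x in lborel. norm (f x * \<phi> (x - b)) \<le> norm (C * indicat_real (cball 0 (R + norm b)) x)"
        using f
      proof eventually_elim
        case (elim x)
        show ?case
        proof (cases "x \<in> cball 0 (R + norm b)")
          case True
          have "\<bar>f x\<bar> * \<bar>\<phi> (x - b)\<bar> \<le> C * 1" using elim \<phi>(2) by (intro mult_mono) auto
          then show ?thesis using True elim by (simp add: abs_mult)
        next
          case False
          then have "norm (x - b) > R" using norm_triangle_ineq2[of x b] by auto
          then show ?thesis using \<phi>(3) False by simp
        qed
      qed
    qed measurable
    have intq: "integrable lborel (\<lambda>x. dquot F e' n x * \<phi> (x - b))" for e' n b
      by (rule int) (auto intro: dquot_bound)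
    have intl: "integrable lborel (\<lambda>x. dlim F e' x * \<phi> x)" for e'
      using int[of "dlim F e'" "L * norm e'" 0] AE_directional_derivative[of e'] abs_dlim_le[of _ e']
      by (simp add: eventually_mono)
    define h where "h n = (1 / real (Suc n)) *\<^sub>R c" for n
    have split: "(\<integral>x. dquot F (e + c) n x * \<phi> x \<partial>lborel) =
        (\<integral>x. dquot F e n x * \<phi> (x - h n) \<partial>lborel) + (\<integral>x. dquot F c n x * \<phi> x \<partial>lborel)" for n
    proof -
      have "dquot F (e + c) n x = dquot F e n (x + h n) + dquot F c n x" for x
        by (simp add: dquot_def h_def algebra_simps)
      then have "(\<integral>x. dquot F (e + c) n x * \<phi> x \<partial>lborel) =
         (\<integral>x. dquot F e n (x + h n) * \<phi> (x + h n - h n) + dquot F c n x * \<phi> x \<partial>lborel)"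
        by (simp add: algebra_simps)
      also have "\<dots> = (\<integral>x. dquot F e n (x + h n) * \<phi> (x + h n - h n) \<partial>lborel) + (\<integral>x. dquot F c n x * \<phi> x \<partial>lborel)"
      proof (rule Bochner_Integration.integral_add)
        have "integrable (distr lborel borel ((+) (h n))) (\<lambda>x. dquot F e n x * \<phi> (x - h n))"
          using intq by (simp add: lborel_distr_plus)
        then have "integrable lborel (\<lambda>x. dquot F e n (h n + x) * \<phi> (h n + x - h n))"
          by (rule integrable_distr[rotated]) measurable
        then show "integrable lborel (\<lambda>x. dquot F e n (x + h n) * \<phi> (x + h n - h n))"
          by (simp add: add.commute)
        show "integrable lborel (\<lambda>x. dquot F c n x * \<phi> x)" using intq[of c n 0] by simp
      qed
      also have "(\<integral>x. dquot F e n (x + h n) * \<phi> (x + h n - h n) \<partial>lborel) = (\<integral>x. dquot F e n x * \<phi> (x - h n) \<partial>lborel)"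
        by (rule integral_lborel_translate[where f="\<lambda>x. dquot F e n x * \<phi> (x - h n)"]) measurable
      finally show ?thesis .
    qed
    have 1: "(\<lambda>n. \<integral>x. dquot F (e + c) n x * \<phi> x \<partial>lborel) \<longlonglongrightarrow> (\<integral>x. dlim F (e + c) x * \<phi> x \<partial>lborel)"
      using integral_dquot_tendsto[where e="e + c" and c=0, OF \<phi>] by simp
    have 2: "(\<lambda>n. \<integral>x. dquot F c n x * \<phi> x \<partial>lborel) \<longlonglongrightarrow> (\<integral>x. dlim F c x * \<phi> x \<partial>lborel)"
      using integral_dquot_tendsto[where e=c and c=0, OF \<phi>] by simp
    have 3: "(\<lambda>n. \<integral>x. dquot F e n x * \<phi> (x - h n) \<partial>lborel) \<longlonglongrightarrow> (\<integral>x. dlim F e x * \<phi> x \<partial>lborel)"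
      unfolding h_def by (rule integral_dquot_tendsto[OF \<phi>])
    have eq: "(\<integral>x. dlim F (e + c) x * \<phi> x \<partial>lborel) = (\<integral>x. dlim F e x * \<phi> x \<partial>lborel) + (\<integral>x. dlim F c x * \<phi> x \<partial>lborel)"
      using tendsto_add[OF 3 2] unfolding split[symmetric] by (rule LIMSEQ_unique[OF 1])
    have "(\<integral>x. G x * \<phi> x \<partial>lborel) = (\<integral>x. dlim F (e + c) x * \<phi> x - dlim F e x * \<phi> x - dlim F c x * \<phi> x \<partial>lborel)"
      using GE by (intro integral_cong_AE) (measurable, auto elim!: eventually_mono simp: left_diff_distrib)
    also have "\<dots> = 0" using eq by (simp add: intl)
    finally show "(\<integral>x. G x * \<phi> x \<partial>lborel) = 0" .
  qed
  with GE show ?thesis by eventually_elim simp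
qed

lemma AE_dlim_scaleR: "AE x in lborel. dlim F (a *\<^sub>R e) x = a * dlim F e x"
  using AE_directional_derivative[of e]
proof eventually_elim
  case (elim x)
  then obtain d where d: "((\<lambda>t. F (x + t *\<^sub>R e)) has_real_derivative d) (at 0)" by (auto simp: real_differentiable_def)
  have "((\<lambda>t. F (x + (a * t) *\<^sub>R e)) has_real_derivative d * a) (at 0)"
    by (rule DERIV_chain'[where f="\<lambda>t. a * t" and g="\<lambda>t. F (x + t *\<^sub>R e)", THEN DERIV_cong])
       (use d in \<open>auto intro!: derivative_eq_intros\<close>)
  then have "((\<lambda>t. F (x + t *\<^sub>R (a *\<^sub>R e))) has_real_derivative d * a) (at 0)" by (simp add: mult.commute)
  then show ?case using dlim_eq[OF d] dlim_eq by fastforce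
qed

text \<open>The expansion of \<open>e\<close> in the basis is built up one term at a time from
  additivity and homogeneity. The exceptional null set depends on \<open>e\<close>, so the identity
  is later invoked only for countably many directions.\<close>

lemma AE_dlim_linear: "AE x in lborel. dlim F e x = (\<Sum>b\<in>Basis. (e \<bullet> b) * dlim F b x)"
proof -
  have "AE x in lborel. dlim F (\<Sum>b\<in>A. (e \<bullet> b) *\<^sub>R b) x = (\<Sum>b\<in>A. (e \<bullet> b) * dlim F b x)" if "finite A" for A
    using that
  proof (induction A rule: finite_induct)
    case empty
    show ?case by (simp add: dlim_def dquot_def)
  next
    case (insert b A)
    show ?case
      using insert(3) AE_dlim_add[of "(e \<bullet> b) *\<^sub>R b" "\<Sum>b\<in>A. (e \<bullet> b) *\<^sub>R b"] AE_dlim_scaleR[of "e \<bullet> b" b]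
      by eventually_elim (use insert(1,2) in simp)
  qed
  from this[of Basis] show ?thesis by (simp add: euclidean_representation)
qed

text \<open>Outside one null set all directions in a countable dense set \<open>D\<close> have
  derivatives that depend linearly on the direction. Finitely many of them form a fine net of the
  unit ball, which makes the convergence uniform; the Lipschitz bound transfers it to all
  directions.\<close>

theorem rademacher: "negligible {x. \<not> F differentiable (at x)}"
proof -
  obtain D :: "'a set" where D: "countable D" "\<And>X. open X \<Longrightarrow> X \<noteq> {} \<Longrightarrow> \<exists>d\<in>D. d \<in> X"
    using countable_dense_setE by blast
  have "AE x in lborel. \<forall>e\<in>D. (\<lambda>t. F (x + t *\<^sub>R e)) differentiable (at 0)"
    using D(1) by (simp add: AE_ball_countable AE_directional_derivative)
  moreover have "AE x in lborel. \<forall>e\<in>D. dlim F e x = (\<Sum>b\<in>Basis. (e \<bullet> b) * dlim F b x)"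
    using D(1) by (simp add: AE_ball_countable AE_dlim_linear)
  ultimately have "AE x in lborel. F differentiable (at x)"
  proof eventually_elim
    case (elim x)
    define l where "l h = (\<Sum>b\<in>Basis. (h \<bullet> b) * dlim F b x)" for h
    have lin: "linear l"
      by (intro linearI) (simp_all add: l_def inner_add_left algebra_simps sum.distrib sum_distrib_left)
    obtain B where B: "B > 0" "\<And>h. norm (l h) \<le> B * norm h" using linear_bounded_pos[OF lin] by blast
    have dir: "((\<lambda>h. (F (x + h *\<^sub>R e) - F x) / h) \<longlongrightarrow> l e) (at 0)" if "e \<in> D" for e
    proof -
      obtain d where d: "((\<lambda>t. F (x + t *\<^sub>R e)) has_real_derivative d) (at 0)"
        using elim(1) \<open>e \<in> D\<close> by (auto simp: real_differentiable_def)
      moreover have "d = l e" using dlim_eq[OF d] elim(2) that by (simp add: l_def)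
      ultimately show ?thesis by (simp add: DERIV_def)
    qed
    have "(F has_derivative l) (at x)"
      unfolding has_derivative_at_alt
    proof (intro conjI allI impI linear_conv_bounded_linear[THEN iffD1, OF lin])
      fix \<epsilon> :: real assume "\<epsilon> > 0"
      \<comment> \<open>Three errors add up: per unit of \<open>norm (y - x)\<close>, moving the
        point to the net direction costs \<open>L * r\<close>, the quotient in that direction
        \<open>r\<close>, and the linear map \<open>B * r\<close>.\<close>
      define r where "r = \<epsilon> / (L + B + 1)"
      have den: "L + B + 1 > 0" using lipschitz_const_nonneg B(1) by simp
      then have r: "r > 0" using \<open>\<epsilon> > 0\<close> by (simp add: r_def)
      have "cball (0::'a) 1 \<subseteq> (\<Union>e\<in>D. ball e r)"
      proof
        fix u :: 'a
        have "open (ball u r)" "ball u r \<noteq> {}" using r by auto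
        then obtain d where "d \<in> D" "d \<in> ball u r" using D(2) by blast
        then show "u \<in> (\<Union>e\<in>D. ball e r)" by (auto simp: dist_commute)
      qed
      then obtain D0 where D0: "D0 \<subseteq> D" "finite D0" "cball (0::'a) 1 \<subseteq> (\<Union>e\<in>D0. ball e r)"
        using compactE_image[OF compact_cball, of D "\<lambda>e. ball e r" "0::'a" 1] by auto
      have "\<exists>d>0. \<forall>t. t \<noteq> 0 \<and> \<bar>t\<bar> < d \<longrightarrow> \<bar>(F (x + t *\<^sub>R e) - F x) / t - l e\<bar> < r" if "e \<in> D" for e
        using LIM_D[OF dir[OF that] r] by auto
      then obtain \<delta> where \<delta>: "\<And>e. e \<in> D \<Longrightarrow> \<delta> e > 0"
        "\<And>e t. e \<in> D \<Longrightarrow> t \<noteq> 0 \<Longrightarrow> \<bar>t\<bar> < \<delta> e \<Longrightarrow> \<bar>(F (x + t *\<^sub>R e) - F x) / t - l e\<bar> < r"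
        by metis
      define d where "d = Min (insert 1 (\<delta> ` D0))"
      have d: "d > 0" "\<And>e. e \<in> D0 \<Longrightarrow> d \<le> \<delta> e"
        using D0(1,2) \<delta>(1) by (auto simp: d_def)
      show "\<exists>d>0. \<forall>y. norm (y - x) < d \<longrightarrow> norm (F y - F x - l (y - x)) \<le> \<epsilon> * norm (y - x)"
      proof (intro exI[of _ d] conjI allI impI d(1))
        fix y assume y: "norm (y - x) < d"
        define t where "t = norm (y - x)"
        show "norm (F y - F x - l (y - x)) \<le> \<epsilon> * norm (y - x)"
        proof (cases "y = x")
          case True then show ?thesis using linear_0[OF lin] by simp
        next
          case False
          then have t: "t > 0" by (simp add: t_def)
          define u where "u = (1 / t) *\<^sub>R (y - x)"
          have "norm u = 1" using t by (simp add: u_def t_def)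
          then have "u \<in> cball 0 1" by simp
          then obtain e where e: "e \<in> D0" "dist e u < r" using D0(3) by (auto simp: dist_commute)
          have yx: "y = x + t *\<^sub>R u" using t by (simp add: u_def)
          have 1: "\<bar>F y - F (x + t *\<^sub>R e)\<bar> \<le> L * (t * r)"
          proof -
            have "\<bar>F y - F (x + t *\<^sub>R e)\<bar> \<le> L * norm (y - (x + t *\<^sub>R e))" by (rule lipschitz_abs_diff)
            also have "y - (x + t *\<^sub>R e) = t *\<^sub>R (u - e)" by (simp add: yx algebra_simps)
            also have "L * norm (t *\<^sub>R (u - e)) \<le> L * (t * r)"
              using e(2) t lipschitz_const_nonneg by (intro mult_left_mono) (auto simp: dist_norm norm_minus_commute)
            finally show ?thesis .
          qed
          have 2: "\<bar>F (x + t *\<^sub>R e) - F x - t * l e\<bar> \<le> t * r"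
          proof -
            have "\<bar>(F (x + t *\<^sub>R e) - F x) / t - l e\<bar> < r"
              using \<delta>(2)[of e t] e(1) D0(1) d(2)[of e] y t by (auto simp: t_def)
            moreover have "F (x + t *\<^sub>R e) - F x - t * l e = t * ((F (x + t *\<^sub>R e) - F x) / t - l e)"
              using t by (simp add: field_simps)
            ultimately show ?thesis using t by (simp add: abs_mult)
          qed
          have 3: "\<bar>t * l e - l (y - x)\<bar> \<le> B * (t * r)"
          proof -
            have "t * l e - l (y - x) = l (t *\<^sub>R (e - u))"
              by (simp add: yx linear_diff[OF lin] linear_scale[OF lin] algebra_simps)
            then have "\<bar>t * l e - l (y - x)\<bar> \<le> B * norm (t *\<^sub>R (e - u))" using B(2) by (metis real_norm_def)
            also have "\<dots> \<le> B * (t * r)"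
              using e(2) t B(1) by (intro mult_left_mono) (auto simp: dist_norm)
            finally show ?thesis .
          qed
          have "\<bar>F y - F x - l (y - x)\<bar> \<le> L * (t * r) + t * r + B * (t * r)" using 1 2 3 by linarith
          also have "\<dots> = (L + B + 1) * r * t" by (simp add: algebra_simps)
          also have "\<dots> = \<epsilon> * t" using den by (simp add: r_def)
          finally show ?thesis by (simp add: t_def)
        qed
      qed
    qed
    then show ?case by (rule differentiableI)
  qed
  then obtain N where "{x. \<not> F differentiable (at x)} \<subseteq> N" "N \<in> null_sets lborel"
    by (auto elim!: AE_E simp: null_sets_def)
  then show ?thesis by (meson negligible_iff_null_sets negligible_subset null_sets_completionI)
qed

end

section \<open>Second order expansions of convex functions\<close>

corollary rademacher_vector:
  fixes T :: "'a::euclidean_space \<Rightarrow> 'b::euclidean_space"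
  assumes T: "L-lipschitz_on UNIV T"
  shows "negligible {x. \<not> T differentiable (at x)}"
proof -
  have "L-lipschitz_on UNIV (\<lambda>x. T x \<bullet> b)" if "b \<in> Basis" for b
  proof (rule lipschitz_onI)
    fix x y
    have "\<bar>T x \<bullet> b - T y \<bullet> b\<bar> \<le> norm (T x - T y)"
      using Basis_le_norm[OF that, of "T x - T y"] by (simp add: inner_diff_left)
    also have "\<dots> \<le> L * dist x y" using lipschitz_onD[OF T, of x y] by (simp add: dist_norm)
    finally show "dist (T x \<bullet> b) (T y \<bullet> b) \<le> L * dist x y" by (simp add: dist_real_def)
  qed (rule lipschitz_on_nonneg[OF T])
  then have "negligible (\<Union>b\<in>Basis. {x. \<not> (\<lambda>x. T x \<bullet> b) differentiable (at x)})"
    by (intro negligible_Union) (auto intro: rademacher)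
  moreover have "{x. \<not> T differentiable (at x)} \<subseteq> (\<Union>b\<in>Basis. {x. \<not> (\<lambda>x. T x \<bullet> b) differentiable (at x)})"
    using differentiable_componentwise_within[of T] by auto
  ultimately show ?thesis by (rule negligible_subset)
qed

section \<open>Subgradients and the proximal map\<close>

definition subgradient :: "('a::real_inner \<Rightarrow> real) \<Rightarrow> 'a \<Rightarrow> 'a \<Rightarrow> bool" where
  "subgradient H z p \<longleftrightarrow> (\<forall>w. H z + p \<bullet> (w - z) \<le> H w)"

lemma subgradient_monotone:
  assumes "subgradient H z p" "subgradient H w q"
  shows "0 \<le> (p - q) \<bullet> (z - w)"
proof -
  have "H z + p \<bullet> (w - z) \<le> H w" "H w + q \<bullet> (z - w) \<le> H z"
    using assms by (auto simp: subgradient_def)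
  then show ?thesis by (simp add: algebra_simps inner_diff_left inner_diff_right)
qed

text \<open>Weighting the two support inequalities at the intermediate point cancels their linear
  terms. Existence of subgradients is the form in which convexity is available later, since the
  sup-convolution comes with explicit ones.\<close>

lemma convex_on_of_subgradients:
  assumes "\<And>z. \<exists>p. subgradient H z p"
  shows "convex_on UNIV H"
proof (rule convex_onI)
  fix t :: real and x y :: 'a assume t: "0 < t" "t < 1"
  define z where "z = (1 - t) *\<^sub>R x + t *\<^sub>R y"
  obtain p where p: "subgradient H z p" using assms by blast
  have 1: "H z + p \<bullet> (x - z) \<le> H x" "H z + p \<bullet> (y - z) \<le> H y" using p by (auto simp: subgradient_def)
  have "(1 - t) * (H z + p \<bullet> (x - z)) + t * (H z + p \<bullet> (y - z)) \<le> (1 - t) * H x + t * H y"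
    using 1 t by (intro add_mono mult_left_mono) auto
  moreover have "(1 - t) * (H z + p \<bullet> (x - z)) + t * (H z + p \<bullet> (y - z))
      = H z + p \<bullet> ((1 - t) *\<^sub>R (x - z) + t *\<^sub>R (y - z))"
    by (simp add: inner_add_right algebra_simps)
  moreover have "(1 - t) *\<^sub>R (x - z) + t *\<^sub>R (y - z) = 0" by (simp add: z_def algebra_simps)
  ultimately show "H ((1 - t) *\<^sub>R x + t *\<^sub>R y) \<le> (1 - t) * H x + t * H y" by (simp add: z_def)
qed simp

text \<open>The point \<open>z\<close> minimizes \<open>H w\<close> plus half the squared distance
  from \<open>w\<close> to \<open>\<zeta>\<close>, and the conclusion is the optimality condition.
  The normalization \<open>H 0 = 0\<close>, \<open>0 \<le> H z\<close> confines the minimization to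
  a ball.\<close>

lemma proximal_map_exists:
  fixes H :: "'a::euclidean_space \<Rightarrow> real"
  assumes sub: "\<And>z. \<exists>p. subgradient H z p" and H0: "H 0 = 0" and nn: "\<And>z. 0 \<le> H z"
  shows "\<exists>z. subgradient H z (\<zeta> - z)"
proof -
  have conv: "convex_on UNIV H" using sub by (rule convex_on_of_subgradients)
  then have cont: "continuous_on UNIV H" by (intro convex_on_continuous) auto
  define g where "g w = H w + 1 / 2 * (norm (w - \<zeta>))\<^sup>2" for w
  have gc: "continuous_on A g" for A
    unfolding g_def by (intro continuous_intros continuous_on_subset[OF cont]) auto
  define R where "R = 2 * norm \<zeta> + 1"
  obtain z where z: "z \<in> cball 0 R" "\<And>w. w \<in> cball 0 R \<Longrightarrow> g z \<le> g w"
  proof -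
    have "cball (0::'a) R \<noteq> {}" using norm_ge_zero[of \<zeta>] unfolding R_def by (simp del: norm_ge_zero)
    then show thesis using continuous_attains_inf[OF compact_cball _ gc] that by blast
  qed
  have "g z \<le> g w" for w
  proof (cases "w \<in> cball 0 R")
    case False
    have "norm \<zeta> \<le> norm (w - \<zeta>)" using False norm_triangle_ineq2[of w \<zeta>] by (auto simp: R_def)
    then have sq: "(norm \<zeta>)\<^sup>2 \<le> (norm (w - \<zeta>))\<^sup>2" by (intro power_mono) auto
    have "g 0 = 1 / 2 * (norm \<zeta>)\<^sup>2" "g w = H w + 1 / 2 * (norm (w - \<zeta>))\<^sup>2" by (simp_all add: g_def H0)
    then have "g 0 \<le> g w" using nn[of w] sq by linarith
    moreover have "g z \<le> g 0" using z(2)[of 0] by (simp add: R_def)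
    ultimately show ?thesis by simp
  qed (rule z(2))
  note gz = this
  have "H z + (\<zeta> - z) \<bullet> (w - z) \<le> H w" for w
  proof -
    \<comment> \<open>Comparing with points of the segment from \<open>z\<close> to \<open>w\<close>
      and dividing by \<open>t\<close> leaves an error proportional to \<open>t\<close>.\<close>
    have *: "H z + (\<zeta> - z) \<bullet> (w - z) \<le> H w + t * (1 / 2 * (norm (w - z))\<^sup>2)" if t: "0 < t" "t < 1" for t
    proof -
      have "g z \<le> g ((1 - t) *\<^sub>R z + t *\<^sub>R w)" by (rule gz)
      also have "H ((1 - t) *\<^sub>R z + t *\<^sub>R w) \<le> (1 - t) * H z + t * H w"
        using convex_onD[OF conv, of t z w] t by simp
      then have "g ((1 - t) *\<^sub>R z + t *\<^sub>R w) \<le> (1 - t) * H z + t * H w + 1 / 2 * (norm ((1 - t) *\<^sub>R z + t *\<^sub>R w - \<zeta>))\<^sup>2"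
        by (simp add: g_def)
      also have "(1 - t) *\<^sub>R z + t *\<^sub>R w - \<zeta> = (z - \<zeta>) + t *\<^sub>R (w - z)" by (simp add: algebra_simps)
      also have "(norm ((z - \<zeta>) + t *\<^sub>R (w - z)))\<^sup>2 = (norm (z - \<zeta>))\<^sup>2 + 2 * t * ((z - \<zeta>) \<bullet> (w - z)) + t\<^sup>2 * (norm (w - z))\<^sup>2"
        by (simp only: power2_norm_eq_inner inner_add_left inner_add_right inner_scaleR_left inner_scaleR_right
             inner_commute[of "w - z" "z - \<zeta>"]) (simp add: power2_eq_square algebra_simps)
      finally have "t * (H z - (z - \<zeta>) \<bullet> (w - z)) \<le> t * (H w + t * (1 / 2 * (norm (w - z))\<^sup>2))"
        by (simp add: g_def algebra_simps power2_eq_square)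
      then have "H z - (z - \<zeta>) \<bullet> (w - z) \<le> H w + t * (1 / 2 * (norm (w - z))\<^sup>2)" using t by simp
      then show ?thesis by (simp add: inner_diff_left)
    qed
    show ?thesis
    proof (rule tendsto_lowerbound)
      show "((\<lambda>t. H w + t * (1 / 2 * (norm (w - z))\<^sup>2)) \<longlongrightarrow> H w) (at_right 0)"
        by (auto intro!: tendsto_eq_intros)
      have "\<forall>\<^sub>F t in at_right 0. 0 < t \<and> t < (1::real)" by (intro eventually_at_rightI[of 0 1]) auto
      then show "\<forall>\<^sub>F t in at_right 0. H z + (\<zeta> - z) \<bullet> (w - z) \<le> H w + t * (1 / 2 * (norm (w - z))\<^sup>2)"
        by eventually_elim (use * in auto)
    qed simp
  qed
  then show ?thesis unfolding subgradient_def by blast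
qed

text \<open>Monotonicity of subgradients bounds |z - w|^2 by the inner product of
  \<open>\<zeta> - \<eta>\<close> and \<open>z - w\<close>. The case \<open>\<zeta> = \<eta>\<close>
  is uniqueness of the proximal point.\<close>

lemma proximal_map_nonexpansive:
  assumes "subgradient H z (\<zeta> - z)" "subgradient H w (\<eta> - w)"
  shows "norm (z - w) \<le> norm (\<zeta> - \<eta>)"
proof -
  have "0 \<le> ((\<zeta> - z) - (\<eta> - w)) \<bullet> (z - w)" using assms by (rule subgradient_monotone)
  then have "(norm (z - w))\<^sup>2 \<le> (\<zeta> - \<eta>) \<bullet> (z - w)"
    by (simp add: power2_norm_eq_inner inner_diff_left inner_diff_right algebra_simps)
  also have "\<dots> \<le> norm (\<zeta> - \<eta>) * norm (z - w)" by (rule norm_cauchy_schwarz)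
  finally show ?thesis by (cases "z = w") (simp_all add: power2_eq_square)
qed

lemma eq_0_of_inner_le_square:
  fixes v :: "'a::real_inner"
  assumes c: "c > 0" and k: "\<And>k. v \<bullet> k \<le> c * (norm k)\<^sup>2"
  shows "v = 0"
proof -
  \<comment> \<open>The increment \<open>v\<close> divided by \<open>2 * c\<close> maximizes
    \<open>v \<bullet> k - c * (norm k)\<^sup>2\<close>.\<close>
  have "v \<bullet> ((1 / (2 * c)) *\<^sub>R v) \<le> c * (norm ((1 / (2 * c)) *\<^sub>R v))\<^sup>2" by (rule k)
  then have "(norm v)\<^sup>2 / (2 * c) \<le> c * ((norm v)\<^sup>2 / (2 * c)\<^sup>2)"
    by (simp add: power2_norm_eq_inner[symmetric] power_mult_distrib power_divide)
  also have "\<dots> = (norm v)\<^sup>2 / (4 * c)" using c by (simp add: power2_eq_square)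
  finally have "(norm v)\<^sup>2 \<le> 0" using c by (simp add: field_simps)
  then show ?thesis by simp
qed

lemma subgradient_eq_of_contact:
  assumes q: "subgradient H z q" and c: "c > 0"
    and up: "\<And>h. H (z + h) \<le> H z + p \<bullet> h + c * (norm h)\<^sup>2"
  shows "q = p"
proof -
  have "(q - p) \<bullet> k \<le> c * (norm k)\<^sup>2" for k
    using q[unfolded subgradient_def, rule_format, of "z + k"] up[of k] by (simp add: inner_diff_left)
  from eq_0_of_inner_le_square[OF c this] show ?thesis by simp
qed

text \<open>A subgradient at \<open>z + h\<close>, tested over a distance \<open>norm h\<close> in
  the direction of its deviation \<open>q - p\<close>, cannot outgrow the paraboloid above, which at
  distance \<open>2 * norm h\<close> allows \<open>4 * c * (norm h)\<^sup>2\<close>. The linear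
  bound on the deviation is what gives the proximal map its lower distance bound at contact
  points.\<close>

lemma subgradient_near_contact:
  fixes H :: "'a::real_inner \<Rightarrow> real"
  assumes p: "subgradient H z p" and c: "c > 0"
    and up: "\<And>h. H (z + h) \<le> H z + p \<bullet> h + c * (norm h)\<^sup>2"
    and q: "subgradient H (z + h) q"
  shows "norm (q - p) \<le> 4 * c * norm h"
proof -
  have k: "(q - p) \<bullet> k \<le> c * (norm (h + k))\<^sup>2" for k
  proof -
    have "H (z + h) + q \<bullet> k \<le> H (z + h + k)"
      using q[unfolded subgradient_def, rule_format, of "z + h + k"] by simp
    moreover have "H z + p \<bullet> h \<le> H (z + h)"
      using p[unfolded subgradient_def, rule_format, of "z + h"] by simp
    moreover have "H (z + h + k) \<le> H z + p \<bullet> (h + k) + c * (norm (h + k))\<^sup>2"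
      using up[of "h + k"] by (simp add: add.assoc)
    ultimately show ?thesis by (simp add: inner_add_right inner_diff_left)
  qed
  show ?thesis
  proof (cases "h = 0 \<or> q = p")
    case True
    have "q = p"
      using True subgradient_eq_of_contact[OF _ c up] q by auto
    then show ?thesis using c by simp
  next
    case False
    define n where "n = norm (q - p)"
    have n: "n > 0" "norm h > 0" using False by (auto simp: n_def)
    have "(q - p) \<bullet> ((norm h / n) *\<^sub>R (q - p)) \<le> c * (norm (h + (norm h / n) *\<^sub>R (q - p)))\<^sup>2" by (rule k)
    also have "norm (h + (norm h / n) *\<^sub>R (q - p)) \<le> norm h + norm ((norm h / n) *\<^sub>R (q - p))" by (rule norm_triangle_ineq)
    then have "norm (h + (norm h / n) *\<^sub>R (q - p)) \<le> 2 * norm h" using n by (simp add: n_def[symmetric])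
    then have "c * (norm (h + (norm h / n) *\<^sub>R (q - p)))\<^sup>2 \<le> c * (2 * norm h)\<^sup>2"
      using c by (intro mult_left_mono power_mono) auto
    finally have "(norm h / n) * n\<^sup>2 \<le> c * (2 * norm h)\<^sup>2"
      by (simp add: power2_norm_eq_inner[symmetric] n_def)
    then have "norm h * n \<le> norm h * (4 * c * norm h)" using n by (simp add: power2_eq_square field_simps)
    then show ?thesis using n(2) by (simp add: n_def)
  qed
qed

section \<open>Second order expansions from derivatives of subgradients\<close>

text \<open>Subgradients are summed along the segment from \<open>z\<close> to \<open>z + h\<close>
  by telescoping over a partition, which avoids integrating a selection of them. Only the quadratic
  form of \<open>S\<close> enters.\<close>

lemma expansion_of_subgradient_expansion:
  fixes H :: "'a::real_inner \<Rightarrow> real"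
  assumes sub: "\<And>z. \<exists>p. subgradient H z p" and S: "linear S"
    and d: "\<And>h q. norm h < d \<Longrightarrow> subgradient H (z + h) q \<Longrightarrow> norm (q - p - S h) \<le> \<epsilon> * norm h"
    and h: "norm h < d" and \<epsilon>: "\<epsilon> \<ge> 0"
  shows "\<bar>H (z + h) - H z - p \<bullet> h - 1 / 2 * (h \<bullet> S h)\<bar> \<le> \<epsilon> * (norm h)\<^sup>2"
proof -
  define a where "a = h \<bullet> S h"
  define \<phi> where "\<phi> t = H (z + t *\<^sub>R h) - t * (p \<bullet> h) - 1 / 2 * t\<^sup>2 * a" for t
  have est: "\<bar>q \<bullet> h - p \<bullet> h - t * a\<bar> \<le> \<epsilon> * (norm h)\<^sup>2"
    if q: "subgradient H (z + t *\<^sub>R h) q" and t: "0 \<le> t" "t \<le> 1" for q t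
  proof -
    have "norm (t *\<^sub>R h) \<le> norm h" using t by (simp add: mult_left_le_one_le)
    then have "norm (q - p - S (t *\<^sub>R h)) \<le> \<epsilon> * norm (t *\<^sub>R h)" using d[OF _ q] h by simp
    also have "\<dots> \<le> \<epsilon> * norm h" using \<open>norm (t *\<^sub>R h) \<le> norm h\<close> \<epsilon> by (rule mult_left_mono)
    finally have "norm (q - p - S (t *\<^sub>R h)) * norm h \<le> \<epsilon> * norm h * norm h" by (rule mult_right_mono) simp
    then have "\<bar>(q - p - S (t *\<^sub>R h)) \<bullet> h\<bar> \<le> \<epsilon> * (norm h)\<^sup>2"
      using Cauchy_Schwarz_ineq2[of "q - p - S (t *\<^sub>R h)" h] by (simp add: power2_eq_square mult.assoc)
    then show ?thesis
      by (simp add: a_def inner_diff_left linear_scale[OF S] inner_commute[of "S h" h])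
  qed
  \<comment> \<open>The support inequality at \<open>t\<close> bounds the increment of
    \<open>H\<close> from above and the one at \<open>s\<close> from below. The quadratic term
    contributes exactly its slope at the midpoint \<open>(t + s) / 2\<close>, whence an error of at
    most \<open>(t - s) * \<bar>a\<bar>\<close> in the slope.\<close>
  have incr: "\<bar>\<phi> t - \<phi> s\<bar> \<le> (t - s) * (\<epsilon> * (norm h)\<^sup>2 + (t - s) * \<bar>a\<bar>)" if st: "0 \<le> s" "s \<le> t" "t \<le> 1" for s t
  proof -
    obtain qs where qs: "subgradient H (z + s *\<^sub>R h) qs" using sub by blast
    obtain qt where qt: "subgradient H (z + t *\<^sub>R h) qt" using sub by blast
    have l: "H (z + s *\<^sub>R h) + (t - s) * (qs \<bullet> h) \<le> H (z + t *\<^sub>R h)"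
      using qs[unfolded subgradient_def, rule_format, of "z + t *\<^sub>R h"] by (simp add: scaleR_diff_left[symmetric])
    have u: "H (z + t *\<^sub>R h) + (s - t) * (qt \<bullet> h) \<le> H (z + s *\<^sub>R h)"
      using qt[unfolded subgradient_def, rule_format, of "z + s *\<^sub>R h"] by (simp add: scaleR_diff_left[symmetric])
    have e: "\<bar>qs \<bullet> h - p \<bullet> h - s * a\<bar> \<le> \<epsilon> * (norm h)\<^sup>2" "\<bar>qt \<bullet> h - p \<bullet> h - t * a\<bar> \<le> \<epsilon> * (norm h)\<^sup>2"
      using est[OF qs] est[OF qt] st by auto
    have a: "(t - s) * a \<le> (t - s) * \<bar>a\<bar>" "- ((t - s) * a) \<le> (t - s) * \<bar>a\<bar>" "0 \<le> (t - s) * \<bar>a\<bar>"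
      using st mult_left_mono[of a "\<bar>a\<bar>" "t - s"] mult_left_mono[of "- a" "\<bar>a\<bar>" "t - s"] by auto
    have m: "qt \<bullet> h - (p \<bullet> h + (t + s) / 2 * a) = (qt \<bullet> h - p \<bullet> h - t * a) + (t - s) * a / 2"
      "qs \<bullet> h - (p \<bullet> h + (t + s) / 2 * a) = (qs \<bullet> h - p \<bullet> h - s * a) - (t - s) * a / 2"
      by (simp_all add: field_simps)
    define X where "X = (t - s) * a"
    define Y where "Y = (t - s) * \<bar>a\<bar>"
    have XY: "X \<le> Y" "- X \<le> Y" "0 \<le> Y" using a by (auto simp: X_def Y_def)
    have ut: "qt \<bullet> h - (p \<bullet> h + (t + s) / 2 * a) \<le> \<epsilon> * (norm h)\<^sup>2 + (t - s) * \<bar>a\<bar>"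
      unfolding m X_def[symmetric] Y_def[symmetric] using e(2) XY unfolding abs_le_iff by linarith
    have us: "- (\<epsilon> * (norm h)\<^sup>2 + (t - s) * \<bar>a\<bar>) \<le> qs \<bullet> h - (p \<bullet> h + (t + s) / 2 * a)"
      unfolding m X_def[symmetric] Y_def[symmetric] using e(1) XY unfolding abs_le_iff by linarith
    have "\<phi> t - \<phi> s = H (z + t *\<^sub>R h) - H (z + s *\<^sub>R h) - (t - s) * (p \<bullet> h + (t + s) / 2 * a)"
      by (simp add: \<phi>_def field_simps power2_eq_square)
    moreover have "H (z + t *\<^sub>R h) - H (z + s *\<^sub>R h) - (t - s) * (p \<bullet> h + (t + s) / 2 * a)
        \<le> (t - s) * (qt \<bullet> h - (p \<bullet> h + (t + s) / 2 * a))" using u by (simp add: algebra_simps)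
    moreover have "\<dots> \<le> (t - s) * (\<epsilon> * (norm h)\<^sup>2 + (t - s) * \<bar>a\<bar>)"
      using ut st by (intro mult_left_mono) auto
    moreover have "(t - s) * (qs \<bullet> h - (p \<bullet> h + (t + s) / 2 * a)) \<le> 
        H (z + t *\<^sub>R h) - H (z + s *\<^sub>R h) - (t - s) * (p \<bullet> h + (t + s) / 2 * a)" using l by (simp add: algebra_simps)
    moreover have "(t - s) * (- (\<epsilon> * (norm h)\<^sup>2 + (t - s) * \<bar>a\<bar>)) \<le> (t - s) * (qs \<bullet> h - (p \<bullet> h + (t + s) / 2 * a))"
      using us st by (intro mult_left_mono) auto
    ultimately have "\<phi> t - \<phi> s \<le> (t - s) * (\<epsilon> * (norm h)\<^sup>2 + (t - s) * \<bar>a\<bar>)"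
        "(t - s) * (- (\<epsilon> * (norm h)\<^sup>2 + (t - s) * \<bar>a\<bar>)) \<le> \<phi> t - \<phi> s" by (simp_all only:)
    then show ?thesis unfolding mult_minus_right by (rule abs_leI[OF _ minus_le_iff[THEN iffD1]])
  qed
  \<comment> \<open>With \<open>Suc m\<close> equal pieces the discretization errors add up to
    \<open>\<bar>a\<bar>\<close> divided by \<open>Suc m\<close>, which disappears as
    \<open>m\<close> grows.\<close>
  have "\<bar>\<phi> 1 - \<phi> 0\<bar> \<le> \<epsilon> * (norm h)\<^sup>2 + inverse (real (Suc m)) * \<bar>a\<bar>" for m
  proof -
    define k where "k = Suc m"
    have "\<phi> 1 - \<phi> 0 = (\<Sum>i<k. \<phi> (real (Suc i) / k) - \<phi> (real i / k))"
      using sum_lessThan_telescope[of "\<lambda>i. \<phi> (real i / k)" k] by (simp add: k_def)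
    also have "\<bar>\<dots>\<bar> \<le> (\<Sum>i<k. \<bar>\<phi> (real (Suc i) / k) - \<phi> (real i / k)\<bar>)" by (rule sum_abs)
    also have "\<dots> \<le> (\<Sum>i<k. 1 / k * (\<epsilon> * (norm h)\<^sup>2 + 1 / k * \<bar>a\<bar>))"
    proof (rule sum_mono)
      fix i assume "i \<in> {..<k}"
      then have "i < k" by simp
      have "real (Suc i) / k - real i / k = 1 / k" by (simp add: diff_divide_distrib[symmetric])
      then show "\<bar>\<phi> (real (Suc i) / k) - \<phi> (real i / k)\<bar> \<le> 1 / k * (\<epsilon> * (norm h)\<^sup>2 + 1 / k * \<bar>a\<bar>)"
        using incr[of "real i / k" "real (Suc i) / k"] \<open>i < k\<close> by (simp add: divide_right_mono)
    qed
    also have "\<dots> = \<epsilon> * (norm h)\<^sup>2 + inverse (real (Suc m)) * \<bar>a\<bar>" by (simp add: k_def inverse_eq_divide)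
    finally show ?thesis .
  qed
  moreover have "(\<lambda>m. \<epsilon> * (norm h)\<^sup>2 + inverse (real (Suc m)) * \<bar>a\<bar>) \<longlonglongrightarrow> \<epsilon> * (norm h)\<^sup>2 + 0 * \<bar>a\<bar>"
    by (intro tendsto_intros LIMSEQ_inverse_real_of_nat)
  ultimately have "\<bar>\<phi> 1 - \<phi> 0\<bar> \<le> \<epsilon> * (norm h)\<^sup>2 + 0 * \<bar>a\<bar>"
    by (intro LIMSEQ_le_const) auto
  then show ?thesis by (simp add: \<phi>_def a_def)
qed

text \<open>At a point where \<open>H\<close> is touched from above by a paraboloid the proximal map \<open>T\<close> expands distances
  by a fixed factor from below, so its derivative is automatically invertible and Sard's theorem is
  not needed to pass from \<open>T\<close> back to \<open>H\<close>.\<close>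

lemma subgradient_expansion_of_proximal_derivative:
  fixes H :: "'a::euclidean_space \<Rightarrow> real"
  assumes T: "\<And>\<zeta>. subgradient H (T \<zeta>) (\<zeta> - T \<zeta>)"
    and p: "subgradient H z p" and c: "c > 0"
    and up: "\<And>h. H (z + h) \<le> H z + p \<bullet> h + c * (norm h)\<^sup>2"
    and D: "(T has_derivative D) (at (z + p))"
  shows "\<exists>S. linear S \<and> (\<forall>\<epsilon>>0. \<exists>d>0. \<forall>h q. norm h < d \<longrightarrow> subgradient H (z + h) q \<longrightarrow> norm (q - p - S h) \<le> \<epsilon> * norm h)"
proof -
  have Teq: "T (w + q) = w" if "subgradient H w q" for w q
  proof -
    have "norm (T (w + q) - w) \<le> norm ((w + q) - (w + q))"
      by (rule proximal_map_nonexpansive[OF T]) (use that in simp)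
    then show ?thesis by simp
  qed
  \<comment> \<open>The displacement \<open>\<eta>\<close> is the displacement \<open>h\<close> of
    the base point plus the change of the subgradient, and the latter is at most
    \<open>4 * c * norm h\<close>.\<close>
  have lb: "norm \<eta> \<le> (1 + 4 * c) * norm (T (z + p + \<eta>) - z)" for \<eta>
  proof -
    define h where "h = T (z + p + \<eta>) - z"
    have "subgradient H (z + h) (z + p + \<eta> - (z + h))" using T[of "z + p + \<eta>"] by (simp add: h_def)
    then have "norm (z + p + \<eta> - (z + h) - p) \<le> 4 * c * norm h" by (rule subgradient_near_contact[OF p c up])
    then have "norm (\<eta> - h) \<le> 4 * c * norm h" by (simp add: algebra_simps)
    then have "norm \<eta> \<le> (1 + 4 * c) * norm h" using norm_triangle_sub[of \<eta> h] by (simp add: algebra_simps)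
    then show ?thesis by (simp add: h_def)
  qed
  have linD: "linear D" using D by (rule has_derivative_linear)
  have Dd: "\<exists>d>0. \<forall>\<eta>. norm \<eta> < d \<longrightarrow> norm (T (z + p + \<eta>) - z - D \<eta>) \<le> e * norm \<eta>" if e: "e > 0" for e
  proof -
    have "T (z + p) = z" by (rule Teq[OF p])
    moreover obtain d where "d > 0" "\<And>y. norm (y - (z + p)) < d \<Longrightarrow> norm (T y - T (z + p) - D (y - (z + p))) \<le> e * norm (y - (z + p))"
      using D e unfolding has_derivative_at_alt by blast
    ultimately show ?thesis by (intro exI[of _ d]) (metis add_diff_cancel_left')
  qed
  have "inj D"
    unfolding linear_injective_0[OF linD]
  proof (intro allI impI)
    fix v assume "D v = 0"
    show "v = 0"
    proof (rule ccontr)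
      assume "v \<noteq> 0"
      \<comment> \<open>With this \<open>e\<close> the image of a small kernel vector of
        \<open>D\<close> would move by at most half of what \<open>lb\<close> demands.\<close>
      define e where "e = 1 / (2 * (1 + 4 * c))"
      obtain d where d: "d > 0" "\<And>\<eta>. norm \<eta> < d \<Longrightarrow> norm (T (z + p + \<eta>) - z - D \<eta>) \<le> e * norm \<eta>"
        using Dd[of e] c by (auto simp: e_def)
      define t where "t = d / (2 * norm v)"
      have t: "t > 0" "norm (t *\<^sub>R v) < d" using d(1) \<open>v \<noteq> 0\<close> by (auto simp: t_def)
      have "norm (T (z + p + t *\<^sub>R v) - z) \<le> e * norm (t *\<^sub>R v)"
        using d(2)[OF t(2)] \<open>D v = 0\<close> by (simp add: linear_scale[OF linD])
      then have "norm (t *\<^sub>R v) \<le> (1 + 4 * c) * (e * norm (t *\<^sub>R v))"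
        using lb[of "t *\<^sub>R v"] c by (meson add_nonneg_nonneg less_eq_real_def mult_left_mono mult_nonneg_nonneg order_trans zero_le_numeral zero_less_one)
      also have "\<dots> = norm (t *\<^sub>R v) / 2" using c by (simp add: e_def field_simps)
      finally show False using t(1) \<open>v \<noteq> 0\<close> by simp
    qed
  qed
  then obtain E where E: "linear E" "\<And>x. E (D x) = x"
    using linear_injective_left_inverse[OF linD] by (auto simp: fun_eq_iff o_def)
  obtain b where b: "b > 0" "\<And>x. norm (E x) \<le> b * norm x" using linear_bounded_pos[OF E(1)] by blast
  show ?thesis
  \<comment> \<open>The proximal map inverts the identity plus the subgradient, so the derivative of
    the subgradient is the inverse \<open>E\<close> of \<open>D\<close> minus the identity.\<close>
  proof (intro exI[of _ "\<lambda>h. E h - h"] conjI allI impI)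
    show "linear (\<lambda>h. E h - h)" by (intro linear_compose_sub E(1) linear_ident)
    fix \<epsilon> :: real assume "\<epsilon> > 0"
    define e where "e = \<epsilon> / (b * (1 + 4 * c))"
    have e: "e > 0" using \<open>\<epsilon> > 0\<close> b c by (simp add: e_def)
    obtain d where d: "d > 0" "\<And>\<eta>. norm \<eta> < d \<Longrightarrow> norm (T (z + p + \<eta>) - z - D \<eta>) \<le> e * norm \<eta>"
      using Dd[OF e] by blast
    show "\<exists>d>0. \<forall>h q. norm h < d \<longrightarrow> subgradient H (z + h) q \<longrightarrow> norm (q - p - (E h - h)) \<le> \<epsilon> * norm h"
    proof (intro exI[of _ "d / (1 + 4 * c)"] conjI allI impI)
      show "0 < d / (1 + 4 * c)" using d(1) c by simp
      fix h q assume h: "norm h < d / (1 + 4 * c)" and q: "subgradient H (z + h) q"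
      define \<eta> where "\<eta> = h + (q - p)"
      have Th: "T (z + p + \<eta>) = z + h" using Teq[OF q] by (simp add: \<eta>_def algebra_simps)
      have n: "norm \<eta> \<le> (1 + 4 * c) * norm h" using lb[of \<eta>] by (simp add: Th)
      also have "\<dots> < d" using h c by (simp add: field_simps)
      finally have "norm (h - D \<eta>) \<le> e * norm \<eta>" using d(2)[of \<eta>] by (simp add: Th)
      also have "\<dots> \<le> e * ((1 + 4 * c) * norm h)" using n e by (intro mult_left_mono) auto
      finally have 1: "norm (h - D \<eta>) \<le> e * ((1 + 4 * c) * norm h)" .
      have "q - p - (E h - h) = - E (h - D \<eta>)"
        by (simp add: linear_diff[OF E(1)] E(2)) (simp add: \<eta>_def)
      then have "norm (q - p - (E h - h)) \<le> b * norm (h - D \<eta>)" using b(2) by simp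
      also have "\<dots> \<le> b * (e * ((1 + 4 * c) * norm h))" using 1 b(1) by simp
      also have "\<dots> = (e * (b * (1 + 4 * c))) * norm h" by (simp add: mult_ac)
      also have "e * (b * (1 + 4 * c)) = \<epsilon>"
      proof -
        have "b * (1 + 4 * c) \<noteq> 0" using b(1) c by simp
        then show ?thesis unfolding e_def by (metis nonzero_eq_divide_eq)
      qed
      finally show "norm (q - p - (E h - h)) \<le> \<epsilon> * norm h" .
    qed
  qed
qed

text \<open>This combines Jensen's lemma with Alexandrov's theorem. Every small slope \<open>r\<close> is the slope
  of \<open>H\<close> minus the quadratic at a contact point \<open>T \<zeta>\<close>, and \<open>r\<close> is a Lipschitz function of \<open>\<zeta>\<close>; hence the
  \<open>\<zeta>\<close> arising in this way cannot all lie in the null set where \<open>T\<close> is not differentiable.\<close>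

theorem convex_contact_expansion:
  fixes H :: "'a::euclidean_space \<Rightarrow> real"
  assumes sub: "\<And>z. \<exists>p. subgradient H z p" and H0: "H 0 = 0" and nn: "\<And>z. 0 \<le> H z"
    and B: "linear B" and sym: "\<And>x y. B x \<bullet> y = x \<bullet> B y"
    and le: "\<And>z. H z \<le> 1 / 2 * (z \<bullet> B z)" and \<kappa>: "\<kappa> > 0"
  shows "\<exists>z p S. norm z < \<kappa> \<and> norm p < \<kappa> \<and> linear S
    \<and> (\<forall>\<epsilon>>0. \<exists>d>0. \<forall>h. norm h < d \<longrightarrow> \<bar>H (z + h) - H z - p \<bullet> h - 1 / 2 * (h \<bullet> S h)\<bar> \<le> \<epsilon> * (norm h)\<^sup>2)
    \<and> (\<forall>h. H (z + h) \<le> H z + p \<bullet> h + 1 / 2 * (h \<bullet> B h) + \<kappa> * (norm h)\<^sup>2)"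
proof -
  obtain b where b: "b > 0" "\<And>x. norm (B x) \<le> b * norm x" using linear_bounded_pos[OF B] by blast
  obtain T where T: "\<And>\<zeta>. subgradient H (T \<zeta>) (\<zeta> - T \<zeta>)"
    using proximal_map_exists[OF sub H0 nn] by metis
  have Tlip: "1-lipschitz_on UNIV T"
    by (rule lipschitz_onI) (use proximal_map_nonexpansive[OF T T] in \<open>auto simp: dist_norm\<close>)
  have cont: "continuous_on A H" for A
    using convex_on_continuous[OF open_UNIV convex_on_of_subgradients[OF sub]] continuous_on_subset by blast
  have Bc: "continuous_on A B" for A using B by (rule linear_continuous_on_compose[OF continuous_on_id, simplified])
  \<comment> \<open>The denominator collects the factors in the bounds
    \<open>\<delta> / \<kappa>\<close> for the contact point and
    \<open>\<delta> * (1 + (b + 2 * \<kappa>) / \<kappa>)\<close> for its slope, so that both fall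
    below \<open>\<kappa>\<close>.\<close>
  define \<delta> where "\<delta> = \<kappa> / (2 * (1 + (b + 2 * \<kappa>) / \<kappa> + 1 / \<kappa>))"
  have den: "1 + (b + 2 * \<kappa>) / \<kappa> + 1 / \<kappa> > 0" using b \<kappa> by (simp add: add_pos_pos)
  have \<delta>: "\<delta> > 0" "\<delta> / \<kappa> < \<kappa>" "\<delta> * (1 + (b + 2 * \<kappa>) / \<kappa>) < \<kappa>"
  proof -
    show "\<delta> > 0" unfolding \<delta>_def using den \<kappa> by (intro divide_pos_pos mult_pos_pos) auto
    have e: "\<delta> * (1 + (b + 2 * \<kappa>) / \<kappa> + 1 / \<kappa>) = \<kappa> / 2"
      unfolding \<delta>_def using den by (metis (no_types, lifting) less_irrefl mult.commute nonzero_mult_divide_mult_cancel_left nonzero_mult_div_cancel_left times_divide_eq_right)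
    have "\<delta> * (1 / \<kappa>) \<le> \<delta> * (1 + (b + 2 * \<kappa>) / \<kappa> + 1 / \<kappa>)"
      using \<open>\<delta> > 0\<close> b \<kappa> by (intro mult_left_mono) auto
    then show "\<delta> / \<kappa> < \<kappa>" using e \<kappa> by simp
    have "\<delta> * (1 + (b + 2 * \<kappa>) / \<kappa>) \<le> \<delta> * (1 + (b + 2 * \<kappa>) / \<kappa> + 1 / \<kappa>)"
      using \<open>\<delta> > 0\<close> b \<kappa> by (intro mult_left_mono) auto
    then show "\<delta> * (1 + (b + 2 * \<kappa>) / \<kappa>) < \<kappa>" using e \<kappa> by simp
  qed
  \<comment> \<open>Contact with the untilted quadratic takes place at the origin. The extra term
    \<open>\<kappa> * (norm z)\<^sup>2\<close> beats the tilt \<open>r\<close> beyond distance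
    \<open>\<delta> / \<kappa>\<close>, so the tilted maximum is attained close to the
    origin.\<close>
  have contact: "\<exists>z. norm z \<le> \<delta> / \<kappa> \<and> (\<forall>h. H (z + h) \<le> H z + (r + B z + (2 * \<kappa>) *\<^sub>R z) \<bullet> h + 1 / 2 * (h \<bullet> B h) + \<kappa> * (norm h)\<^sup>2)"
    if r: "norm r < \<delta>" for r
  proof -
    define W where "W z = H z - 1 / 2 * (z \<bullet> B z) - \<kappa> * (norm z)\<^sup>2 - r \<bullet> z" for z
    have Wc: "continuous_on A W" for A unfolding W_def by (intro continuous_intros cont Bc)
    obtain z where z: "z \<in> cball 0 (\<delta> / \<kappa>)" "\<And>w. w \<in> cball 0 (\<delta> / \<kappa>) \<Longrightarrow> W w \<le> W z"
    proof -
      have "cball (0::'a) (\<delta> / \<kappa>) \<noteq> {}" using divide_pos_pos[OF \<delta>(1) \<kappa>] by simp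
      then show thesis using continuous_attains_sup[OF compact_cball _ Wc] that by blast
    qed
    have W0: "0 \<le> W z" using z(2)[of 0] \<delta>(1) \<kappa> by (simp add: W_def H0)
    have Wz: "W w \<le> W z" for w
    proof (cases "w \<in> cball 0 (\<delta> / \<kappa>)")
      case False
      then have "\<delta> < \<kappa> * norm w" using \<kappa> by (simp add: field_simps)
      then have "norm r * norm w \<le> (\<kappa> * norm w) * norm w" using r by (intro mult_right_mono) auto
      moreover have "- (r \<bullet> w) \<le> norm r * norm w" using Cauchy_Schwarz_ineq2[of r w] by linarith
      ultimately have "W w \<le> 0" using le[of w] by (simp add: W_def power2_eq_square)
      then show ?thesis using W0 by simp
    qed (rule z(2))
    show ?thesis
    proof (intro exI[of _ z] conjI allI)
      show "norm z \<le> \<delta> / \<kappa>" using z by simp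
      fix h
      have "(z + h) \<bullet> B (z + h) = z \<bullet> B z + 2 * (B z \<bullet> h) + h \<bullet> B h"
        using sym[of z h] by (simp add: linear_add[OF B] inner_add_left inner_add_right inner_commute)
      moreover have "(norm (z + h))\<^sup>2 = (norm z)\<^sup>2 + 2 * (z \<bullet> h) + (norm h)\<^sup>2"
        by (simp add: power2_norm_eq_inner inner_add_left inner_add_right inner_commute)
      ultimately show "H (z + h) \<le> H z + (r + B z + (2 * \<kappa>) *\<^sub>R z) \<bullet> h + 1 / 2 * (h \<bullet> B h) + \<kappa> * (norm h)\<^sup>2"
        using Wz[of "z + h"] by (simp add: W_def inner_add_left inner_add_right algebra_simps)
    qed
  qed
  define c where "c = b + \<kappa>"
  have c: "c > 0" using b \<kappa> by (simp add: c_def)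
  have qc: "1 / 2 * (h \<bullet> B h) + \<kappa> * (norm h)\<^sup>2 \<le> c * (norm h)\<^sup>2" for h
  proof -
    have "h \<bullet> B h \<le> norm h * norm (B h)" by (rule norm_cauchy_schwarz)
    also have "\<dots> \<le> norm h * (b * norm h)" using b by (intro mult_left_mono) auto
    finally have "h \<bullet> B h \<le> b * (norm h)\<^sup>2" by (simp add: power2_eq_square mult.left_commute)
    moreover have "0 \<le> b * (norm h)\<^sup>2" using b by simp
    ultimately show ?thesis unfolding c_def distrib_right by linarith
  qed
  \<comment> \<open>At a contact point \<open>z\<close> the slope is
    \<open>p = r + B z + (2 * \<kappa>) *\<^sub>R z\<close>, and \<open>T (z + p) = z\<close>;
    solving for \<open>r\<close> shows that \<open>M\<close> recovers \<open>r\<close> from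
    \<open>z + p\<close>.\<close>
  define M where "M \<zeta> = \<zeta> - T \<zeta> - B (T \<zeta>) - (2 * \<kappa>) *\<^sub>R T \<zeta>" for \<zeta>
  define N where "N = {\<zeta>. \<not> T differentiable (at \<zeta>)}"
  have Nneg: "negligible N" unfolding N_def by (rule rademacher_vector[OF Tlip])
  have "negligible (M ` N)"
  proof (rule negligible_locally_Lipschitz_image[OF _ Nneg])
    fix x
    have "norm (M y - M x) \<le> (2 + b + 2 * \<kappa>) * norm (y - x)" for y
    proof -
      have t: "norm (T y - T x) \<le> norm (y - x)" by (rule proximal_map_nonexpansive[OF T T])
      have "M y - M x = (y - x) - (T y - T x) - B (T y - T x) - (2 * \<kappa>) *\<^sub>R (T y - T x)"
        by (simp add: M_def linear_diff[OF B] algebra_simps)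
      also have "norm \<dots> \<le> norm (y - x) + norm (T y - T x) + norm (B (T y - T x)) + norm ((2 * \<kappa>) *\<^sub>R (T y - T x))"
        by (intro order_trans[OF norm_triangle_ineq4] add_mono order_refl)
      also have "\<dots> \<le> norm (y - x) + norm (y - x) + b * norm (y - x) + 2 * \<kappa> * norm (y - x)"
        using t b \<kappa> order_trans[OF b(2) mult_left_mono[OF t, of b]] by (intro add_mono) auto
      finally show ?thesis by (simp add: algebra_simps)
    qed
    then show "\<exists>U B. open U \<and> x \<in> U \<and> (\<forall>y\<in>N \<inter> U. norm (M y - M x) \<le> B * norm (y - x))"
      by (intro exI[of _ UNIV] exI[of _ "2 + b + 2 * \<kappa>"]) auto
  qed simp
  moreover have "\<not> negligible (ball (0::'a) \<delta>)"
    using \<delta>(1) open_not_negligible[of "ball (0::'a) \<delta>"] by auto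
  ultimately obtain r where r: "norm r < \<delta>" "r \<notin> M ` N"
    by (meson mem_ball_0 negligible_subset subsetI)
  obtain z where z: "norm z \<le> \<delta> / \<kappa>"
    "\<And>h. H (z + h) \<le> H z + (r + B z + (2 * \<kappa>) *\<^sub>R z) \<bullet> h + 1 / 2 * (h \<bullet> B h) + \<kappa> * (norm h)\<^sup>2"
    using contact[OF r(1)] by blast
  define p where "p = r + B z + (2 * \<kappa>) *\<^sub>R z"
  have up: "H (z + h) \<le> H z + p \<bullet> h + c * (norm h)\<^sup>2" for h
    using z(2)[of h] qc[of h] unfolding p_def by linarith
  have p: "subgradient H z p"
  proof -
    obtain q where q: "subgradient H z q" using sub by blast
    have "q = p" using q c up by (rule subgradient_eq_of_contact)
    then show ?thesis using q by simp
  qed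
  have Tz: "T (z + p) = z"
    using proximal_map_nonexpansive[of H "T (z + p)" "z + p" z "z + p"] T[of "z + p"] p by simp
  have "M (z + p) = r" by (simp add: M_def Tz) (simp add: p_def)
  then have "T differentiable (at (z + p))" using r(2) by (auto simp: N_def)
  then obtain D where D: "(T has_derivative D) (at (z + p))" by (auto simp: differentiable_def)
  obtain S where S: "linear S" "\<And>\<epsilon>. \<epsilon> > 0 \<Longrightarrow> \<exists>d>0. \<forall>h q. norm h < d \<longrightarrow> subgradient H (z + h) q \<longrightarrow> norm (q - p - S h) \<le> \<epsilon> * norm h"
    using subgradient_expansion_of_proximal_derivative[OF T p c up D] by blast
  show ?thesis
  proof (rule exI[of _ z], rule exI[of _ p], rule exI[of _ S], intro conjI allI impI S(1))
    show "norm z < \<kappa>" using z(1) \<delta>(2) by simp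
    have "norm p \<le> norm r + norm (B z) + norm ((2 * \<kappa>) *\<^sub>R z)"
      unfolding p_def by (intro order_trans[OF norm_triangle_ineq] add_mono order_refl)
    also have "\<dots> \<le> \<delta> + b * (\<delta> / \<kappa>) + 2 * \<kappa> * (\<delta> / \<kappa>)"
      using r(1) b \<kappa> z(1) order_trans[OF b(2) mult_left_mono[OF z(1), of b]] mult_left_mono[OF z(1), of "2 * \<kappa>"]
      by (intro add_mono) auto
    also have "\<dots> = \<delta> * (1 + (b + 2 * \<kappa>) / \<kappa>)" using \<kappa> by (simp add: field_simps)
    finally show "norm p < \<kappa>" using \<delta>(3) by simp
    show "H (z + h) \<le> H z + p \<bullet> h + 1 / 2 * (h \<bullet> B h) + \<kappa> * (norm h)\<^sup>2" for h
      using z(2) by (simp add: p_def)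
    fix \<epsilon> :: real assume "\<epsilon> > 0"
    then obtain d where "d > 0" and d: "\<And>h q. norm h < d \<Longrightarrow> subgradient H (z + h) q \<Longrightarrow> norm (q - p - S h) \<le> \<epsilon> * norm h"
      using S(2) by blast
    then show "\<exists>d>0. \<forall>h. norm h < d \<longrightarrow> \<bar>H (z + h) - H z - p \<bullet> h - 1 / 2 * (h \<bullet> S h)\<bar> \<le> \<epsilon> * (norm h)\<^sup>2"
      using expansion_of_subgradient_expansion[OF sub S(1) d] \<open>\<epsilon> > 0\<close> by (intro exI[of _ d]) auto
  qed
qed

section \<open>Determinants and quadratic forms\<close>

lemma tendsto_det:
  fixes M :: "'b \<Rightarrow> real^'m^'m"
  assumes "(M \<longlongrightarrow> N) F"
  shows "((\<lambda>x. det (M x)) \<longlongrightarrow> det N) F"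
  unfolding det_def by (intro tendsto_intros tendsto_vec_nth assms)

text \<open>A crude count of the terms in the Leibniz formula; all that matters is that the bound is
  the same for every power of a matrix.\<close>

lemma abs_det_le_card_permutations:
  fixes A :: "real^'m^'m"
  assumes "\<And>i j. \<bar>A $ i $ j\<bar> \<le> 1"
  shows "\<bar>det A\<bar> \<le> real (card {p. p permutes (UNIV :: 'm set)})"
proof -
  have "\<bar>det A\<bar> \<le> (\<Sum>p\<in>{p. p permutes (UNIV :: 'm set)}. \<bar>of_int (sign p) * (\<Prod>i\<in>UNIV. A $ i $ p i)\<bar>)"
    unfolding det_def by (rule sum_abs)
  also have "\<dots> \<le> (\<Sum>p\<in>{p. p permutes (UNIV :: 'm set)}. 1)"
  proof (rule sum_mono)
    fix p assume "p \<in> {p. p permutes (UNIV :: 'm set)}"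
    have "\<bar>of_int (sign p) :: real\<bar> = 1" by (simp add: sign_def)
    moreover have "\<bar>\<Prod>i\<in>UNIV. A $ i $ p i\<bar> \<le> 1"
      unfolding abs_prod by (rule prod_le_1) (use assms in auto)
    ultimately show "\<bar>of_int (sign p) * (\<Prod>i\<in>UNIV. A $ i $ p i)\<bar> \<le> 1" by (simp add: abs_mult)
  qed
  finally show ?thesis by simp
qed

text \<open>The powers of a contraction have bounded entries, hence bounded determinants.\<close>

lemma abs_det_contraction_le_1:
  fixes V :: "real^'m^'m"
  assumes V: "\<And>x. norm (V *v x) \<le> norm x"
  shows "\<bar>det V\<bar> \<le> 1"
proof (rule ccontr)
  assume "\<not> ?thesis"
  then have d: "1 < \<bar>det V\<bar>" by simp
  define P where "P k = ((\<lambda>M. V ** M) ^^ k) (mat 1)" for k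
  have det: "det (P k) = det V ^ k" for k
    by (induction k) (simp_all add: P_def det_mul)
  have nrm: "norm (P k *v x) \<le> norm x" for k x
  proof (induction k)
    case (Suc k)
    have "P (Suc k) *v x = V *v (P k *v x)" by (simp add: P_def matrix_vector_mul_assoc)
    then show ?case using V[of "P k *v x"] Suc by simp
  qed (simp add: P_def)
  have "\<bar>P k $ i $ j\<bar> \<le> 1" for k i j
  proof -
    have "P k $ i $ j = (P k *v axis j 1) $ i" by (simp add: matrix_vector_mult_basis column_def)
    also have "\<bar>\<dots>\<bar> \<le> norm (P k *v axis j 1)" by (rule component_le_norm_cart)
    also have "\<dots> \<le> 1" using nrm[of k "axis j 1"] by simp
    finally show ?thesis .
  qed
  then have b: "\<bar>det V\<bar> ^ k \<le> real (card {p. p permutes (UNIV :: 'm set)})" for k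
    using abs_det_le_card_permutations[of "P k"] by (simp add: det power_abs)
  obtain k where "real (card {p. p permutes (UNIV :: 'm set)}) < \<bar>det V\<bar> ^ k"
    using real_arch_pow[OF d] by blast
  with b[of k] show False by simp
qed

section \<open>Monotonicity of the determinant on positive definite matrices\<close>

lemma sym_inner_commute:
  assumes "B \<in> sym_mats"
  shows "x \<bullet> (B *v y) = y \<bullet> (B *v x)"
proof -
  have "x v* B = B *v x"
  proof -
    have t: "transpose B = B" using assms by (simp add: sym_mats_def)
    have "x v* transpose B = B *v x" by (rule vector_transpose_matrix)
    then show ?thesis by (simp only: t)
  qed
  then show ?thesis using dot_lmul_matrix[of x B y] by (simp add: inner_commute)
qed

text \<open>Gram-Schmidt for the inner product \<open>x \<bullet> (B *v y)\<close>, run over growing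
  index sets; a dimension count supplies a vector outside the span of the family built so
  far.\<close>

lemma pos_definite_orthonormal_family:
  fixes B :: "real^'m^'m"
  assumes sym: "B \<in> sym_mats" and pos: "pos_definite B"
  shows "\<exists>f :: 'm \<Rightarrow> real^'m. \<forall>i j. f i \<bullet> (B *v f j) = (if i = j then 1 else 0)"
proof -
  have "\<exists>f :: 'm \<Rightarrow> real^'m. \<forall>i\<in>I. \<forall>j\<in>I. f i \<bullet> (B *v f j) = (if i = j then 1 else 0)" for I :: "'m set"
  proof (induction I rule: finite_induct[OF finite])
    case 1 show ?case by simp
  next
    case (2 a I)
    then obtain f where f: "\<And>i j. i \<in> I \<Longrightarrow> j \<in> I \<Longrightarrow> f i \<bullet> (B *v f j) = (if i = j then 1 else 0)" by blast
    have "dim (f ` I) \<le> card (f ` I)" by (rule dim_le_card') simp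
    also have "\<dots> \<le> card I" by (rule card_image_le) simp
    also have "\<dots> < CARD('m)" using 2(2) by (metis UNIV_I finite psubsetI psubset_card_mono subset_UNIV)
    finally have "span (f ` I) \<noteq> UNIV" by (metis dim_span dim_UNIV DIM_cart DIM_real mult.right_neutral nat_less_le)
    then obtain v where v: "v \<notin> span (f ` I)" by auto
    define w where "w = v - (\<Sum>i\<in>I. (v \<bullet> (B *v f i)) *\<^sub>R f i)"
    have "w \<noteq> 0"
    proof
      assume "w = 0"
      then have "v = (\<Sum>i\<in>I. (v \<bullet> (B *v f i)) *\<^sub>R f i)" by (simp add: w_def)
      moreover have "(\<Sum>i\<in>I. (v \<bullet> (B *v f i)) *\<^sub>R f i) \<in> span (f ` I)"
        by (intro span_sum span_scale span_base) auto
      ultimately show False using v by simp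
    qed
    then have wp: "w \<bullet> (B *v w) > 0" using pos by (simp add: pos_definite_def)
    have wo: "w \<bullet> (B *v f j) = 0" if "j \<in> I" for j
    proof -
      have "w \<bullet> (B *v f j) = v \<bullet> (B *v f j) - (\<Sum>i\<in>I. (v \<bullet> (B *v f i)) * (f i \<bullet> (B *v f j)))"
        by (simp add: w_def inner_diff_left inner_sum_left)
      also have "(\<Sum>i\<in>I. (v \<bullet> (B *v f i)) * (f i \<bullet> (B *v f j))) = (\<Sum>i\<in>I. if i = j then v \<bullet> (B *v f j) else 0)"
        by (rule sum.cong) (use f that in auto)
      finally show ?thesis using that by simp
    qed
    define g where "g = f(a := (1 / sqrt (w \<bullet> (B *v w))) *\<^sub>R w)"
    have 1: "g a \<bullet> (B *v g a) = 1"
      using wp by (simp add: g_def matrix_vector_mult_scaleR)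
    have 2: "g a \<bullet> (B *v g j) = 0" "g j \<bullet> (B *v g a) = 0" if "j \<in> I" for j
    proof -
      have "j \<noteq> a" using that \<open>a \<notin> I\<close> by auto
      then show "g a \<bullet> (B *v g j) = 0" using wo[OF that] by (simp add: g_def)
      then show "g j \<bullet> (B *v g a) = 0" using sym_inner_commute[OF sym] by metis
    qed
    have 3: "g i \<bullet> (B *v g j) = (if i = j then 1 else 0)" if "i \<in> I" "j \<in> I" for i j
      using f[OF that] that \<open>a \<notin> I\<close> by (auto simp: g_def)
    show ?case
      by (intro exI[of _ g]) (use 1 2 3 \<open>a \<notin> I\<close> in auto)
  qed
  from this[of UNIV] show ?thesis by simp
qed

text \<open>The columns of \<open>W\<close> are orthonormal for \<open>B\<close>. This congruence
  with the identity takes the place of eigenvalues and square roots in the determinant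
  estimates.\<close>

lemma pos_definite_factor:
  fixes B :: "real^'m^'m"
  assumes sym: "B \<in> sym_mats" and pos: "pos_definite B"
  obtains W :: "real^'m^'m" where "transpose W ** B ** W = mat 1"
proof -
  obtain f :: "'m \<Rightarrow> real^'m" where f: "\<And>i j. f i \<bullet> (B *v f j) = (if i = j then 1 else 0)"
    using pos_definite_orthonormal_family[OF assms] by blast
  define W where "W = (\<chi> a b. f b $ a)"
  have "(transpose W ** B ** W) $ i $ j = f i \<bullet> (B *v f j)" for i j
  proof -
    have "(transpose W ** B ** W) $ i $ j = (transpose W ** (B ** W)) $ i $ j" by (simp add: matrix_mul_assoc)
    also have "\<dots> = (\<Sum>k\<in>UNIV. f i $ k * (\<Sum>l\<in>UNIV. B $ k $ l * f j $ l))"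
      by (simp add: matrix_matrix_mult_def transpose_def W_def)
    also have "\<dots> = f i \<bullet> (B *v f j)" by (simp add: inner_vec_def matrix_vector_mult_def)
    finally show ?thesis .
  qed
  then have "transpose W ** B ** W = mat 1" by (simp add: vec_eq_iff f mat_def)
  then show thesis by (rule that)
qed

lemma det_pos_definite_pos:
  fixes B :: "real^'m^'m"
  assumes sym: "B \<in> sym_mats" and pos: "pos_definite B"
  shows "0 < det B"
proof -
  obtain W :: "real^'m^'m" where "transpose W ** B ** W = mat 1"
    by (rule pos_definite_factor[OF assms])
  then have "det (transpose W ** B ** W) = 1" by simp
  then have "(det W)\<^sup>2 * det B = 1" by (simp add: det_mul power2_eq_square mult_ac)
  then show ?thesis by (metis mult_nonneg_nonpos not_le zero_le_power2 zero_less_one)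
qed

text \<open>With \<open>W\<close> and \<open>U\<close> normalizing \<open>B\<close> and
  \<open>D\<close>, the matrix \<open>V = transpose W ** B ** U\<close> is a contraction because
  \<open>B \<preceq> D\<close>, and the square of its determinant is det B / det D.\<close>

lemma det_mono_pos_definite:
  fixes B D :: "real^'m^'m"
  assumes B: "B \<in> sym_mats" "pos_definite B" and D: "D \<in> sym_mats" and le: "B \<preceq> D"
  shows "det B \<le> det D"
proof -
  have Dp: "pos_definite D"
    using B(2) le unfolding pos_definite_def mat_le_def by (meson less_le_trans)
  obtain W :: "real^'m^'m" where W: "transpose W ** B ** W = mat 1"
    by (rule pos_definite_factor[OF B])
  obtain U :: "real^'m^'m" where U: "transpose U ** D ** U = mat 1"
    by (rule pos_definite_factor[OF D Dp])
  \<comment> \<open>Since \<open>transpose W ** B\<close> is the inverse of \<open>W\<close>, the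
    vector \<open>V *v x\<close> holds the coordinates of \<open>U *v x\<close> in the
    \<open>B\<close>-orthonormal basis, and its norm is the length measured by
    \<open>B\<close>.\<close>
  have W': "W ** (transpose W ** B) = mat 1" using W matrix_left_right_inverse by blast
  have form: "(P *v x) \<bullet> (M *v (P *v x)) = x \<bullet> ((transpose P ** M ** P) *v x)" for P M :: "real^'m^'m" and x
  proof -
    have "(P *v x) \<bullet> (M *v (P *v x)) = x \<bullet> (transpose P *v (M *v (P *v x)))"
      by (simp only: dot_lmul_matrix[symmetric] vector_transpose_matrix)
    then show ?thesis by (simp add: matrix_vector_mul_assoc matrix_mul_assoc)
  qed
  define V where "V = transpose W ** B ** U"
  have "norm (V *v x) \<le> norm x" for x
  proof -
    define y where "y = U *v x"
    have Vx: "V *v x = (transpose W ** B) *v y" by (simp add: V_def y_def matrix_vector_mul_assoc)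
    have "W *v (V *v x) = y" by (simp add: Vx matrix_vector_mul_assoc W')
    then have "(V *v x) \<bullet> (V *v x) = y \<bullet> (B *v y)" using form[of W "V *v x" B] by (simp add: W)
    also have "\<dots> \<le> y \<bullet> (D *v y)" using le by (simp add: mat_le_def)
    also have "\<dots> = x \<bullet> x" using form[of U x D] by (simp add: y_def U)
    finally show ?thesis by (simp add: norm_le)
  qed
  then have "\<bar>det V\<bar> \<le> 1" by (rule abs_det_contraction_le_1)
  then have "(det V)\<^sup>2 \<le> 1" by (simp add: abs_square_le_1)
  moreover have detW: "(det W)\<^sup>2 * det B = 1"
  proof -
    have "det (transpose W ** B ** W) = 1" using W by simp
    then show ?thesis by (simp add: det_mul power2_eq_square mult_ac)
  qed
  moreover have "(det V)\<^sup>2 = ((det W)\<^sup>2 * det B) * (det B * (det U)\<^sup>2)"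
    by (simp add: V_def det_mul power2_eq_square mult_ac)
  ultimately have "det B * (det U)\<^sup>2 \<le> 1" by simp
  moreover have detU: "(det U)\<^sup>2 * det D = 1"
  proof -
    have "det (transpose U ** D ** U) = 1" using U by simp
    then show ?thesis by (simp add: det_mul power2_eq_square mult_ac)
  qed
  moreover have "0 < (det U)\<^sup>2" using detU by (metis mult_zero_left zero_less_power2 zero_neq_one power_zero_numeral)
  ultimately have "(det U)\<^sup>2 * det B \<le> (det U)\<^sup>2 * det D" by (simp add: mult.commute)
  then show ?thesis using \<open>0 < (det U)\<^sup>2\<close> by simp
qed

text \<open>Scaling a matrix by \<open>t = 1 - \<delta> / \<gamma>\<close> multiplies its
  determinant by \<open>t ^ CARD('m)\<close>, which is the source of the factor
  \<open>CARD('m)\<close> in front of the logarithm.\<close>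

lemma ln_det_perturbation:
  fixes M N :: "real^'m^'m"
  assumes M: "M \<in> sym_mats" "\<gamma> *\<^sub>R mat 1 \<preceq> M" and N: "N \<in> sym_mats" "M - \<delta> *\<^sub>R mat 1 \<preceq> N"
    and \<delta>: "0 \<le> \<delta>" "\<delta> < \<gamma>"
  shows "pos_definite N" "0 < det M" "0 < det N"
    "ln (det M) + real CARD('m) * ln (1 - \<delta> / \<gamma>) \<le> ln (det N)"
proof -
  have I: "x \<bullet> ((c *\<^sub>R mat 1) *v x) = c * (norm x)\<^sup>2" for c and x :: "real^'m"
    by (simp add: scaleR_matrix_vector_assoc[symmetric] power2_norm_eq_inner)
  have Mg: "\<gamma> * (norm x)\<^sup>2 \<le> x \<bullet> (M *v x)" for x using M(2) by (simp add: mat_le_def I)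
  have Ng: "x \<bullet> (M *v x) - \<delta> * (norm x)\<^sup>2 \<le> x \<bullet> (N *v x)" for x
    using N(2) by (simp add: mat_le_def matrix_vector_mult_diff_rdistrib inner_diff_right I)
  have \<gamma>: "\<gamma> > 0" using \<delta> by simp
  have Mp: "pos_definite M"
    unfolding pos_definite_def using Mg \<gamma> by (meson less_le_trans mult_pos_pos zero_less_norm_iff zero_less_power)
  define t where "t = 1 - \<delta> / \<gamma>"
  have t: "t > 0" "t \<le> 1" using \<delta> \<gamma> by (simp_all add: t_def)
  have tM: "t * (x \<bullet> (M *v x)) \<le> x \<bullet> (N *v x)" for x
  proof -
    have "\<delta> / \<gamma> * (\<gamma> * (norm x)\<^sup>2) \<le> \<delta> / \<gamma> * (x \<bullet> (M *v x))"
      using \<delta> \<gamma> Mg by (intro mult_left_mono) auto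
    then have "\<delta> * (norm x)\<^sup>2 \<le> \<delta> / \<gamma> * (x \<bullet> (M *v x))" using \<gamma> by simp
    then show ?thesis using Ng[of x] by (simp add: t_def left_diff_distrib)
  qed
  show Np: "pos_definite N"
    unfolding pos_definite_def
  proof (intro allI impI)
    fix x :: "real^'m" assume "x \<noteq> 0"
    then have "0 < t * (x \<bullet> (M *v x))" using Mp t(1) by (simp add: pos_definite_def)
    then show "0 < x \<bullet> (N *v x)" using tM[of x] by simp
  qed
  show dM: "0 < det M" by (rule det_pos_definite_pos[OF M(1) Mp])
  show dN: "0 < det N" by (rule det_pos_definite_pos[OF N(1) Np])
  have "t *\<^sub>R M \<in> sym_mats" using M(1) by (simp add: sym_mats_def vec_eq_iff transpose_def)
  moreover have "pos_definite (t *\<^sub>R M)"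
    using Mp t(1) by (simp add: pos_definite_def scaleR_matrix_vector_assoc[symmetric])
  moreover have "t *\<^sub>R M \<preceq> N" using tM by (simp add: mat_le_def scaleR_matrix_vector_assoc[symmetric])
  ultimately have "det (t *\<^sub>R M) \<le> det N" using N(1) by (intro det_mono_pos_definite)
  moreover have "det (t *\<^sub>R M) = t ^ CARD('m) * det M"
    by (simp add: det_def prod.distrib sum_distrib_left mult_ac)
  ultimately have "ln (t ^ CARD('m) * det M) \<le> ln (det N)" using t(1) dM dN by simp
  then show "ln (det M) + real CARD('m) * ln (1 - \<delta> / \<gamma>) \<le> ln (det N)"
    unfolding t_def[symmetric] using t(1) dM by (simp add: ln_mult ln_realpow)
qed

text \<open>Polarization turns a bound on the quadratic form into one on every entry. This is the
  compactness estimate for the matrices in the theorem on sums.\<close>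

lemma norm_sym_mat_le:
  fixes X :: "real^'n^'n"
  assumes X: "X \<in> sym_mats" and b: "\<And>h. \<bar>h \<bullet> (X *v h)\<bar> \<le> c * (norm h)\<^sup>2"
  shows "norm X \<le> real CARD('n) * (real CARD('n) * c)"
proof -
  have e: "\<bar>X $ i $ j\<bar> \<le> c" for i j
  proof -
    define a b where "a = (axis i 1 :: real^'n)" and "b = (axis j 1 :: real^'n)"
    have n: "norm a = 1" "norm b = 1" by (simp_all add: a_def b_def)
    have ij: "X $ i $ j = a \<bullet> (X *v b)"
      by (simp add: a_def b_def matrix_vector_mult_basis column_def inner_axis')
    have "4 * (a \<bullet> (X *v b)) = (a + b) \<bullet> (X *v (a + b)) - (a - b) \<bullet> (X *v (a - b))"
      using sym_inner_commute[OF X, of a b]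
      by (simp add: inner_add_left inner_add_right inner_diff_left inner_diff_right matrix_vector_right_distrib matrix_vector_mult_diff_distrib)
    then have "4 * \<bar>a \<bullet> (X *v b)\<bar> \<le> c * (norm (a + b))\<^sup>2 + c * (norm (a - b))\<^sup>2"
      using assms(2)[of "a + b"] assms(2)[of "a - b"] by linarith
    also have "\<dots> = c * (2 * (norm a)\<^sup>2 + 2 * (norm b)\<^sup>2)"
      by (simp add: power2_norm_eq_inner inner_add_left inner_add_right inner_diff_left inner_diff_right algebra_simps)
    finally have "\<bar>a \<bullet> (X *v b)\<bar> \<le> c" using n by simp
    then show ?thesis using ij by simp
  qed
  have "norm X \<le> (\<Sum>i\<in>UNIV. norm (X $ i))" by (simp add: norm_vec_def L2_set_le_sum)
  also have "\<dots> \<le> (\<Sum>i\<in>(UNIV :: 'n set). real CARD('n) * c)"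
  proof (rule sum_mono)
    fix i
    have "norm (X $ i) \<le> (\<Sum>j\<in>UNIV. \<bar>X $ i $ j\<bar>)" by (rule norm_le_l1_cart)
    also have "\<dots> \<le> (\<Sum>j\<in>(UNIV :: 'n set). c)" by (intro sum_mono e)
    finally show "norm (X $ i) \<le> real CARD('n) * c" by simp
  qed
  finally show ?thesis by simp
qed

section \<open>The theorem on sums\<close>

text \<open>The filter \<open>at x within S\<close> omits \<open>x\<close> itself; the hypothesis
  \<open>u x < c\<close> restores it, giving a full neighbourhood.\<close>

lemma usc_on_nbhd:
  assumes "usc_on S u" "x \<in> S" "u x < c"
  obtains T where "open T" "x \<in> T" "\<And>y. y \<in> T \<inter> S \<Longrightarrow> u y < c"
proof -
  have "\<forall>\<^sub>F y in at x within S. u y < c" using assms by (auto simp: usc_on_def)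
  then obtain T where "open T" "x \<in> T" "\<And>y. y \<in> T \<Longrightarrow> y \<noteq> x \<Longrightarrow> y \<in> S \<Longrightarrow> u y < c"
    unfolding eventually_at_topological by blast
  then show thesis using assms(3) by (intro that[of T]) auto
qed

lemma usc_on_add:
  assumes u: "usc_on S u" and w: "usc_on S w"
  shows "usc_on S (\<lambda>x. u x + w x)"
  unfolding usc_on_def
proof (intro ballI allI impI)
  fix x c assume x: "x \<in> S" "u x + w x < c"
  define e where "e = (c - u x - w x) / 2"
  have e: "e > 0" using x by (simp add: e_def)
  have "\<forall>\<^sub>F y in at x within S. u y < u x + e" "\<forall>\<^sub>F y in at x within S. w y < w x + e"
    using u w x(1) e unfolding usc_on_def by auto
  then show "\<forall>\<^sub>F y in at x within S. u y + w y < c"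
    by eventually_elim (simp add: e_def field_simps)
qed

lemma usc_on_compose:
  assumes u: "usc_on S u" and g: "continuous_on T g" "g ` T \<subseteq> S"
  shows "usc_on T (\<lambda>x. u (g x))"
  unfolding usc_on_def
proof (intro ballI allI impI)
  fix x c assume x: "x \<in> T" "u (g x) < c"
  obtain U where U: "open U" "g x \<in> U" "\<And>y. y \<in> U \<inter> S \<Longrightarrow> u y < c"
    using usc_on_nbhd[OF u, of "g x" c] x g(2) by blast
  have "\<forall>\<^sub>F y in at x within T. g y \<in> U"
    using g(1) x(1) U(1,2) unfolding continuous_on_def by (auto intro: topological_tendstoD)
  moreover have "\<forall>\<^sub>F y in at x within T. y \<in> T" by (simp add: eventually_at_filter)
  ultimately show "\<forall>\<^sub>F y in at x within T. u (g y) < c"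
    by eventually_elim (use U(3) g(2) in auto)
qed

lemma continuous_imp_usc_on:
  fixes f :: "'a::topological_space \<Rightarrow> real"
  assumes "continuous_on S f"
  shows "usc_on S f"
  using assms unfolding usc_on_def continuous_on_def by (auto intro: order_tendstoD)

lemma usc_on_subset: "usc_on S u \<Longrightarrow> T \<subseteq> S \<Longrightarrow> usc_on T u"
  using usc_on_compose[of S u T "\<lambda>x. x"] by (auto intro: continuous_on_id)

lemma lsc_on_uminus: "lsc_on S v \<Longrightarrow> usc_on S (\<lambda>x. - v x)"
  unfolding lsc_on_def usc_on_def
proof (intro ballI allI impI)
  fix x c assume *: "\<forall>x\<in>S. \<forall>c<v x. \<forall>\<^sub>F y in at x within S. c < v y" "x \<in> S" "- v x < c"
  then have "\<forall>\<^sub>F y in at x within S. - c < v y" by auto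
  then show "\<forall>\<^sub>F y in at x within S. - v y < c" by eventually_elim simp
qed

lemma usc_on_limit_less:
  assumes "usc_on S u" "x \<longlonglongrightarrow> a" "\<And>k. x k \<in> S" "a \<in> S" "u a < c"
  shows "\<forall>\<^sub>F k in sequentially. u (x k) < c"
proof -
  obtain U where U: "open U" "a \<in> U" "\<And>y. y \<in> U \<inter> S \<Longrightarrow> u y < c"
    using usc_on_nbhd[OF assms(1,4,5)] by blast
  have "\<forall>\<^sub>F k in sequentially. x k \<in> U" using assms(2) U(1,2) by (rule topological_tendstoD)
  then show ?thesis by eventually_elim (use U(3) assms(3) in auto)
qed

lemma usc_on_add_continuous: "usc_on S u \<Longrightarrow> continuous_on S f \<Longrightarrow> usc_on S (\<lambda>x. u x + f x)"
  for f :: "'a::topological_space \<Rightarrow> real"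
  by (rule usc_on_add[OF _ continuous_imp_usc_on])

text \<open>Without a maximum, each \<open>x\<close> would have a strictly better \<open>g x\<close>
  and a neighbourhood on which \<open>u\<close> stays below \<open>u (g x)\<close>. In a finite
  subcover the largest of the values \<open>u (g x)\<close> would then lie below another
  one.\<close>

lemma usc_on_attains_sup:
  assumes S: "compact S" "S \<noteq> {}" and u: "usc_on S u"
  shows "\<exists>x\<in>S. \<forall>y\<in>S. u y \<le> u x"
proof (rule ccontr)
  assume "\<not> ?thesis"
  then have "\<forall>x\<in>S. \<exists>y\<in>S. u x < u y" by (auto simp: not_le)
  then obtain g where g: "\<And>x. x \<in> S \<Longrightarrow> g x \<in> S" "\<And>x. x \<in> S \<Longrightarrow> u x < u (g x)" by metis
  have "\<forall>x\<in>S. \<exists>T. open T \<and> x \<in> T \<and> (\<forall>y\<in>T \<inter> S. u y < u (g x))"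
    using usc_on_nbhd[OF u] g(2) by metis
  then obtain T where T: "\<And>x. x \<in> S \<Longrightarrow> open (T x)" "\<And>x. x \<in> S \<Longrightarrow> x \<in> T x"
    "\<And>x y. x \<in> S \<Longrightarrow> y \<in> T x \<inter> S \<Longrightarrow> u y < u (g x)" by metis
  obtain D where D: "D \<subseteq> S" "finite D" "S \<subseteq> (\<Union>x\<in>D. T x)"
    using compactE_image[OF S(1), of S T] T by blast
  have "D \<noteq> {}" using D S(2) by auto
  define M where "M = Max ((\<lambda>x. u (g x)) ` D)"
  have "M \<in> (\<lambda>x. u (g x)) ` D" unfolding M_def using D(2) \<open>D \<noteq> {}\<close> by (intro Max_in) auto
  then obtain x where x: "x \<in> D" "M = u (g x)" by auto
  have "g x \<in> S" using x D g by auto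
  then obtain y where y: "y \<in> D" "g x \<in> T y" using D(3) by auto
  then have "u (g x) < u (g y)" using T(3)[of y "g x"] D(1) \<open>g x \<in> S\<close> by auto
  also have "u (g y) \<le> M" unfolding M_def using D(2) y(1) by (intro Max_ge) auto
  finally show False using x by simp
qed

section \<open>Superjets and sup-convolutions\<close>

text \<open>The second order superjet of viscosity theory relative to \<open>C\<close>, with the
  little-o remainder written out.\<close>

definition superjet ::
  "(real^'n) set \<Rightarrow> (real^'n \<Rightarrow> real) \<Rightarrow> real^'n \<Rightarrow> real^'n \<Rightarrow> real^'n^'n \<Rightarrow> bool" where
  "superjet C \<alpha> x q X \<longleftrightarrow> (\<forall>e>0. \<exists>d>0. \<forall>h. norm h < d \<longrightarrow> x + h \<in> C \<longrightarrow>
     \<alpha> (x + h) \<le> \<alpha> x + q \<bullet> h + 1 / 2 * (h \<bullet> (X *v h)) + e * (norm h)\<^sup>2)"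

text \<open>A second order expansion delivers a linear map whose matrix may fail to be symmetric,
  while the structure conditions speak of symmetric matrices; the expansion sees only the quadratic
  form.\<close>

lemma quadratic_form_symmetrize:
  fixes A :: "real^'n \<Rightarrow> real^'n"
  assumes "linear A"
  shows "\<exists>X\<in>sym_mats. \<forall>h. h \<bullet> (X *v h) = h \<bullet> A h"
proof
  let ?M = "matrix A"
  show "(1 / 2) *\<^sub>R (?M + transpose ?M) \<in> sym_mats"
    by (simp add: sym_mats_def vec_eq_iff transpose_def)
  have "h \<bullet> (transpose ?M *v h) = h \<bullet> (?M *v h)" for h
    by (metis dot_lmul_matrix inner_commute vector_transpose_matrix)
  then show "\<forall>h. h \<bullet> ((1 / 2) *\<^sub>R (?M + transpose ?M) *v h) = h \<bullet> A h"
    by (simp add: matrix_vector_mult_add_rdistrib scaleR_matrix_vector_assoc[symmetric] inner_add_right matrix_vector_mul(2)[OF assms, symmetric, THEN fun_cong])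
qed

lemma le_of_le_add_eps:
  fixes x y c :: real
  assumes "\<And>e. e > 0 \<Longrightarrow> x \<le> y + e * c" and "c \<ge> 0"
  shows "x \<le> y"
proof (rule field_le_epsilon)
  fix e :: real assume "e > 0"
  have "x \<le> y + (e / (c + 1)) * c" using \<open>e > 0\<close> assms by (intro assms(1)) auto
  also have "(e / (c + 1)) * c \<le> e" using \<open>e > 0\<close> assms(2) by (simp add: field_simps)
  finally show "x \<le> y + e" by simp
qed

text \<open>Completing the square, \<open>\<Phi> \<xi>\<close> is the maximum over \<open>C\<close>
  of \<open>\<alpha> x\<close> minus \<open>l / 2\<close> times the squared distance from
  \<open>x\<close> to \<open>\<xi>\<close>, plus \<open>l / 2 * (norm \<xi>)\<^sup>2\<close>. As a
  maximum of functions affine in \<open>\<xi>\<close> it has the slope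
  \<open>l *\<^sub>R m \<xi>\<close> of a maximizing one as a subgradient.\<close>

lemma sup_convolution:
  fixes \<alpha> :: "real^'n \<Rightarrow> real"
  assumes C: "compact C" "0 \<in> C" and \<alpha>: "usc_on C \<alpha>" "\<alpha> 0 = 0" and l: "l > 0"
  obtains \<Phi> m where "\<And>\<xi>. m \<xi> \<in> C" "\<And>\<xi>. \<Phi> \<xi> = \<alpha> (m \<xi>) - l / 2 * (norm (m \<xi>))\<^sup>2 + l * (m \<xi> \<bullet> \<xi>)"
    "\<And>\<xi> x. x \<in> C \<Longrightarrow> \<alpha> x - l / 2 * (norm x)\<^sup>2 + l * (x \<bullet> \<xi>) \<le> \<Phi> \<xi>"
    "\<And>\<xi>. subgradient \<Phi> \<xi> (l *\<^sub>R m \<xi>)" "\<And>\<xi>. 0 \<le> \<Phi> \<xi>"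
proof -
  define f where "f \<xi> x = \<alpha> x + (- (l / 2 * (norm x)\<^sup>2) + l * (x \<bullet> \<xi>))" for \<xi> x
  have "\<exists>x\<in>C. \<forall>y\<in>C. f \<xi> y \<le> f \<xi> x" for \<xi>
    unfolding f_def using C by (intro usc_on_attains_sup usc_on_add_continuous \<alpha>(1) continuous_intros) auto
  then obtain m where m: "\<And>\<xi>. m \<xi> \<in> C" "\<And>\<xi> y. y \<in> C \<Longrightarrow> f \<xi> y \<le> f \<xi> (m \<xi>)" by metis
  define \<Phi> where "\<Phi> \<xi> = f \<xi> (m \<xi>)" for \<xi>
  show thesis
  proof (rule that[of m \<Phi>])
    show "m \<xi> \<in> C" for \<xi> by (rule m)
    show "\<Phi> \<xi> = \<alpha> (m \<xi>) - l / 2 * (norm (m \<xi>))\<^sup>2 + l * (m \<xi> \<bullet> \<xi>)" for \<xi>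
      by (simp add: \<Phi>_def f_def)
    show le: "\<alpha> x - l / 2 * (norm x)\<^sup>2 + l * (x \<bullet> \<xi>) \<le> \<Phi> \<xi>" if "x \<in> C" for x \<xi>
      using m(2)[OF that, of \<xi>] by (simp add: \<Phi>_def f_def)
    show "subgradient \<Phi> \<xi> (l *\<^sub>R m \<xi>)" for \<xi>
      unfolding subgradient_def
    proof
      fix w
      show "\<Phi> \<xi> + l *\<^sub>R m \<xi> \<bullet> (w - \<xi>) \<le> \<Phi> w"
        using m(2)[OF m(1)[of \<xi>], of w] by (simp add: \<Phi>_def f_def inner_diff_right algebra_simps)
    qed
    show "0 \<le> \<Phi> \<xi>" for \<xi> using le[OF C(2), of \<xi>] \<alpha>(2) by simp
  qed
qed

text \<open>Moving \<open>x\<close> and \<open>\<xi>\<close> by the same \<open>h\<close> leaves the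
  penalty on their difference unchanged, so the expansion of the convolution at \<open>\<xi>\<close>
  passes to \<open>\<alpha>\<close> at \<open>x\<close>. Undoing the added quadratic shifts the
  slope by \<open>l *\<^sub>R \<xi>\<close> and the matrix by
  \<open>l *\<^sub>R mat 1\<close>.\<close>

lemma superjet_of_sup_convolution:
  fixes \<alpha> :: "real^'n \<Rightarrow> real"
  assumes \<Phi>: "\<Phi> \<xi> = \<alpha> x - l / 2 * (norm x)\<^sup>2 + l * (x \<bullet> \<xi>)"
    and le: "\<And>y \<eta>. y \<in> C \<Longrightarrow> \<alpha> y - l / 2 * (norm y)\<^sup>2 + l * (y \<bullet> \<eta>) \<le> \<Phi> \<eta>"
    and ex: "\<And>e. e > 0 \<Longrightarrow> \<exists>d>0. \<forall>h. norm h < d \<longrightarrow>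
       \<Phi> (\<xi> + h) \<le> \<Phi> \<xi> + (l *\<^sub>R x) \<bullet> h + 1 / 2 * (h \<bullet> (X *v h)) + e * (norm h)\<^sup>2"
  shows "superjet C \<alpha> x (l *\<^sub>R (x - \<xi>)) (X - l *\<^sub>R mat 1)"
  unfolding superjet_def
proof (intro allI impI)
  fix e :: real assume "e > 0"
  then obtain d where d: "d > 0" "\<And>h. norm h < d \<Longrightarrow>
     \<Phi> (\<xi> + h) \<le> \<Phi> \<xi> + (l *\<^sub>R x) \<bullet> h + 1 / 2 * (h \<bullet> (X *v h)) + e * (norm h)\<^sup>2" using ex by blast
  show "\<exists>d>0. \<forall>h. norm h < d \<longrightarrow> x + h \<in> C \<longrightarrow>
     \<alpha> (x + h) \<le> \<alpha> x + l *\<^sub>R (x - \<xi>) \<bullet> h + 1 / 2 * (h \<bullet> ((X - l *\<^sub>R mat 1) *v h)) + e * (norm h)\<^sup>2"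
  proof (intro exI[of _ d] conjI allI impI d(1))
    fix h assume h: "norm h < d" "x + h \<in> C"
    have 1: "\<alpha> (x + h) - l / 2 * (norm (x + h))\<^sup>2 + l * ((x + h) \<bullet> (\<xi> + h))
       \<le> \<Phi> \<xi> + (l *\<^sub>R x) \<bullet> h + 1 / 2 * (h \<bullet> (X *v h)) + e * (norm h)\<^sup>2"
      using le[OF h(2), of "\<xi> + h"] d(2)[OF h(1)] by linarith
    have 2: "h \<bullet> ((X - l *\<^sub>R mat 1) *v h) = h \<bullet> (X *v h) - l * (norm h)\<^sup>2"
      by (simp add: matrix_vector_mult_diff_rdistrib scaleR_matrix_vector_assoc[symmetric] inner_diff_right power2_norm_eq_inner)
    have 3: "(norm (x + h))\<^sup>2 = (norm x)\<^sup>2 + 2 * (x \<bullet> h) + (norm h)\<^sup>2"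
      by (simp add: power2_norm_eq_inner inner_add_left inner_add_right inner_commute)
    have 4: "(x + h) \<bullet> (\<xi> + h) = x \<bullet> \<xi> + x \<bullet> h + \<xi> \<bullet> h + (norm h)\<^sup>2"
      by (simp add: power2_norm_eq_inner inner_add_left inner_add_right inner_commute)
    show "\<alpha> (x + h) \<le> \<alpha> x + l *\<^sub>R (x - \<xi>) \<bullet> h + 1 / 2 * (h \<bullet> ((X - l *\<^sub>R mat 1) *v h)) + e * (norm h)\<^sup>2"
      using 1 unfolding 2 3 4 \<Phi> by (simp add: inner_diff_left algebra_simps)
  qed
qed


text \<open>The bounds in the next theorem on points, slopes, values and matrices cost factors among
  1 / l, 1 + l, 1 and 2; the constant \<open>s\<close> dominates all of them.\<close>

lemma sums_small:
  fixes l \<kappa> :: real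
  assumes "l > 0" "\<kappa> > 0"
  obtains k where "k > 0" "k \<le> 1" "k / l < \<kappa>" "(1 + l) * k < \<kappa>" "k < \<kappa>" "2 * k \<le> \<kappa>"
proof -
  define s where "s = 2 + l + 1 / l"
  have s: "s > 0" "1 / l \<le> s" "1 + l \<le> s" "2 \<le> s" using assms by (auto simp: s_def add_pos_pos)
  define k where "k = min 1 (\<kappa> / (2 * s))"
  have k: "k > 0" "k \<le> 1" using s(1) assms by (auto simp: k_def)
  have "k \<le> \<kappa> / (2 * s)" by (simp add: k_def)
  then have sk: "s * k \<le> \<kappa> / 2" using s(1) by (simp add: field_simps)
  have m: "a * k \<le> \<kappa> / 2" if "a \<le> s" for a using mult_right_mono[OF that, of k] k(1) sk by linarith
  show thesis
  proof (rule that[of k])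
    have "k / l = 1 / l * k" by simp
    then show "k / l < \<kappa>" using m[OF s(2)] assms(2) by linarith
    show "(1 + l) * k < \<kappa>" using m[OF s(3)] assms(2) by linarith
    show "k < \<kappa>" "2 * k \<le> \<kappa>" using m[OF s(4)] assms(2) k by auto
  qed (use k in auto)
qed

text \<open>Both functions are regularized and the contact theorem is applied to \<open>H\<close> on
  the product space. The hypothesis carries \<open>l / 6\<close> because splitting
  \<open>x - y\<close> into three parts costs a factor 3, after which every part is charged at the
  rate \<open>l / 2\<close>.\<close>

theorem sums_approx:
  fixes \<alpha> \<beta> :: "real^'n \<Rightarrow> real"
  assumes C: "compact C" "0 \<in> C" and D: "compact D" "0 \<in> D"
    and \<alpha>: "usc_on C \<alpha>" "\<alpha> 0 = 0" and \<beta>: "usc_on D \<beta>" "\<beta> 0 = 0" and l: "l > 0" and \<kappa>: "\<kappa> > 0"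
    and le: "\<And>x y. x \<in> C \<Longrightarrow> y \<in> D \<Longrightarrow> \<alpha> x + \<beta> y \<le> l / 6 * (norm (x - y))\<^sup>2"
  shows "\<exists>x\<in>C. \<exists>y\<in>D. \<exists>p q. \<exists>X\<in>sym_mats. \<exists>Y\<in>sym_mats.
    norm x < \<kappa> \<and> norm y < \<kappa> \<and> \<bar>\<alpha> x\<bar> < \<kappa> \<and> \<bar>\<beta> y\<bar> < \<kappa> \<and> norm p < \<kappa> \<and> norm q < \<kappa>
    \<and> superjet C \<alpha> x p X \<and> superjet D \<beta> y q Y
    \<and> (\<forall>h. - l * (norm h)\<^sup>2 \<le> h \<bullet> (X *v h)) \<and> (\<forall>k. - l * (norm k)\<^sup>2 \<le> k \<bullet> (Y *v k))
    \<and> (\<forall>h k. h \<bullet> (X *v h) + k \<bullet> (Y *v k) \<le> l * (norm (h - k))\<^sup>2 + \<kappa> * ((norm h)\<^sup>2 + (norm k)\<^sup>2))"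
proof -
  obtain \<Phi> m where mC: "\<And>\<xi>. m \<xi> \<in> C"
    and \<Phi>: "\<And>\<xi>. \<Phi> \<xi> = \<alpha> (m \<xi>) - l / 2 * (norm (m \<xi>))\<^sup>2 + l * (m \<xi> \<bullet> \<xi>)"
    and \<Phi>le: "\<And>\<xi> x. x \<in> C \<Longrightarrow> \<alpha> x - l / 2 * (norm x)\<^sup>2 + l * (x \<bullet> \<xi>) \<le> \<Phi> \<xi>"
    and \<Phi>s: "\<And>\<xi>. subgradient \<Phi> \<xi> (l *\<^sub>R m \<xi>)" and \<Phi>0: "\<And>\<xi>. 0 \<le> \<Phi> \<xi>"
    using sup_convolution[OF C \<alpha> l] by metis
  obtain \<Psi> n where nD: "\<And>\<xi>. n \<xi> \<in> D"
    and \<Psi>: "\<And>\<xi>. \<Psi> \<xi> = \<beta> (n \<xi>) - l / 2 * (norm (n \<xi>))\<^sup>2 + l * (n \<xi> \<bullet> \<xi>)"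
    and \<Psi>le: "\<And>\<xi> x. x \<in> D \<Longrightarrow> \<beta> x - l / 2 * (norm x)\<^sup>2 + l * (x \<bullet> \<xi>) \<le> \<Psi> \<xi>"
    and \<Psi>s: "\<And>\<xi>. subgradient \<Psi> \<xi> (l *\<^sub>R n \<xi>)" and \<Psi>0: "\<And>\<xi>. 0 \<le> \<Psi> \<xi>"
    using sup_convolution[OF D \<beta> l] by metis
  define H where "H = (\<lambda>z. \<Phi> (fst z) + \<Psi> (snd z))"
  \<comment> \<open>The symmetric map whose form is \<open>l\<close> times the sum of the squared
    norms of \<open>\<xi> - \<eta>\<close>, \<open>\<xi>\<close> and \<open>\<eta>\<close>: the
    penalty together with the two quadratics that make the convolutions convex.\<close>
  define B where "B = (\<lambda>z::(real^'n) \<times> (real^'n). (l *\<^sub>R (2 *\<^sub>R fst z - snd z), l *\<^sub>R (2 *\<^sub>R snd z - fst z)))"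
  obtain k where k: "k > 0" "k \<le> 1" "k / l < \<kappa>" "(1 + l) * k < \<kappa>" "k < \<kappa>" "2 * k \<le> \<kappa>"
    using sums_small[OF l \<kappa>] .
  have Hs: "subgradient H z (l *\<^sub>R m (fst z), l *\<^sub>R n (snd z))" for z
    unfolding subgradient_def H_def
  proof
    fix w
    show "\<Phi> (fst z) + \<Psi> (snd z) + (l *\<^sub>R m (fst z), l *\<^sub>R n (snd z)) \<bullet> (w - z) \<le> \<Phi> (fst w) + \<Psi> (snd w)"
      using \<Phi>s[of "fst z", unfolded subgradient_def, rule_format, of "fst w"]
        \<Psi>s[of "snd z", unfolded subgradient_def, rule_format, of "snd w"]
      by (simp add: inner_prod_def)
  qed
  have BB: "z \<bullet> B z = l * (norm (fst z - snd z))\<^sup>2 + l * (norm (fst z))\<^sup>2 + l * (norm (snd z))\<^sup>2" for z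
    by (simp add: B_def inner_prod_def power2_norm_eq_inner inner_diff_left inner_diff_right inner_commute algebra_simps)
  have Hle: "H z \<le> 1 / 2 * (z \<bullet> B z)" for z
  proof -
    obtain \<xi> \<eta> where z: "z = (\<xi>, \<eta>)" by force
    let ?x = "m \<xi>" and ?y = "n \<eta>"
    \<comment> \<open>The difference \<open>?x - ?y\<close> is split at the convolution variables;
      \<open>norm b\<close> and \<open>norm c\<close> are the distances penalized in
      \<open>\<Phi>\<close> and \<open>\<Psi>\<close>.\<close>
    define a b c where "a = \<xi> - \<eta>" and "b = ?x - \<xi>" and "c = \<eta> - ?y"
    have "(norm (a + b + c))\<^sup>2 \<le> 3 * ((norm a)\<^sup>2 + (norm b)\<^sup>2 + (norm c)\<^sup>2)"
    proof -
      have "0 \<le> (norm (a - b))\<^sup>2 + (norm (a - c))\<^sup>2 + (norm (b - c))\<^sup>2" by simp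
      then show ?thesis
        by (simp add: power2_norm_eq_inner inner_diff_left inner_diff_right inner_add_left inner_add_right inner_commute)
    qed
    moreover have "a + b + c = ?x - ?y" by (simp add: a_def b_def c_def)
    ultimately have "l / 6 * (norm (?x - ?y))\<^sup>2 \<le> l / 6 * (3 * ((norm a)\<^sup>2 + (norm b)\<^sup>2 + (norm c)\<^sup>2))"
      using l by (intro mult_left_mono) auto
    moreover have "l / 6 * (3 * ((norm a)\<^sup>2 + (norm b)\<^sup>2 + (norm c)\<^sup>2)) = l / 2 * ((norm a)\<^sup>2 + (norm b)\<^sup>2 + (norm c)\<^sup>2)"
      by simp
    ultimately have *: "\<alpha> ?x + \<beta> ?y \<le> l / 2 * ((norm a)\<^sup>2 + (norm b)\<^sup>2 + (norm c)\<^sup>2)"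
      using le[OF mC[of \<xi>] nD[of \<eta>]] by linarith
    have b: "(norm b)\<^sup>2 = (norm ?x)\<^sup>2 - 2 * (?x \<bullet> \<xi>) + (norm \<xi>)\<^sup>2"
      by (simp add: b_def power2_norm_eq_inner inner_diff_left inner_diff_right inner_commute)
    have c: "(norm c)\<^sup>2 = (norm ?y)\<^sup>2 - 2 * (?y \<bullet> \<eta>) + (norm \<eta>)\<^sup>2"
      by (simp add: c_def power2_norm_eq_inner inner_diff_left inner_diff_right inner_commute)
    show ?thesis using * unfolding BB b c unfolding H_def z \<Phi>[of \<xi>] \<Psi>[of \<eta>] a_def by (simp add: \<Phi>[of \<xi>] \<Psi>[of \<eta>] algebra_simps)
  qed
  have Hn: "0 \<le> H z" for z using \<Phi>0 \<Psi>0 by (simp add: H_def)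
  have H0: "H 0 = 0" using Hle[of 0] Hn[of 0] by simp
  have Blin: "linear B"
    unfolding B_def by (intro linearI) (auto simp: algebra_simps)
  have Bsym: "B x \<bullet> y = x \<bullet> B y" for x y
    by (simp add: B_def inner_prod_def inner_diff_left inner_diff_right algebra_simps)
  obtain z P S where z: "norm z < k" and P: "norm P < k" and S: "linear S"
    and ex: "\<And>\<epsilon>. \<epsilon> > 0 \<Longrightarrow> \<exists>d>0. \<forall>h. norm h < d \<longrightarrow> \<bar>H (z + h) - H z - P \<bullet> h - 1 / 2 * (h \<bullet> S h)\<bar> \<le> \<epsilon> * (norm h)\<^sup>2"
    and up: "\<And>h. H (z + h) \<le> H z + P \<bullet> h + 1 / 2 * (h \<bullet> B h) + k * (norm h)\<^sup>2"
    using convex_contact_expansion[of H B k] Hs H0 Hn Blin Bsym Hle k(1) by metis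
  define \<xi> \<eta> where "\<xi> = fst z" and "\<eta> = snd z"
  define x y where "x = m \<xi>" and "y = n \<eta>"
  have z': "z = (\<xi>, \<eta>)" by (simp add: \<xi>_def \<eta>_def)
  \<comment> \<open>The paraboloid in contact from above leaves only one subgradient at
    \<open>z\<close>, so the slope \<open>P\<close> must be the pair of maximizers scaled by
    \<open>l\<close>.\<close>
  have PP: "P = (l *\<^sub>R x, l *\<^sub>R y)"
  proof -
    have "H (z + h) \<le> H z + P \<bullet> h + (3 * l + k) * (norm h)\<^sup>2" for h
    proof -
      have "(norm (fst h - snd h))\<^sup>2 \<le> 2 * ((norm (fst h))\<^sup>2 + (norm (snd h))\<^sup>2)"
        using zero_le_power2[of "norm (fst h + snd h)"]
        by (simp add: power2_norm_eq_inner inner_add_left inner_add_right inner_diff_left inner_diff_right inner_commute)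
      then have "l * (norm (fst h - snd h))\<^sup>2 \<le> l * (2 * (norm h)\<^sup>2)"
        using l by (intro mult_left_mono) (auto simp: norm_prod_def)
      moreover have "l * (norm (fst h))\<^sup>2 + l * (norm (snd h))\<^sup>2 = l * (norm h)\<^sup>2"
        by (simp add: norm_prod_def algebra_simps)
      moreover have "0 \<le> l * (norm h)\<^sup>2" using l by simp
      ultimately show ?thesis using up[of h] unfolding BB by (simp add: algebra_simps)
    qed
    from subgradient_eq_of_contact[OF Hs[of z] _ this] l k(1) show ?thesis by (simp add: x_def y_def \<xi>_def \<eta>_def)
  qed
  \<comment> \<open>The remainder of the expansion. Evaluating it at \<open>t *\<^sub>R w\<close>
    and dividing by \<open>t\<^sup>2\<close> extracts inequalities for the quadratic form of
    \<open>S\<close>.\<close>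
  define E where "E w = H (z + w) - H z - P \<bullet> w - 1 / 2 * (w \<bullet> S w)" for w
  have scale: "(t *\<^sub>R w) \<bullet> S (t *\<^sub>R w) = t\<^sup>2 * (w \<bullet> S w)" "(t *\<^sub>R w) \<bullet> B (t *\<^sub>R w) = t\<^sup>2 * (w \<bullet> B w)" for t w
    by (simp_all add: linear_scale[OF S] linear_scale[OF Blin] power2_eq_square)
  have Es: "\<exists>t>0. \<bar>E (t *\<^sub>R w1)\<bar> \<le> e * t\<^sup>2 * (norm w1)\<^sup>2 \<and> \<bar>E (t *\<^sub>R w2)\<bar> \<le> e * t\<^sup>2 * (norm w2)\<^sup>2 \<and> \<bar>E (t *\<^sub>R w3)\<bar> \<le> e * t\<^sup>2 * (norm w3)\<^sup>2"
    if e: "e > 0" for e w1 w2 w3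
  proof -
    obtain d where d: "d > 0" "\<And>h. norm h < d \<Longrightarrow> \<bar>E h\<bar> \<le> e * (norm h)\<^sup>2"
      using ex[OF e] unfolding E_def by blast
    define M where "M = norm w1 + norm w2 + norm w3 + 1"
    have M: "M > 0" "norm w1 < M" "norm w2 < M" "norm w3 < M"
      unfolding M_def using norm_ge_zero[of w1] norm_ge_zero[of w2] norm_ge_zero[of w3] by linarith+
    have t: "d / M > 0" using d(1) M by simp
    have "norm ((d / M) *\<^sub>R w) < d" if "norm w < M" for w :: "(real^'n) \<times> (real^'n)"
      using that M(1) d(1) by (simp add: field_simps)
    then have "\<bar>E ((d / M) *\<^sub>R w)\<bar> \<le> e * (d / M)\<^sup>2 * (norm w)\<^sup>2" if "norm w < M" for w
      using d(2)[of "(d / M) *\<^sub>R w"] that by (simp add: power_mult_distrib power_divide mult.assoc)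
    then show ?thesis using t M by blast
  qed
  have Sup: "w \<bullet> S w \<le> w \<bullet> B w + 2 * k * (norm w)\<^sup>2" for w
  proof (rule le_of_le_add_eps[where c="2 * (norm w)\<^sup>2"])
    fix e :: real assume "e > 0"
    obtain t where t: "t > 0" "\<bar>E (t *\<^sub>R w)\<bar> \<le> e * t\<^sup>2 * (norm w)\<^sup>2" using Es[OF \<open>e > 0\<close>, of w w w] by blast
    have "t\<^sup>2 * (w \<bullet> S w) \<le> t\<^sup>2 * (w \<bullet> B w + 2 * k * (norm w)\<^sup>2 + e * (2 * (norm w)\<^sup>2))"
      using t(2) up[of "t *\<^sub>R w"] unfolding E_def scale by (simp add: power_mult_distrib algebra_simps)
    then show "w \<bullet> S w \<le> w \<bullet> B w + 2 * k * (norm w)\<^sup>2 + e * (2 * (norm w)\<^sup>2)" using t(1) by simp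
  qed simp
  have Slow: "0 \<le> w \<bullet> S w" for w
  proof (rule le_of_le_add_eps[where c="2 * (norm w)\<^sup>2"])
    fix e :: real assume "e > 0"
    obtain t where t: "t > 0" "\<bar>E (t *\<^sub>R w)\<bar> \<le> e * t\<^sup>2 * (norm w)\<^sup>2" using Es[OF \<open>e > 0\<close>, of w w w] by blast
    have "H z + P \<bullet> (t *\<^sub>R w) \<le> H (z + t *\<^sub>R w)"
      using Hs[of z, unfolded subgradient_def, rule_format, of "z + t *\<^sub>R w"] by (simp add: PP x_def y_def \<xi>_def \<eta>_def)
    then have "0 \<le> t\<^sup>2 * (w \<bullet> S w + e * (2 * (norm w)\<^sup>2))"
      using t(2) unfolding E_def scale by (simp add: power_mult_distrib algebra_simps)
    then show "0 \<le> w \<bullet> S w + e * (2 * (norm w)\<^sup>2)" using t(1) by (simp add: zero_le_mult_iff)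
  qed simp
  \<comment> \<open>\<open>H\<close> is a sum of functions of the two variables, so its increments
    along \<open>(h, 0)\<close> and \<open>(0, k')\<close> add up to the one along
    \<open>(h, k')\<close>. Hence the form of \<open>S\<close> has no mixed part; the inequality is
    the half that is used.\<close>
  have Sadd: "(h, 0) \<bullet> S (h, 0) + (0, k') \<bullet> S (0, k') \<le> (h, k') \<bullet> S (h, k')" for h k'
  proof (rule le_of_le_add_eps[where c="2 * ((norm (h, 0::real^'n))\<^sup>2 + (norm (0::real^'n, k'))\<^sup>2 + (norm (h, k'))\<^sup>2)"])
    fix e :: real assume "e > 0"
    obtain t where t: "t > 0" "\<bar>E (t *\<^sub>R (h, 0))\<bar> \<le> e * t\<^sup>2 * (norm (h, 0::real^'n))\<^sup>2" "\<bar>E (t *\<^sub>R (0, k'))\<bar> \<le> e * t\<^sup>2 * (norm (0::real^'n, k'))\<^sup>2"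
      "\<bar>E (t *\<^sub>R (h, k'))\<bar> \<le> e * t\<^sup>2 * (norm (h, k'))\<^sup>2"
      using Es[OF \<open>e > 0\<close>, of "(h, 0)" "(0, k')" "(h, k')"] by blast
    have "E (t *\<^sub>R (h, k')) - E (t *\<^sub>R (h, 0)) - E (t *\<^sub>R (0, k')) =
       1 / 2 * (t\<^sup>2 * ((h, 0) \<bullet> S (h, 0) + (0, k') \<bullet> S (0, k') - (h, k') \<bullet> S (h, k')))"
      unfolding E_def scale by (simp add: H_def z' PP inner_prod_def algebra_simps)
    then have "t\<^sup>2 * ((h, 0) \<bullet> S (h, 0) + (0, k') \<bullet> S (0, k')) \<le>
      t\<^sup>2 * ((h, k') \<bullet> S (h, k') + e * (2 * ((norm (h, 0::real^'n))\<^sup>2 + (norm (0::real^'n, k'))\<^sup>2 + (norm (h, k'))\<^sup>2)))"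
      using t(2-4) by (simp add: algebra_simps)
    then show "(h, 0) \<bullet> S (h, 0) + (0, k') \<bullet> S (0, k') \<le> (h, k') \<bullet> S (h, k') + e * (2 * ((norm (h, 0::real^'n))\<^sup>2 + (norm (0::real^'n, k'))\<^sup>2 + (norm (h, k'))\<^sup>2))"
      using t(1) by simp
  qed simp
  have lin1: "linear (\<lambda>h. fst (S (h, 0)))"
    by (intro linearI) (simp_all add: linear_add[OF S, symmetric] linear_scale[OF S, symmetric] flip: fst_add fst_scaleR)
  have lin2: "linear (\<lambda>h. snd (S (0, h)))"
    by (intro linearI) (simp_all add: linear_add[OF S, symmetric] linear_scale[OF S, symmetric] flip: snd_add snd_scaleR)
  obtain X where X: "X \<in> sym_mats" "\<And>h. h \<bullet> (X *v h) = (h, 0) \<bullet> S (h, 0)"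
    using quadratic_form_symmetrize[OF lin1] by (auto simp: inner_prod_def)
  obtain Y where Y: "Y \<in> sym_mats" "\<And>h. h \<bullet> (Y *v h) = (0, h) \<bullet> S (0, h)"
    using quadratic_form_symmetrize[OF lin2] by (auto simp: inner_prod_def)
  have jX: "superjet C \<alpha> x (l *\<^sub>R (x - \<xi>)) (X - l *\<^sub>R mat 1)"
  proof (rule superjet_of_sup_convolution[where \<Phi>=\<Phi>])
    show "\<Phi> \<xi> = \<alpha> x - l / 2 * (norm x)\<^sup>2 + l * (x \<bullet> \<xi>)" unfolding x_def by (rule \<Phi>)
    fix e :: real assume "e > 0"
    then obtain d where d: "d > 0" "\<And>h. norm h < d \<Longrightarrow> \<bar>E h\<bar> \<le> e * (norm h)\<^sup>2"
      using ex unfolding E_def by blast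
    show "\<exists>d>0. \<forall>h. norm h < d \<longrightarrow> \<Phi> (\<xi> + h) \<le> \<Phi> \<xi> + l *\<^sub>R x \<bullet> h + 1 / 2 * (h \<bullet> (X *v h)) + e * (norm h)\<^sup>2"
    proof (intro exI[of _ d] conjI allI impI d(1))
      fix h :: "real^'n" assume "norm h < d"
      then have "\<bar>E (h, 0)\<bar> \<le> e * (norm h)\<^sup>2" using d(2)[of "(h, 0)"] by simp
      moreover have "E (h, 0) = \<Phi> (\<xi> + h) - \<Phi> \<xi> - l *\<^sub>R x \<bullet> h - 1 / 2 * (h \<bullet> (X *v h))"
        unfolding E_def X(2) by (simp add: H_def z' PP inner_prod_def)
      ultimately show "\<Phi> (\<xi> + h) \<le> \<Phi> \<xi> + l *\<^sub>R x \<bullet> h + 1 / 2 * (h \<bullet> (X *v h)) + e * (norm h)\<^sup>2" by linarith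
    qed
  qed (rule \<Phi>le)
  have jY: "superjet D \<beta> y (l *\<^sub>R (y - \<eta>)) (Y - l *\<^sub>R mat 1)"
  proof (rule superjet_of_sup_convolution[where \<Phi>=\<Psi>])
    show "\<Psi> \<eta> = \<beta> y - l / 2 * (norm y)\<^sup>2 + l * (y \<bullet> \<eta>)" unfolding y_def by (rule \<Psi>)
    fix e :: real assume "e > 0"
    then obtain d where d: "d > 0" "\<And>h. norm h < d \<Longrightarrow> \<bar>E h\<bar> \<le> e * (norm h)\<^sup>2"
      using ex unfolding E_def by blast
    show "\<exists>d>0. \<forall>h. norm h < d \<longrightarrow> \<Psi> (\<eta> + h) \<le> \<Psi> \<eta> + l *\<^sub>R y \<bullet> h + 1 / 2 * (h \<bullet> (Y *v h)) + e * (norm h)\<^sup>2"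
    proof (intro exI[of _ d] conjI allI impI d(1))
      fix h :: "real^'n" assume "norm h < d"
      then have "\<bar>E (0, h)\<bar> \<le> e * (norm h)\<^sup>2" using d(2)[of "(0, h)"] by simp
      moreover have "E (0, h) = \<Psi> (\<eta> + h) - \<Psi> \<eta> - l *\<^sub>R y \<bullet> h - 1 / 2 * (h \<bullet> (Y *v h))"
        unfolding E_def Y(2) by (simp add: H_def z' PP inner_prod_def)
      ultimately show "\<Psi> (\<eta> + h) \<le> \<Psi> \<eta> + l *\<^sub>R y \<bullet> h + 1 / 2 * (h \<bullet> (Y *v h)) + e * (norm h)\<^sup>2" by linarith
    qed
  qed (rule \<Psi>le)
  have shift: "h \<bullet> ((M - l *\<^sub>R mat 1) *v h) = h \<bullet> (M *v h) - l * (norm h)\<^sup>2" for h and M :: "real^'n^'n"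
    by (simp add: matrix_vector_mult_diff_rdistrib scaleR_matrix_vector_assoc[symmetric] inner_diff_right power2_norm_eq_inner)
  have syms: "M - l *\<^sub>R mat 1 \<in> sym_mats" if "M \<in> sym_mats" for M :: "real^'n^'n"
    using that by (auto simp: sym_mats_def vec_eq_iff transpose_def mat_def)
  have nx: "norm x < k / l" "norm y < k / l" "norm \<xi> < k" "norm \<eta> < k"
  proof -
    have "norm (l *\<^sub>R x) \<le> norm P" "norm (l *\<^sub>R y) \<le> norm P"
      unfolding PP by (metis norm_fst_le fst_conv, metis norm_snd_le snd_conv)
    then show "norm x < k / l" "norm y < k / l" using P l by (simp_all add: field_simps)
    have "norm \<xi> \<le> norm z" "norm \<eta> \<le> norm z" unfolding z' by (metis norm_fst_le fst_conv, metis norm_snd_le snd_conv)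
    then show "norm \<xi> < k" "norm \<eta> < k" using z by simp_all
  qed
  have jet_small: "norm (l *\<^sub>R (a - b)) < \<kappa>" if "norm a < k / l" "norm b < k" for a b :: "real^'n"
  proof -
    have "norm (l *\<^sub>R (a - b)) \<le> l * (norm a + norm b)" using l norm_triangle_ineq4[of a b] by simp
    also have "\<dots> < l * (k / l + k)" using that l by (intro mult_strict_left_mono) auto
    also have "\<dots> = (1 + l) * k" using l by (simp add: field_simps)
    finally show ?thesis using k(4) by simp
  qed
  \<comment> \<open>The upper bound pairs the point with the origin of the other variable; the lower
    bound holds since the convolution is nonnegative. The estimate \<open>l * norm w < k\<close>,
    with \<open>k \<le> 1\<close>, reduces the two error terms to \<open>norm w\<close> and
    \<open>norm b\<close>.\<close>
  have val_small: "\<bar>a\<bar> < \<kappa>"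
    if w: "norm w < k / l" "norm b < k" and up: "a \<le> l / 6 * (norm w)\<^sup>2" and low: "0 \<le> a - l / 2 * (norm w)\<^sup>2 + l * (w \<bullet> b)"
    for a and w b :: "real^'n"
  proof -
    have lw: "l * norm w < k" using w(1) l by (simp add: field_simps)
    have "l / 6 * (norm w)\<^sup>2 = (l * norm w) * (norm w / 6)" by (simp add: power2_eq_square)
    also have "\<dots> \<le> 1 * norm w" using lw k(2) by (intro mult_mono) auto
    finally have "a < \<kappa>" using up w(1) k(3) by simp
    have "l * (w \<bullet> b) \<le> (l * norm w) * norm b" using norm_cauchy_schwarz[of w b] l by (simp add: mult.assoc)
    also have "\<dots> \<le> 1 * norm b" using lw k(2) by (intro mult_right_mono) auto
    finally have "- a < \<kappa>" using low w(2) k(5) l by (smt (verit) divide_nonneg_nonneg mult_nonneg_nonneg zero_le_power2)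
    with \<open>a < \<kappa>\<close> show ?thesis by simp
  qed
  show ?thesis
  proof (rule bexI[of _ x], rule bexI[of _ y], rule exI[of _ "l *\<^sub>R (x - \<xi>)"], rule exI[of _ "l *\<^sub>R (y - \<eta>)"],
      rule bexI[of _ "X - l *\<^sub>R mat 1"], rule bexI[of _ "Y - l *\<^sub>R mat 1"], intro conjI allI)
    show "norm x < \<kappa>" "norm y < \<kappa>" using nx k(3) by auto
    show "\<bar>\<alpha> x\<bar> < \<kappa>"
      using le[of x 0] C D \<beta>(2) mC[of \<xi>] \<Phi>0[of \<xi>] \<Phi>[of \<xi>] by (intro val_small[OF nx(1,3)]) (auto simp: x_def)
    show "\<bar>\<beta> y\<bar> < \<kappa>"
      using le[of 0 y] C D \<alpha>(2) nD[of \<eta>] \<Psi>0[of \<eta>] \<Psi>[of \<eta>] by (intro val_small[OF nx(2,4)]) (auto simp: y_def)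
    show "norm (l *\<^sub>R (x - \<xi>)) < \<kappa>" "norm (l *\<^sub>R (y - \<eta>)) < \<kappa>" using jet_small nx by auto
    show "- l * (norm h)\<^sup>2 \<le> h \<bullet> ((X - l *\<^sub>R mat 1) *v h)" "- l * (norm h)\<^sup>2 \<le> h \<bullet> ((Y - l *\<^sub>R mat 1) *v h)" for h
      unfolding shift X(2) Y(2) using Slow by simp_all
    show "h \<bullet> ((X - l *\<^sub>R mat 1) *v h) + k' \<bullet> ((Y - l *\<^sub>R mat 1) *v k') \<le> l * (norm (h - k'))\<^sup>2 + \<kappa> * ((norm h)\<^sup>2 + (norm k')\<^sup>2)" for h k'
    proof -
      have "2 * k * (norm (h, k'))\<^sup>2 \<le> \<kappa> * (norm (h, k'))\<^sup>2" using k(6) by (intro mult_right_mono) auto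
      then show ?thesis
        unfolding shift X(2) Y(2) using Sadd[of h k'] Sup[of "(h, k')"] unfolding BB by (simp add: norm_prod_def)
    qed
  qed (use jX jY syms X Y mC nD in \<open>auto simp: x_def y_def\<close>)
qed

section \<open>Reduction to the origin and passage to the limit\<close>

lemma usc_on_translate:
  fixes u :: "'a::real_normed_vector \<Rightarrow> real"
  assumes "usc_on S u"
  shows "usc_on ((\<lambda>x. x - a) ` S) (\<lambda>x. u (a + x))"
  using assms by (rule usc_on_compose) (auto intro!: continuous_intros)

lemma superjet_translate:
  assumes "superjet ((\<lambda>x. x - a) ` S) (\<lambda>x. u (a + x) - c - p \<bullet> x) x q X"
  shows "superjet S u (a + x) (p + q) X"
  unfolding superjet_def
proof (intro allI impI)
  fix e :: real assume "e > 0"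
  then obtain d where d: "d > 0" "\<And>h. norm h < d \<Longrightarrow> x + h \<in> (\<lambda>x. x - a) ` S \<Longrightarrow>
    u (a + (x + h)) - c - p \<bullet> (x + h) \<le> u (a + x) - c - p \<bullet> x + q \<bullet> h + 1 / 2 * (h \<bullet> (X *v h)) + e * (norm h)\<^sup>2"
    using assms unfolding superjet_def by blast
  show "\<exists>d>0. \<forall>h. norm h < d \<longrightarrow> a + x + h \<in> S \<longrightarrow>
     u (a + x + h) \<le> u (a + x) + (p + q) \<bullet> h + 1 / 2 * (h \<bullet> (X *v h)) + e * (norm h)\<^sup>2"
  proof (intro exI[of _ d] conjI allI impI d(1))
    fix h assume h: "norm h < d" "a + x + h \<in> S"
    have "x + h \<in> (\<lambda>x. x - a) ` S" using h(2) by (intro image_eqI[of _ _ "a + x + h"]) auto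
    from d(2)[OF h(1) this] show "u (a + x + h) \<le> u (a + x) + (p + q) \<bullet> h + 1 / 2 * (h \<bullet> (X *v h)) + e * (norm h)\<^sup>2"
      by (simp add: inner_add_right inner_add_left add.assoc)
  qed
qed

lemma tendsto_quadratic_form:
  fixes X :: "'b \<Rightarrow> real^'n^'n"
  assumes "(X \<longlongrightarrow> Y) F"
  shows "((\<lambda>k. h \<bullet> (X k *v h)) \<longlongrightarrow> h \<bullet> (Y *v h)) F"
  unfolding inner_vec_def matrix_vector_mult_def
  by (simp, intro tendsto_intros tendsto_vec_nth assms)

lemma closed_sym_mats: "closed (sym_mats :: (real^'n^'n) set)"
proof -
  have "(sym_mats :: (real^'n^'n) set) = (\<Inter>i. \<Inter>j. {X. X $ i $ j = X $ j $ i})"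
    by (auto simp: sym_mats_def vec_eq_iff transpose_def)
  also have "closed \<dots>" by (intro closed_INT ballI closed_Collect_eq continuous_intros)
  finally show ?thesis .
qed

text \<open>Translating the maximum point to the origin and removing the linear part of the penalty
  leaves the squared distance with coefficient 1 / (2 \<epsilon>), and
  \<open>l = 3 / \<epsilon>\<close> matches it with \<open>l / 6\<close>. Approximate jets with
  \<kappa> = 1 / (k + 1) are then thinned to a subsequence along which the matrices
  converge.\<close>

theorem theorem_on_sums:
  fixes u w :: "real^'n \<Rightarrow> real"
  assumes S: "compact S" "x0 \<in> S" "y0 \<in> S" and u: "usc_on S u" and w: "usc_on S w" and \<epsilon>: "\<epsilon> > 0"
    and max: "\<And>x y. x \<in> S \<Longrightarrow> y \<in> S \<Longrightarrow>
      u x + w y - (norm (x - y))\<^sup>2 / (2 * \<epsilon>) \<le> u x0 + w y0 - (norm (x0 - y0))\<^sup>2 / (2 * \<epsilon>)"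
  obtains X Y :: "real^'n^'n" and x y p q :: "nat \<Rightarrow> real^'n" and Xs Ys :: "nat \<Rightarrow> real^'n^'n" where
    "X \<in> sym_mats" "Y \<in> sym_mats"
    "\<And>k. x k \<in> S" "\<And>k. y k \<in> S" "\<And>k. Xs k \<in> sym_mats" "\<And>k. Ys k \<in> sym_mats"
    "\<And>k. superjet S u (x k) (p k) (Xs k)" "\<And>k. superjet S w (y k) (q k) (Ys k)"
    "x \<longlonglongrightarrow> x0" "y \<longlonglongrightarrow> y0" "(\<lambda>k. u (x k)) \<longlonglongrightarrow> u x0" "(\<lambda>k. w (y k)) \<longlonglongrightarrow> w y0"
    "p \<longlonglongrightarrow> (1 / \<epsilon>) *\<^sub>R (x0 - y0)" "q \<longlonglongrightarrow> - ((1 / \<epsilon>) *\<^sub>R (x0 - y0))" "Xs \<longlonglongrightarrow> X" "Ys \<longlonglongrightarrow> Y"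
    "\<And>h. - (3 / \<epsilon>) * (norm h)\<^sup>2 \<le> h \<bullet> (X *v h)" "\<And>h. - (3 / \<epsilon>) * (norm h)\<^sup>2 \<le> h \<bullet> (Y *v h)"
    "\<And>h k. h \<bullet> (X *v h) + k \<bullet> (Y *v k) \<le> 3 / \<epsilon> * (norm (h - k))\<^sup>2"
proof -
  define l where "l = 3 / \<epsilon>"
  have l: "l > 0" using \<epsilon> by (simp add: l_def)
  \<comment> \<open>The derivative of the penalty in its first variable; in the second variable it
    is \<open>- r\<close>.\<close>
  define r where "r = (1 / \<epsilon>) *\<^sub>R (x0 - y0)"
  define C D where "C = (\<lambda>x. x - x0) ` S" and "D = (\<lambda>x. x - y0) ` S"
  define \<alpha> \<beta> where "\<alpha> x = u (x0 + x) - u x0 - r \<bullet> x" and "\<beta> y = w (y0 + y) - w y0 - (- r) \<bullet> y" for x y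
  have C: "compact C" "0 \<in> C" and D: "compact D" "0 \<in> D"
    using S unfolding C_def D_def by (auto intro!: compact_continuous_image continuous_intros)
  have \<alpha>: "usc_on C \<alpha>" "\<alpha> 0 = 0"
  proof -
    have "usc_on C (\<lambda>x. u (x0 + x) + (- u x0 - r \<bullet> x))"
      unfolding C_def by (intro usc_on_add_continuous usc_on_translate u continuous_intros)
    then show "usc_on C \<alpha>" unfolding \<alpha>_def by (simp only: diff_conv_add_uminus add.assoc)
  qed (simp add: \<alpha>_def)
  have \<beta>: "usc_on D \<beta>" "\<beta> 0 = 0"
  proof -
    have "usc_on D (\<lambda>x. w (y0 + x) + (- w y0 - (- r) \<bullet> x))"
      unfolding D_def by (intro usc_on_add_continuous usc_on_translate w continuous_intros)
    then show "usc_on D \<beta>" unfolding \<beta>_def by (simp only: diff_conv_add_uminus add.assoc)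
  qed (simp add: \<beta>_def)
  have le: "\<alpha> x + \<beta> y \<le> l / 6 * (norm (x - y))\<^sup>2" if "x \<in> C" "y \<in> D" for x y
  proof -
    have xy: "x0 + x \<in> S" "y0 + y \<in> S" using that by (auto simp: C_def D_def)
    have "(x0 + x) - (y0 + y) = (x0 - y0) + (x - y)" by simp
    then have n: "(norm ((x0 + x) - (y0 + y)))\<^sup>2 = (norm (x0 - y0))\<^sup>2 + 2 * ((x0 - y0) \<bullet> (x - y)) + (norm (x - y))\<^sup>2"
      by (simp only: power2_norm_eq_inner inner_add_left inner_add_right) (simp add: inner_commute)
    have "r \<bullet> x - r \<bullet> y = 1 / \<epsilon> * ((x0 - y0) \<bullet> (x - y))" by (simp add: r_def inner_diff_right algebra_simps)
    moreover have "((norm (x0 - y0))\<^sup>2 + 2 * ((x0 - y0) \<bullet> (x - y)) + (norm (x - y))\<^sup>2) / (2 * \<epsilon>) =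
       (norm (x0 - y0))\<^sup>2 / (2 * \<epsilon>) + 1 / \<epsilon> * ((x0 - y0) \<bullet> (x - y)) + l / 6 * (norm (x - y))\<^sup>2"
      using \<epsilon> by (simp add: l_def add_divide_distrib)
    ultimately show ?thesis using max[OF xy] unfolding n by (simp add: \<alpha>_def \<beta>_def)
  qed
  define P where "P \<kappa> x y p q X Y \<longleftrightarrow> x \<in> C \<and> y \<in> D \<and> X \<in> sym_mats \<and> Y \<in> sym_mats \<and>
    norm x < \<kappa> \<and> norm y < \<kappa> \<and> \<bar>\<alpha> x\<bar> < \<kappa> \<and> \<bar>\<beta> y\<bar> < \<kappa> \<and> norm p < \<kappa> \<and> norm q < \<kappa>
    \<and> superjet C \<alpha> x p X \<and> superjet D \<beta> y q Y
    \<and> (\<forall>h. - l * (norm h)\<^sup>2 \<le> h \<bullet> (X *v h)) \<and> (\<forall>k. - l * (norm k)\<^sup>2 \<le> k \<bullet> (Y *v k))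
    \<and> (\<forall>h k. h \<bullet> (X *v h) + k \<bullet> (Y *v k) \<le> l * (norm (h - k))\<^sup>2 + \<kappa> * ((norm h)\<^sup>2 + (norm k)\<^sup>2))"
    for \<kappa> x y p q X Y
  have "\<exists>x y p q X Y. P (inverse (real (Suc k))) x y p q X Y" for k
  proof -
    have "inverse (real (Suc k)) > 0" by simp
    then show ?thesis
      by (rule sums_approx[OF C D \<alpha> \<beta> l _ le, THEN revcut_rl])
        (assumption | unfold P_def Bex_def, elim exE conjE, (intro exI conjI; assumption))+
  qed
  then obtain x y p q X Y where P: "\<And>k. P (inverse (real (Suc k))) (x k) (y k) (p k) (q k) (X k) (Y k)"
    by metis
  have small: "a \<longlonglongrightarrow> 0" if "\<And>k. norm (a k) < inverse (real (Suc k))" for a :: "nat \<Rightarrow> 'z::real_normed_vector"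
    by (rule Lim_null_comparison[OF always_eventually[OF allI[OF less_imp_le[OF that]]] LIMSEQ_inverse_real_of_nat])
  have inv1: "inverse (real (Suc k)) \<le> 1" for k by (simp add: field_simps)
  \<comment> \<open>Inserting zero for one of the two vectors in the joint upper bound leaves
    \<open>l\<close> plus the error, and the error is at most 1.\<close>
  define c where "c = l + 1"
  have bX: "\<bar>h \<bullet> (X k *v h)\<bar> \<le> c * (norm h)\<^sup>2" for k h
  proof -
    have "h \<bullet> (X k *v h) + 0 \<bullet> (Y k *v 0) \<le> l * (norm (h - 0))\<^sup>2 + inverse (real (Suc k)) * ((norm h)\<^sup>2 + (norm (0::real^'n))\<^sup>2)"
      using P[of k] unfolding P_def by blast
    moreover have "inverse (real (Suc k)) * (norm h)\<^sup>2 \<le> 1 * (norm h)\<^sup>2" by (intro mult_right_mono inv1) simp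
    moreover have "- l * (norm h)\<^sup>2 \<le> h \<bullet> (X k *v h)" using P[of k] unfolding P_def by blast
    moreover have "0 \<le> l * (norm h)\<^sup>2" "0 \<le> (norm h)\<^sup>2" using l by simp_all
    ultimately show ?thesis unfolding c_def distrib_right abs_le_iff by (simp, linarith)
  qed
  have bY: "\<bar>h \<bullet> (Y k *v h)\<bar> \<le> c * (norm h)\<^sup>2" for k h
  proof -
    have "0 \<bullet> (X k *v 0) + h \<bullet> (Y k *v h) \<le> l * (norm (0 - h))\<^sup>2 + inverse (real (Suc k)) * ((norm (0::real^'n))\<^sup>2 + (norm h)\<^sup>2)"
      using P[of k] unfolding P_def by blast
    moreover have "inverse (real (Suc k)) * (norm h)\<^sup>2 \<le> 1 * (norm h)\<^sup>2" by (intro mult_right_mono inv1) simp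
    moreover have "- l * (norm h)\<^sup>2 \<le> h \<bullet> (Y k *v h)" using P[of k] unfolding P_def by blast
    moreover have "0 \<le> l * (norm h)\<^sup>2" "0 \<le> (norm h)\<^sup>2" using l by simp_all
    ultimately show ?thesis unfolding c_def distrib_right abs_le_iff by (simp, linarith)
  qed
  define b where "b = real CARD('n) * (real CARD('n) * c)"
  have "X k \<in> cball 0 b" "Y k \<in> cball 0 b" for k
    using norm_sym_mat_le[OF _ bX] norm_sym_mat_le[OF _ bY] P[of k] unfolding P_def b_def by auto
  then have XY: "\<And>k. (X k, Y k) \<in> cball 0 b \<times> cball 0 b" by auto
  have "compact (cball (0::real^'n^'n) b \<times> cball (0::real^'n^'n) b)" by (intro compact_Times compact_cball)
  then have "\<exists>Z s. strict_mono s \<and> ((\<lambda>k. (X k, Y k)) \<circ> s) \<longlonglongrightarrow> Z"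
    unfolding compact_def using XY by (auto dest!: spec[of _ "\<lambda>k. (X k, Y k)"])
  then obtain Z s where Z: "strict_mono s" "((\<lambda>k. (X k, Y k)) \<circ> s) \<longlonglongrightarrow> Z" by blast
  define X' Y' where "X' = fst Z" and "Y' = snd Z"
  have X': "(\<lambda>k. X (s k)) \<longlonglongrightarrow> X'" using tendsto_fst[OF Z(2)] by (simp add: X'_def o_def)
  have Y': "(\<lambda>k. Y (s k)) \<longlonglongrightarrow> Y'" using tendsto_snd[OF Z(2)] by (simp add: Y'_def o_def)
  have sub: "(\<lambda>k. a (s k)) \<longlonglongrightarrow> L" if "a \<longlonglongrightarrow> L" for a :: "nat \<Rightarrow> 'z::topological_space" and L
    using LIMSEQ_subseq_LIMSEQ[OF that Z(1)] by (simp add: o_def)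
  have lims: "x \<longlonglongrightarrow> 0" "y \<longlonglongrightarrow> 0" "p \<longlonglongrightarrow> 0" "q \<longlonglongrightarrow> 0" "(\<lambda>k. \<alpha> (x k)) \<longlonglongrightarrow> 0" "(\<lambda>k. \<beta> (y k)) \<longlonglongrightarrow> 0"
    using P unfolding P_def by (auto intro!: small)
  show thesis
  proof (rule that[of X' Y' "\<lambda>k. x0 + x (s k)" "\<lambda>k. y0 + y (s k)" "\<lambda>k. X (s k)" "\<lambda>k. Y (s k)" "\<lambda>k. r + p (s k)" "\<lambda>k. - r + q (s k)"])
    show "X' \<in> sym_mats" "Y' \<in> sym_mats"
      using P unfolding P_def by (auto intro!: closed_sequentially[OF closed_sym_mats _ X'] closed_sequentially[OF closed_sym_mats _ Y'])
    show "x0 + x (s k) \<in> S" "y0 + y (s k) \<in> S" "X (s k) \<in> sym_mats" "Y (s k) \<in> sym_mats" for k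
      using P[of "s k"] unfolding P_def C_def D_def by auto
    show "superjet S u (x0 + x (s k)) (r + p (s k)) (X (s k))" for k
      using P[of "s k"] unfolding P_def C_def \<alpha>_def[abs_def] by (intro superjet_translate) auto
    show "superjet S w (y0 + y (s k)) (- r + q (s k)) (Y (s k))" for k
      using P[of "s k"] unfolding P_def D_def \<beta>_def[abs_def] by (intro superjet_translate) auto
    show "(\<lambda>k. x0 + x (s k)) \<longlonglongrightarrow> x0" using tendsto_add[OF tendsto_const sub[OF lims(1)], of x0] by simp
    show "(\<lambda>k. y0 + y (s k)) \<longlonglongrightarrow> y0" using tendsto_add[OF tendsto_const sub[OF lims(2)], of y0] by simp
    show "(\<lambda>k. r + p (s k)) \<longlonglongrightarrow> (1 / \<epsilon>) *\<^sub>R (x0 - y0)"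
      using tendsto_add[OF tendsto_const sub[OF lims(3)], of r] by (simp add: r_def)
    show "(\<lambda>k. - r + q (s k)) \<longlonglongrightarrow> - ((1 / \<epsilon>) *\<^sub>R (x0 - y0))"
      using tendsto_add[OF tendsto_const sub[OF lims(4)], of "- r"] by (simp add: r_def)
    have "(\<lambda>k. \<alpha> (x (s k)) + u x0 + r \<bullet> x (s k)) \<longlonglongrightarrow> 0 + u x0 + r \<bullet> 0"
      by (intro tendsto_intros sub lims)
    then show "(\<lambda>k. u (x0 + x (s k))) \<longlonglongrightarrow> u x0" by (simp add: \<alpha>_def)
    have "(\<lambda>k. \<beta> (y (s k)) + w y0 + (- r) \<bullet> y (s k)) \<longlonglongrightarrow> 0 + w y0 + (- r) \<bullet> 0"
      by (intro tendsto_intros sub lims)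
    then show "(\<lambda>k. w (y0 + y (s k))) \<longlonglongrightarrow> w y0" by (simp add: \<beta>_def)
    show "(\<lambda>k. X (s k)) \<longlonglongrightarrow> X'" "(\<lambda>k. Y (s k)) \<longlonglongrightarrow> Y'" by (rule X', rule Y')
    show "- (3 / \<epsilon>) * (norm h)\<^sup>2 \<le> h \<bullet> (X' *v h)" for h
      using P unfolding P_def l_def[symmetric] by (intro LIMSEQ_le_const[OF tendsto_quadratic_form[OF X']]) blast
    show "- (3 / \<epsilon>) * (norm h)\<^sup>2 \<le> h \<bullet> (Y' *v h)" for h
      using P unfolding P_def l_def[symmetric] by (intro LIMSEQ_le_const[OF tendsto_quadratic_form[OF Y']]) blast
    show "h \<bullet> (X' *v h) + k \<bullet> (Y' *v k) \<le> 3 / \<epsilon> * (norm (h - k))\<^sup>2" for h k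
    proof (rule LIMSEQ_le)
      show "(\<lambda>j. h \<bullet> (X (s j) *v h) + k \<bullet> (Y (s j) *v k)) \<longlonglongrightarrow> h \<bullet> (X' *v h) + k \<bullet> (Y' *v k)"
        by (intro tendsto_add tendsto_quadratic_form X' Y')
      have "(\<lambda>j. l * (norm (h - k))\<^sup>2 + inverse (real (Suc (s j))) * ((norm h)\<^sup>2 + (norm k)\<^sup>2)) \<longlonglongrightarrow> l * (norm (h - k))\<^sup>2 + 0 * ((norm h)\<^sup>2 + (norm k)\<^sup>2)"
        by (intro tendsto_intros sub[OF LIMSEQ_inverse_real_of_nat])
      then show "(\<lambda>j. l * (norm (h - k))\<^sup>2 + inverse (real (Suc (s j))) * ((norm h)\<^sup>2 + (norm k)\<^sup>2)) \<longlonglongrightarrow> 3 / \<epsilon> * (norm (h - k))\<^sup>2"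
        by (simp add: l_def)
      show "\<exists>N. \<forall>j\<ge>N. h \<bullet> (X (s j) *v h) + k \<bullet> (Y (s j) *v k) \<le> l * (norm (h - k))\<^sup>2 + inverse (real (Suc (s j))) * ((norm h)\<^sup>2 + (norm k)\<^sup>2)"
        using P unfolding P_def by blast
    qed
  qed
qed

section \<open>Test functions\<close>

lemma grad_eqI:
  assumes "(\<phi> has_derivative (\<lambda>h. g \<bullet> h)) (at x)"
  shows "grad \<phi> x = g"
proof -
  have "frechet_derivative \<phi> (at x) = (\<lambda>h. g \<bullet> h)" using assms by (rule frechet_derivative_at[symmetric])
  then show ?thesis by (simp add: grad_def vec_eq_iff inner_axis)
qed

lemma hessian_eqI:
  fixes M :: "real^'n^'n"
  assumes "(grad \<phi> has_derivative (\<lambda>h. M *v h)) (at x)"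
  shows "hessian \<phi> x = M"
proof -
  have "frechet_derivative (grad \<phi>) (at x) = (\<lambda>h. M *v h)" using assms by (rule frechet_derivative_at[symmetric])
  then show ?thesis by (simp add: hessian_def jacobian_def)
qed

text \<open>A second order Taylor polynomial plus a fourth order term. That term leaves the
  derivatives at \<open>x\<close> up to order two unchanged, is smooth on the whole space, and with
  large \<open>c\<close> dominates any bounded function away from \<open>x\<close>.\<close>

definition quartic :: "real^'n \<Rightarrow> real^'n \<Rightarrow> real^'n^'n \<Rightarrow> real \<Rightarrow> real^'n \<Rightarrow> real" where
  "quartic x q Z c y = q \<bullet> (y - x) + 1 / 2 * ((y - x) \<bullet> (Z *v (y - x))) + c * ((y - x) \<bullet> (y - x))\<^sup>2"

lemma quartic_derivatives:
  fixes x q :: "real^'n" and c :: real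
  assumes Z: "Z \<in> sym_mats"
  defines "G \<equiv> \<lambda>y. q + Z *v (y - x) + (4 * c * ((y - x) \<bullet> (y - x))) *\<^sub>R (y - x)"
    and "H \<equiv> \<lambda>y. Z + (8 * c) *\<^sub>R (\<chi> i j. (y - x) $ i * (y - x) $ j) + (4 * c * ((y - x) \<bullet> (y - x))) *\<^sub>R mat 1"
  shows "(quartic x q Z c has_derivative (\<lambda>h. G y \<bullet> h)) (at y)" "grad (quartic x q Z c) = G"
    "(G has_derivative (\<lambda>h. H y *v h)) (at y)" "hessian (quartic x q Z c) = H"
    "C2_on \<Omega> (quartic x q Z c)" "C2_closure \<Omega> (quartic x q Z c)"
proof -
  have bl: "bounded_linear (\<lambda>h. Z *v h)" by (simp add: matrix_vector_mul_bounded_linear)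
  have dZ: "((\<lambda>y. Z *v (y - x)) has_derivative (\<lambda>h. Z *v h)) (at y)" for y
  proof -
    have "((\<lambda>y. y - x) has_derivative (\<lambda>h. h)) (at y)" by (auto intro!: derivative_eq_intros)
    from bounded_linear.has_derivative[OF bl this] show ?thesis .
  qed
  show d: "(quartic x q Z c has_derivative (\<lambda>h. G y \<bullet> h)) (at y)" for y
  proof -
    have "((\<lambda>y. q \<bullet> (y - x) + 1 / 2 * ((y - x) \<bullet> (Z *v (y - x))) + c * ((y - x) \<bullet> (y - x))\<^sup>2) has_derivative
       (\<lambda>h. q \<bullet> h + 1 / 2 * ((y - x) \<bullet> (Z *v h) + h \<bullet> (Z *v (y - x))) + c * (2 * ((y - x) \<bullet> (y - x)) * (2 * ((y - x) \<bullet> h))))) (at y)"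
      by (rule derivative_eq_intros dZ refl | simp add: inner_commute algebra_simps fun_eq_iff power2_eq_square)+
    moreover have "(\<lambda>h. q \<bullet> h + 1 / 2 * ((y - x) \<bullet> (Z *v h) + h \<bullet> (Z *v (y - x))) + c * (2 * ((y - x) \<bullet> (y - x)) * (2 * ((y - x) \<bullet> h)))) = (\<lambda>h. G y \<bullet> h)"
    proof
      fix h
      have "(y - x) \<bullet> (Z *v h) = h \<bullet> (Z *v (y - x))" by (rule sym_inner_commute[OF Z])
      then show "q \<bullet> h + 1 / 2 * ((y - x) \<bullet> (Z *v h) + h \<bullet> (Z *v (y - x))) + c * (2 * ((y - x) \<bullet> (y - x)) * (2 * ((y - x) \<bullet> h))) = G y \<bullet> h"
        unfolding G_def by (simp add: inner_add_left inner_commute[of h] )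
    qed
    ultimately show ?thesis by (simp add: quartic_def[abs_def])
  qed
  show gr: "grad (quartic x q Z c) = G" using grad_eqI[OF d] by (rule ext)
  have outer: "(\<chi> i j. a $ i * a $ j) *v h = (a \<bullet> h) *\<^sub>R a" for a h :: "real^'n"
    by (simp add: vec_eq_iff matrix_vector_mult_def inner_vec_def sum_distrib_left mult_ac)
  show dG: "(G has_derivative (\<lambda>h. H y *v h)) (at y)" for y
  proof -
    have "(G has_derivative (\<lambda>h. Z *v h + ((4 * c * ((y - x) \<bullet> (y - x))) *\<^sub>R h + (4 * c * (2 * ((y - x) \<bullet> h))) *\<^sub>R (y - x)))) (at y)"
      unfolding G_def
      by (rule derivative_eq_intros dZ refl | simp add: inner_commute algebra_simps fun_eq_iff)+
    moreover have "(\<lambda>h. Z *v h + ((4 * c * ((y - x) \<bullet> (y - x))) *\<^sub>R h + (4 * c * (2 * ((y - x) \<bullet> h))) *\<^sub>R (y - x))) = (\<lambda>h. H y *v h)"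
    proof
      fix h
      show "Z *v h + ((4 * c * ((y - x) \<bullet> (y - x))) *\<^sub>R h + (4 * c * (2 * ((y - x) \<bullet> h))) *\<^sub>R (y - x)) = H y *v h"
        unfolding H_def matrix_vector_mult_add_rdistrib scaleR_matrix_vector_assoc[symmetric] outer by simp
    qed
    ultimately show ?thesis by simp
  qed
  show he: "hessian (quartic x q Z c) = H"
    by (rule ext, rule hessian_eqI) (simp add: gr dG)
  have cH: "continuous_on A H" for A
    unfolding H_def by (intro continuous_intros)
  have cG: "continuous_on A G" for A
    by (intro continuous_at_imp_continuous_on ballI has_derivative_continuous[OF dG])
  have cq: "continuous_on A (quartic x q Z c)" for A
    by (intro continuous_at_imp_continuous_on ballI has_derivative_continuous[OF d])
  show c2: "C2_on \<Omega> (quartic x q Z c)"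
    unfolding C2_on_def gr he using d dG cH by (auto simp: differentiable_def)
  show "C2_closure \<Omega> (quartic x q Z c)"
    unfolding C2_closure_def gr he using c2 cq cG cH by blast
qed

lemma quartic_at:
  fixes x q :: "real^'n"
  assumes "Z \<in> sym_mats"
  shows "quartic x q Z c x = 0" "grad (quartic x q Z c) x = q" "hessian (quartic x q Z c) x = Z"
proof -
  have "(\<chi> i j. (0::real^'n) $ i * (0::real^'n) $ j) = (0 :: real^'n^'n)" by (simp add: vec_eq_iff)
  then show "quartic x q Z c x = 0" "grad (quartic x q Z c) x = q" "hessian (quartic x q Z c) x = Z"
    using assms by (simp_all add: quartic_def quartic_derivatives)
qed

text \<open>Near \<open>x\<close> the added \<open>e *\<^sub>R mat 1\<close> absorbs the little-o
  remainder; at distance at least \<open>d\<close> the quartic term dominates everything else. The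
  local contact thus becomes a maximum over all of \<open>C\<close>, as the definition of a
  viscosity solution demands.\<close>

lemma superjet_quartic:
  fixes u :: "real^'n \<Rightarrow> real"
  assumes C: "compact C" and u: "bounded (u ` C)" and j: "superjet C u x q X" and e: "e > 0"
  obtains c where "\<And>y. y \<in> C \<Longrightarrow> u y \<le> u x + quartic x q (X + e *\<^sub>R mat 1) c y"
proof -
  have Zq: "h \<bullet> ((X + e *\<^sub>R mat 1) *v h) = h \<bullet> (X *v h) + e * (norm h)\<^sup>2" for h
    by (simp add: matrix_vector_mult_add_rdistrib scaleR_matrix_vector_assoc[symmetric] inner_add_right power2_norm_eq_inner)
  obtain d where d: "d > 0" "\<And>h. norm h < d \<Longrightarrow> x + h \<in> C \<Longrightarrow>
     u (x + h) \<le> u x + q \<bullet> h + 1 / 2 * (h \<bullet> (X *v h)) + e / 2 * (norm h)\<^sup>2"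
    using j e unfolding superjet_def by (meson half_gt_zero)
  define f where "f y = q \<bullet> (y - x) + 1 / 2 * ((y - x) \<bullet> ((X + e *\<^sub>R mat 1) *v (y - x)))" for y
  have "continuous_on C (\<lambda>y. y - x)" by (intro continuous_intros)
  then have "continuous_on C (\<lambda>y. (X + e *\<^sub>R mat 1) *v (y - x))"
    by (rule linear_continuous_on_compose[OF _ matrix_vector_mul_linear])
  then have "continuous_on C f" unfolding f_def by (intro continuous_intros)
  then have "bounded (f ` C)" using C compact_continuous_image compact_imp_bounded by blast
  then obtain bf where bf: "\<And>y. y \<in> C \<Longrightarrow> \<bar>f y\<bar> \<le> bf" unfolding bounded_iff by auto
  obtain bu where bu: "\<And>y. y \<in> C \<Longrightarrow> \<bar>u y\<bar> \<le> bu" using u unfolding bounded_iff by auto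
  \<comment> \<open>The numerator bounds \<open>u y - u x - f y\<close> over \<open>C\<close>, and
    beyond distance \<open>d\<close> the fourth power is at least \<open>d ^ 4\<close>.\<close>
  define c where "c = (bu + \<bar>u x\<bar> + bf) / d ^ 4"
  show thesis
  proof (rule that[of "\<bar>c\<bar>"])
    fix y assume y: "y \<in> C"
    have q: "quartic x q (X + e *\<^sub>R mat 1) \<bar>c\<bar> y = f y + \<bar>c\<bar> * (norm (y - x)) ^ 4"
      by (simp add: quartic_def f_def power2_norm_eq_inner[symmetric])
    show "u y \<le> u x + quartic x q (X + e *\<^sub>R mat 1) \<bar>c\<bar> y"
    proof (cases "norm (y - x) < d")
      case True
      have "u y \<le> u x + q \<bullet> (y - x) + 1 / 2 * ((y - x) \<bullet> (X *v (y - x))) + e / 2 * (norm (y - x))\<^sup>2"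
        using d(2)[of "y - x"] True y by simp
      also have "\<dots> = u x + f y" by (simp add: f_def Zq field_simps)
      finally show ?thesis unfolding q by (smt (verit) abs_ge_zero mult_nonneg_nonneg norm_ge_zero zero_le_power)
    next
      case False
      have "d ^ 4 \<le> norm (y - x) ^ 4" using False d(1) by (intro power_mono) auto
      then have "\<bar>c\<bar> * d ^ 4 \<le> \<bar>c\<bar> * norm (y - x) ^ 4" by (intro mult_left_mono) auto
      moreover have "c * d ^ 4 \<le> \<bar>c\<bar> * d ^ 4" using d(1) by (intro mult_right_mono) auto
      moreover have "c * d ^ 4 = bu + \<bar>u x\<bar> + bf" using d(1) by (simp add: c_def)
      ultimately show ?thesis unfolding q using bf[OF y] bu[OF y] by linarith
    qed
  qed
qed

section \<open>Viscosity inequalities at superjets\<close>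

lemma sym_mats_add: "X \<in> sym_mats \<Longrightarrow> Y \<in> sym_mats \<Longrightarrow> X + Y \<in> sym_mats"
  by (simp add: sym_mats_def vec_eq_iff transpose_def)

lemma sym_mats_uminus: "X \<in> sym_mats \<Longrightarrow> - X \<in> sym_mats"
  by (simp add: sym_mats_def vec_eq_iff transpose_def)

lemma sym_mats_scaled_mat: "c *\<^sub>R mat 1 \<in> sym_mats"
  by (auto simp: sym_mats_def vec_eq_iff transpose_def mat_def)

lemma MA_matrix_quadratic_form:
  "\<xi> \<bullet> (MA_matrix \<sigma> A x p X *v \<xi>) = (\<sigma> x *v \<xi>) \<bullet> (X *v (\<sigma> x *v \<xi>)) + \<xi> \<bullet> (A x p *v \<xi>)"
proof -
  have "\<xi> \<bullet> (transpose (\<sigma> x) *v z) = (\<sigma> x *v \<xi>) \<bullet> z" for z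
    by (simp only: dot_lmul_matrix[symmetric] vector_transpose_matrix)
  then show ?thesis
    by (simp add: MA_matrix_def matrix_vector_mult_add_rdistrib inner_add_right matrix_vector_mul_assoc[symmetric])
qed

lemma MA_matrix_sym:
  assumes "X \<in> sym_mats" "A x p \<in> sym_mats"
  shows "MA_matrix \<sigma> A x p X \<in> sym_mats"
proof -
  have "transpose (transpose (\<sigma> x) ** X ** \<sigma> x) = transpose (\<sigma> x) ** X ** \<sigma> x"
    using assms(1) by (simp add: matrix_transpose_mul sym_mats_def matrix_mul_assoc)
  then show ?thesis using assms(2) unfolding MA_matrix_def by (intro sym_mats_add) (auto simp: sym_mats_def)
qed

text \<open>One quartic with Hessian \<open>X + e *\<^sub>R mat 1\<close> serves as a test function
  for both notions of subsolution. The shift by \<open>e\<close> stays in the statement and is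
  removed only in the limit.\<close>

lemma visc_subsol_jet:
  fixes \<Omega> :: "(real^'n) set" and \<sigma> :: "real^'n \<Rightarrow> real^'m^'n"
  assumes \<Omega>: "bounded \<Omega>" "x \<in> \<Omega>" and u: "bounded (u ` closure \<Omega>)" "visc_subsol \<Omega> \<sigma> A K u"
    and m: "visc_matrix_subsol \<Omega> (\<lambda>x p X. - MA_matrix \<sigma> A x p X) (- \<gamma> *\<^sub>R mat 1) u"
    and j: "superjet (closure \<Omega>) u x q X" and X: "X \<in> sym_mats" and e: "e > 0"
  shows "\<gamma> *\<^sub>R mat 1 \<preceq> MA_matrix \<sigma> A x q (X + e *\<^sub>R mat 1)"
    "MA_op \<sigma> A K x (u x) q (X + e *\<^sub>R mat 1) \<le> 0"
proof -
  define Z where "Z = X + e *\<^sub>R mat 1"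
  have Z: "Z \<in> sym_mats" unfolding Z_def by (intro sym_mats_add X sym_mats_scaled_mat)
  obtain c where c: "\<And>y. y \<in> closure \<Omega> \<Longrightarrow> u y \<le> u x + quartic x q Z c y"
    using superjet_quartic[OF _ u(1) j e] \<Omega>(1) unfolding Z_def by (metis compact_closure)
  have cl: "x \<in> closure \<Omega>" using \<Omega>(2) closure_subset by blast
  have le: "u y - quartic x q Z c y \<le> u x - quartic x q Z c x" if "y \<in> closure \<Omega>" for y
    using c[OF that] by (simp add: quartic_at(1)[OF Z])
  have am: "is_arg_max (\<lambda>y. u y - quartic x q Z c y) (\<lambda>y. y \<in> closure \<Omega>) x"
    unfolding is_arg_max_def using le cl by (auto simp: not_less)
  have "MA_op \<sigma> A K y (u y) (grad \<phi> y) (hessian \<phi> y) \<le> 0"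
    if "C2_closure \<Omega> \<phi>" "y \<in> \<Omega>" "is_arg_max (\<lambda>y. u y - \<phi> y) (\<lambda>y. y \<in> closure \<Omega>) y" for \<phi> y
    using u(2) that unfolding visc_subsol_def by blast
  from this[OF quartic_derivatives(6)[OF Z] \<Omega>(2) am] show "MA_op \<sigma> A K x (u x) q (X + e *\<^sub>R mat 1) \<le> 0"
    by (simp only: quartic_at[OF Z]) (simp only: Z_def)
  have am: "is_arg_max (\<lambda>y. u y - quartic x q Z c y) (\<lambda>y. y \<in> \<Omega>) x"
    unfolding is_arg_max_def using le \<Omega>(2) closure_subset by (auto simp: not_less)
  have "- MA_matrix \<sigma> A y (grad \<phi> y) (hessian \<phi> y) \<preceq> - \<gamma> *\<^sub>R mat 1"
    if "C2_on \<Omega> \<phi>" "is_arg_max (\<lambda>y. u y - \<phi> y) (\<lambda>y. y \<in> \<Omega>) y" for \<phi> y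
    using m that unfolding visc_matrix_subsol_def by blast
  from this[OF quartic_derivatives(5)[OF Z] am] have "- MA_matrix \<sigma> A x q Z \<preceq> - \<gamma> *\<^sub>R mat 1"
    by (simp only: quartic_at[OF Z])
  moreover have "(- M) *v y = - (M *v y)" for M :: "real^'m^'m" and y
    by (simp add: vec_eq_iff matrix_vector_mult_def sum_negf)
  ultimately show "\<gamma> *\<^sub>R mat 1 \<preceq> MA_matrix \<sigma> A x q (X + e *\<^sub>R mat 1)"
    by (simp add: mat_le_def Z_def scaleR_matrix_vector_assoc[symmetric])
qed

text \<open>Negating the quartic that touches \<open>- v\<close> from above gives one touching
  \<open>v\<close> from below, hence the signs of \<open>q\<close> and \<open>X\<close>. Positive
  definiteness has to be supplied, since a supersolution is tested only there.\<close>

lemma visc_supersol_jet: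
  fixes \<Omega> :: "(real^'n) set" and \<sigma> :: "real^'n \<Rightarrow> real^'m^'n"
  assumes \<Omega>: "bounded \<Omega>" "x \<in> \<Omega>" and v: "bounded (v ` closure \<Omega>)" "visc_supersol \<Omega> \<sigma> A K v"
    and j: "superjet (closure \<Omega>) (\<lambda>y. - v y) x q X" and X: "X \<in> sym_mats" and e: "e > 0"
    and pos: "pos_definite (MA_matrix \<sigma> A x (- q) (- (X + e *\<^sub>R mat 1)))"
  shows "0 \<le> MA_op \<sigma> A K x (v x) (- q) (- (X + e *\<^sub>R mat 1))"
proof -
  define Z where "Z = X + e *\<^sub>R mat 1"
  have Z: "Z \<in> sym_mats" unfolding Z_def by (intro sym_mats_add X sym_mats_scaled_mat)
  have Z': "- Z \<in> sym_mats" by (rule sym_mats_uminus[OF Z])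
  have bv: "bounded ((\<lambda>y. - v y) ` closure \<Omega>)" using v(1) by (simp add: bounded_iff)
  obtain c where c: "\<And>y. y \<in> closure \<Omega> \<Longrightarrow> - v y \<le> - v x + quartic x q Z c y"
    using superjet_quartic[OF _ bv j e] \<Omega>(1) unfolding Z_def by (metis compact_closure)
  have neg: "quartic x (- q) (- Z) (- c) y = - quartic x q Z c y" for y
  proof -
    have "(- Z) *v h = - (Z *v h)" for h by (simp add: vec_eq_iff matrix_vector_mult_def sum_negf)
    then show ?thesis by (simp add: quartic_def)
  qed
  have le: "v x - quartic x (- q) (- Z) (- c) x \<le> v y - quartic x (- q) (- Z) (- c) y" if "y \<in> closure \<Omega>" for y
    unfolding neg using c[OF that] by (simp add: quartic_at(1)[OF Z])
  have am: "is_arg_min (\<lambda>y. v y - quartic x (- q) (- Z) (- c) y) (\<lambda>y. y \<in> closure \<Omega>) x"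
    unfolding is_arg_min_def using le \<Omega>(2) closure_subset by (auto simp: not_less)
  have "0 \<le> MA_op \<sigma> A K y (v y) (grad \<phi> y) (hessian \<phi> y)"
    if "C2_closure \<Omega> \<phi>" "y \<in> \<Omega>" "is_arg_min (\<lambda>y. v y - \<phi> y) (\<lambda>y. y \<in> closure \<Omega>) y"
      "pos_definite (MA_matrix \<sigma> A y (grad \<phi> y) (hessian \<phi> y))" for \<phi> y
    using v(2) that unfolding visc_supersol_def by blast
  from this[OF quartic_derivatives(6)[OF Z'] \<Omega>(2) am] pos show ?thesis
    by (simp only: quartic_at[OF Z'] Z_def[symmetric])
qed

text \<open>The value \<infinity> at nonpositive determinants makes the inequality itself assert
  that the determinant is positive.\<close>

lemma MA_op_le_0_iff:
  "MA_op \<sigma> A K x r p X \<le> 0 \<longleftrightarrow>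
     0 < det (MA_matrix \<sigma> A x p X) \<and> - ln (det (MA_matrix \<sigma> A x p X)) + K x r p X \<le> 0"
  by (cases "0 < det (MA_matrix \<sigma> A x p X)") (simp_all add: MA_op_def neg_log_det_def zero_ereal_def)

lemma MA_op_ge_0_iff:
  assumes "0 < det (MA_matrix \<sigma> A x p X)"
  shows "0 \<le> MA_op \<sigma> A K x r p X \<longleftrightarrow> 0 \<le> - ln (det (MA_matrix \<sigma> A x p X)) + K x r p X"
  using assms by (simp add: MA_op_def neg_log_det_def zero_ereal_def)

lemma abs_quadratic_form_le:
  fixes M :: "real^'m^'m"
  shows "\<bar>x \<bullet> (M *v x)\<bar> \<le> (\<Sum>i\<in>UNIV. \<Sum>j\<in>UNIV. \<bar>M $ i $ j\<bar>) * (norm x)\<^sup>2"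
proof -
  have "x \<bullet> (M *v x) = (\<Sum>i\<in>UNIV. \<Sum>j\<in>UNIV. x $ i * (M $ i $ j * x $ j))"
    by (simp add: inner_vec_def matrix_vector_mult_def sum_distrib_left)
  also have "\<bar>\<dots>\<bar> \<le> (\<Sum>i\<in>UNIV. \<Sum>j\<in>UNIV. \<bar>x $ i * (M $ i $ j * x $ j)\<bar>)"
    by (rule order_trans[OF sum_abs]) (intro sum_mono sum_abs)
  also have "\<dots> \<le> (\<Sum>i\<in>UNIV. \<Sum>j\<in>UNIV. \<bar>M $ i $ j\<bar> * (norm x)\<^sup>2)"
  proof (intro sum_mono)
    fix i j
    have "\<bar>x $ i\<bar> * \<bar>x $ j\<bar> \<le> norm x * norm x" by (intro mult_mono component_le_norm_cart) auto
    then have "\<bar>M $ i $ j\<bar> * (\<bar>x $ i\<bar> * \<bar>x $ j\<bar>) \<le> \<bar>M $ i $ j\<bar> * (norm x)\<^sup>2"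
      by (intro mult_left_mono) (auto simp: power2_eq_square)
    then show "\<bar>x $ i * (M $ i $ j * x $ j)\<bar> \<le> \<bar>M $ i $ j\<bar> * (norm x)\<^sup>2" by (simp add: abs_mult mult_ac)
  qed
  finally show ?thesis by (simp add: sum_distrib_right)
qed

text \<open>Positive definiteness with a margin is an open condition. It permits testing the
  supersolution along a sequence of which only the limit matrix is controlled.\<close>

lemma eventually_pos_definite:
  fixes M :: "nat \<Rightarrow> real^'m^'m"
  assumes M: "M \<longlonglongrightarrow> N" and N: "\<eta> *\<^sub>R mat 1 \<preceq> N" and \<eta>: "\<eta> > 0"
  shows "\<forall>\<^sub>F k in sequentially. pos_definite (M k)"
proof -
  define s where "s k = (\<Sum>i\<in>UNIV. \<Sum>j\<in>UNIV. \<bar>(M k - N) $ i $ j\<bar>)" for k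
  have "s \<longlonglongrightarrow> (\<Sum>i\<in>(UNIV::'m set). \<Sum>j\<in>(UNIV::'m set). \<bar>(N - N) $ i $ j\<bar>)"
    unfolding s_def by (intro tendsto_intros tendsto_vec_nth M)
  then have "s \<longlonglongrightarrow> 0" by simp
  then have "\<forall>\<^sub>F k in sequentially. s k < \<eta>" using \<eta> by (rule order_tendstoD)
  then show ?thesis
  proof eventually_elim
    case (elim k)
    show ?case
      unfolding pos_definite_def
    proof (intro allI impI)
      fix x :: "real^'m" assume "x \<noteq> 0"
      then have nx: "0 < (norm x)\<^sup>2" by simp
      have "\<eta> * (norm x)\<^sup>2 \<le> x \<bullet> (N *v x)"
        using N by (simp add: mat_le_def scaleR_matrix_vector_assoc[symmetric] power2_norm_eq_inner)
      moreover have "\<bar>x \<bullet> ((M k - N) *v x)\<bar> \<le> s k * (norm x)\<^sup>2" unfolding s_def by (rule abs_quadratic_form_le)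
      moreover have "x \<bullet> ((M k - N) *v x) = x \<bullet> (M k *v x) - x \<bullet> (N *v x)"
        by (simp add: matrix_vector_mult_diff_rdistrib inner_diff_right)
      moreover have "s k * (norm x)\<^sup>2 < \<eta> * (norm x)\<^sup>2" using elim nx by simp
      ultimately show "0 < x \<bullet> (M k *v x)" by linarith
    qed
  qed
qed

lemma tendsto_MA_matrix:
  fixes \<sigma> :: "real^'n \<Rightarrow> real^'m^'n"
  assumes \<sigma>: "continuous_on S \<sigma>" and A: "continuous_on (S \<times> UNIV) (\<lambda>(x, p). A x p)"
    and lim: "x \<longlonglongrightarrow> x0" "p \<longlonglongrightarrow> p0" "X \<longlonglongrightarrow> X0" and S: "\<And>k. x k \<in> S" "x0 \<in> S"
  shows "(\<lambda>k. MA_matrix \<sigma> A (x k) (p k) (X k)) \<longlonglongrightarrow> MA_matrix \<sigma> A x0 p0 X0"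
proof -
  have s: "(\<lambda>k. \<sigma> (x k)) \<longlonglongrightarrow> \<sigma> x0"
    by (rule continuous_on_tendsto_compose[OF \<sigma> lim(1)]) (use S in auto)
  have a: "(\<lambda>k. A (x k) (p k)) \<longlonglongrightarrow> A x0 p0"
    using continuous_on_tendsto_compose[OF A tendsto_Pair[OF lim(1,2)]] S by simp
  show ?thesis
    unfolding MA_matrix_def
  proof (intro tendsto_add a vec_tendstoI)
    fix i j
    show "(\<lambda>k. (transpose (\<sigma> (x k)) ** X k ** \<sigma> (x k)) $ i $ j) \<longlonglongrightarrow> (transpose (\<sigma> x0) ** X0 ** \<sigma> x0) $ i $ j"
      by (simp add: matrix_matrix_mult_def transpose_def) (intro tendsto_intros tendsto_vec_nth s lim(3))
  qed
qed

section \<open>The comparison principle\<close>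

text \<open>Read as quadratic forms in the two halves of a vector, the block inequalities of the
  structure condition become those delivered by the theorem on sums.\<close>

lemma block_mat_quadratic_form:
  fixes P Q R S :: "real^'n^'n" and \<zeta> :: "real^('n + 'n)"
  defines "h \<equiv> \<chi> a. \<zeta> $ Inl a" and "k \<equiv> \<chi> a. \<zeta> $ Inr a"
  shows "\<zeta> \<bullet> (block_mat P Q R S *v \<zeta>) = h \<bullet> (P *v h + Q *v k) + k \<bullet> (R *v h + S *v k)"
proof -
  have s: "(\<Sum>i\<in>UNIV. f i) = (\<Sum>a\<in>UNIV. f (Inl a)) + (\<Sum>a\<in>UNIV. f (Inr a))" for f :: "'n + 'n \<Rightarrow> real"
    by (simp add: UNIV_Plus_UNIV[symmetric] sum.Plus del: UNIV_Plus_UNIV)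
  show ?thesis
    by (simp add: inner_vec_def matrix_vector_mult_def s block_mat_def h_def k_def)
qed

lemma norm_matrix_vector_mult_le:
  fixes M :: "real^'m^'n"
  shows "norm (M *v x) \<le> norm M * norm x"
proof -
  have "(norm (M *v x))\<^sup>2 = (\<Sum>i\<in>UNIV. (M $ i \<bullet> x)\<^sup>2)"
    unfolding power2_norm_eq_inner inner_vec_def[of "M *v x"]
    by (simp add: matrix_vector_mult_def inner_vec_def power2_eq_square)
  also have "\<dots> \<le> (\<Sum>i\<in>UNIV. (norm (M $ i))\<^sup>2 * (norm x)\<^sup>2)"
  proof (rule sum_mono)
    fix i
    have "\<bar>M $ i \<bullet> x\<bar> \<le> norm (M $ i) * norm x" by (rule Cauchy_Schwarz_ineq2)
    then have "\<bar>M $ i \<bullet> x\<bar>\<^sup>2 \<le> (norm (M $ i) * norm x)\<^sup>2" by (intro power_mono) auto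
    then show "(M $ i \<bullet> x)\<^sup>2 \<le> (norm (M $ i))\<^sup>2 * (norm x)\<^sup>2" by (simp add: power_mult_distrib)
  qed
  also have "\<dots> = (norm M)\<^sup>2 * (norm x)\<^sup>2"
    by (simp add: norm_vec_def L2_set_def real_sqrt_pow2 sum_nonneg sum_distrib_right)
  finally show ?thesis by (metis mult_nonneg_nonneg norm_ge_zero power2_le_imp_le power_mult_distrib)
qed

section \<open>Viscosity inequalities at limits of jets\<close>

locale comparison_setting =
  fixes \<Omega> :: "(real^'n) set"
    and \<sigma> :: "real^'n \<Rightarrow> real^'m^'n"
    and A :: "real^'n \<Rightarrow> real^'n \<Rightarrow> real^'m^'m"
    and K :: "real^'n \<Rightarrow> real \<Rightarrow> real^'n \<Rightarrow> real^'n^'n \<Rightarrow> real"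
    and \<omega> :: "real \<Rightarrow> real" and L C\<^sub>1 :: real
  assumes bounded_dom: "bounded \<Omega>" and open_dom: "open \<Omega>"
    and K_cont: "continuous_on (closure \<Omega> \<times> UNIV \<times> UNIV \<times> sym_mats) (\<lambda>(x, r, p, X). K x r p X)"
    and modulus: "modulus \<omega>"
    and K_struct: "\<And>\<epsilon> x y r X Y. \<epsilon> > 0 \<Longrightarrow> x \<in> closure \<Omega> \<Longrightarrow> y \<in> closure \<Omega> \<Longrightarrow>
      X \<in> sym_mats \<Longrightarrow> Y \<in> sym_mats \<Longrightarrow>
      - (3 / \<epsilon>) *\<^sub>R block_mat (mat 1) 0 0 (mat 1) \<preceq> block_mat X 0 0 (- Y) \<Longrightarrow>
      block_mat X 0 0 (- Y) \<preceq> (3 / \<epsilon>) *\<^sub>R block_mat (mat 1) (- mat 1) (- mat 1) (mat 1) \<Longrightarrow>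
      K y r ((1 / \<epsilon>) *\<^sub>R (x - y)) Y - K x r ((1 / \<epsilon>) *\<^sub>R (x - y)) X
        \<le> \<omega> (norm (x - y) * (1 + norm (x - y) / \<epsilon>))"
    and \<sigma>_lip: "L-lipschitz_on (closure \<Omega>) \<sigma>"
    and A_sym: "\<And>x p. x \<in> closure \<Omega> \<Longrightarrow> A x p \<in> sym_mats"
    and A_cont: "continuous_on (closure \<Omega> \<times> UNIV) (\<lambda>(x, p). A x p)"
    and A_lip: "\<And>x y p. x \<in> closure \<Omega> \<Longrightarrow> y \<in> closure \<Omega> \<Longrightarrow>
      A x p - A y p \<preceq> (C\<^sub>1 * norm (x - y) * (1 + norm p)) *\<^sub>R mat 1"
begin

lemma dom_subset: "\<Omega> \<subseteq> closure \<Omega>" by (rule closure_subset)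

lemma compact_dom: "compact (closure \<Omega>)" using bounded_dom by (simp add: compact_closure)

lemma tendsto_MA:
  assumes "x \<longlonglongrightarrow> x0" "p \<longlonglongrightarrow> p0" "X \<longlonglongrightarrow> X0" "\<And>k. x k \<in> closure \<Omega>" "x0 \<in> closure \<Omega>"
  shows "(\<lambda>k. MA_matrix \<sigma> A (x k) (p k) (X k)) \<longlonglongrightarrow> MA_matrix \<sigma> A x0 p0 X0"
  by (rule tendsto_MA_matrix[OF lipschitz_on_continuous_on[OF \<sigma>_lip] A_cont assms])

lemma tendsto_K:
  assumes "x \<longlonglongrightarrow> x0" "r \<longlonglongrightarrow> r0" "p \<longlonglongrightarrow> p0" "X \<longlonglongrightarrow> X0" "\<And>k. x k \<in> closure \<Omega>" "x0 \<in> closure \<Omega>"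
    "\<And>k. X k \<in> sym_mats" "X0 \<in> sym_mats"
  shows "(\<lambda>k. K (x k) (r k) (p k) (X k)) \<longlonglongrightarrow> K x0 r0 p0 X0"
  using continuous_on_tendsto_compose[OF K_cont tendsto_Pair[OF assms(1) tendsto_Pair[OF assms(2) tendsto_Pair[OF assms(3,4)]]]] assms(5-)
  by simp

lemma tendsto_shifted:
  fixes Xs :: "nat \<Rightarrow> real^'n^'n"
  assumes "Xs \<longlonglongrightarrow> X"
  shows "(\<lambda>k. Xs k + inverse (real (Suc k)) *\<^sub>R mat 1) \<longlonglongrightarrow> X"
proof -
  have "(\<lambda>k. Xs k + inverse (real (Suc k)) *\<^sub>R (mat 1 :: real^'n^'n)) \<longlonglongrightarrow> X + 0 *\<^sub>R mat 1"
    by (intro tendsto_intros assms LIMSEQ_inverse_real_of_nat)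
  then show ?thesis by simp
qed

text \<open>The jets are tested with the shift 1 / (k + 1), which vanishes in the limit. The bound
  by \<open>\<gamma>\<close> survives the limit and keeps the determinant positive there, so that
  the logarithm is continuous.\<close>

lemma subsol_limit:
  assumes u: "bounded (u ` closure \<Omega>)" "visc_subsol \<Omega> \<sigma> A K u"
    and m: "visc_matrix_subsol \<Omega> (\<lambda>x p X. - MA_matrix \<sigma> A x p X) (- \<gamma> *\<^sub>R mat 1) u" and \<gamma>: "\<gamma> > 0"
    and j: "\<And>k. superjet (closure \<Omega>) u (x k) (p k) (Xs k)" "\<And>k. Xs k \<in> sym_mats" "\<And>k. x k \<in> closure \<Omega>"
    and lim: "x \<longlonglongrightarrow> x0" "(\<lambda>k. u (x k)) \<longlonglongrightarrow> u x0" "p \<longlonglongrightarrow> p0" "Xs \<longlonglongrightarrow> X" and X: "X \<in> sym_mats" and x0: "x0 \<in> \<Omega>"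
  shows "\<gamma> *\<^sub>R mat 1 \<preceq> MA_matrix \<sigma> A x0 p0 X"
    "K x0 (u x0) p0 X \<le> ln (det (MA_matrix \<sigma> A x0 p0 X))"
proof -
  define Z where "Z k = Xs k + inverse (real (Suc k)) *\<^sub>R mat 1" for k
  have Z: "Z k \<in> sym_mats" for k unfolding Z_def by (intro sym_mats_add j(2) sym_mats_scaled_mat)
  have Zl: "Z \<longlonglongrightarrow> X" unfolding Z_def by (rule tendsto_shifted[OF lim(4)])
  have x0c: "x0 \<in> closure \<Omega>" using x0 dom_subset by blast
  define M where "M k = MA_matrix \<sigma> A (x k) (p k) (Z k)" for k
  have Ml: "M \<longlonglongrightarrow> MA_matrix \<sigma> A x0 p0 X" unfolding M_def by (rule tendsto_MA[OF lim(1,3) Zl j(3) x0c])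
  have ev: "\<forall>\<^sub>F k in sequentially. x k \<in> \<Omega>" using lim(1) open_dom x0 by (rule topological_tendstoD)
  have ineq: "\<gamma> *\<^sub>R mat 1 \<preceq> M k \<and> 0 < det (M k) \<and> K (x k) (u (x k)) (p k) (Z k) \<le> ln (det (M k))" if "x k \<in> \<Omega>" for k
    using visc_subsol_jet[OF bounded_dom that u m j(1,2), of "inverse (real (Suc k))"]
    unfolding Z_def[symmetric] M_def MA_op_le_0_iff by simp
  show ge: "\<gamma> *\<^sub>R mat 1 \<preceq> MA_matrix \<sigma> A x0 p0 X"
    unfolding mat_le_def
  proof
    fix \<xi> :: "real^'m"
    have "\<forall>\<^sub>F k in sequentially. \<xi> \<bullet> ((\<gamma> *\<^sub>R mat 1) *v \<xi>) \<le> \<xi> \<bullet> (M k *v \<xi>)"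
      using ev by eventually_elim (use ineq in \<open>auto simp: mat_le_def\<close>)
    then show "\<xi> \<bullet> ((\<gamma> *\<^sub>R mat 1) *v \<xi>) \<le> \<xi> \<bullet> (MA_matrix \<sigma> A x0 p0 X *v \<xi>)"
      by (rule tendsto_lowerbound[OF tendsto_quadratic_form[OF Ml]]) simp
  qed
  have "pos_definite (MA_matrix \<sigma> A x0 p0 X)"
    unfolding pos_definite_def
  proof (intro allI impI)
    fix \<xi> :: "real^'m" assume "\<xi> \<noteq> 0"
    then have "0 < \<gamma> * (\<xi> \<bullet> \<xi>)" using \<gamma> by simp
    then show "0 < \<xi> \<bullet> (MA_matrix \<sigma> A x0 p0 X *v \<xi>)"
      using ge by (simp add: mat_le_def scaleR_matrix_vector_assoc[symmetric]) (meson less_le_trans)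
  qed
  then have "0 < det (MA_matrix \<sigma> A x0 p0 X)" by (intro det_pos_definite_pos MA_matrix_sym X A_sym x0c)
  then have "(\<lambda>k. ln (det (M k))) \<longlonglongrightarrow> ln (det (MA_matrix \<sigma> A x0 p0 X))"
    by (intro tendsto_ln tendsto_det Ml) simp
  moreover have "(\<lambda>k. K (x k) (u (x k)) (p k) (Z k)) \<longlonglongrightarrow> K x0 (u x0) p0 X"
    by (rule tendsto_K[OF lim(1-3) Zl j(3) x0c Z X])
  ultimately show "K x0 (u x0) p0 X \<le> ln (det (MA_matrix \<sigma> A x0 p0 X))"
  proof (rule tendsto_le[OF sequentially_bot])
    show "\<forall>\<^sub>F k in sequentially. K (x k) (u (x k)) (p k) (Z k) \<le> ln (det (M k))"
      using ev by eventually_elim (use ineq in blast)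
  qed
qed

text \<open>The bound by \<open>\<eta>\<close> at the limit makes the approximating matrices
  positive definite from some index on, where the supersolution inequality becomes available. The
  jets are those of \<open>- v\<close>, hence \<open>q\<close> tends to \<open>- p0\<close>.\<close>

lemma supersol_limit:
  assumes v: "bounded (v ` closure \<Omega>)" "visc_supersol \<Omega> \<sigma> A K v"
    and j: "\<And>k. superjet (closure \<Omega>) (\<lambda>y. - v y) (y k) (q k) (Ys k)" "\<And>k. Ys k \<in> sym_mats" "\<And>k. y k \<in> closure \<Omega>"
    and lim: "y \<longlonglongrightarrow> y0" "(\<lambda>k. - v (y k)) \<longlonglongrightarrow> - v y0" "q \<longlonglongrightarrow> - p0" "Ys \<longlonglongrightarrow> Y" and Y: "Y \<in> sym_mats" and y0: "y0 \<in> \<Omega>"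
    and ge: "\<eta> *\<^sub>R mat 1 \<preceq> MA_matrix \<sigma> A y0 p0 (- Y)" and \<eta>: "\<eta> > 0" and det: "0 < det (MA_matrix \<sigma> A y0 p0 (- Y))"
  shows "ln (det (MA_matrix \<sigma> A y0 p0 (- Y))) \<le> K y0 (v y0) p0 (- Y)"
proof -
  define Z where "Z k = Ys k + inverse (real (Suc k)) *\<^sub>R mat 1" for k
  have Z: "Z k \<in> sym_mats" for k unfolding Z_def by (intro sym_mats_add j(2) sym_mats_scaled_mat)
  have Zl: "(\<lambda>k. - Z k) \<longlonglongrightarrow> - Y" unfolding Z_def by (intro tendsto_minus tendsto_shifted[OF lim(4)])
  have ql: "(\<lambda>k. - q k) \<longlonglongrightarrow> p0" using tendsto_minus[OF lim(3)] by simp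
  have vl: "(\<lambda>k. v (y k)) \<longlonglongrightarrow> v y0" using tendsto_minus[OF lim(2)] by simp
  have y0c: "y0 \<in> closure \<Omega>" using y0 dom_subset by blast
  define M where "M k = MA_matrix \<sigma> A (y k) (- q k) (- Z k)" for k
  have Ml: "M \<longlonglongrightarrow> MA_matrix \<sigma> A y0 p0 (- Y)" unfolding M_def by (rule tendsto_MA[OF lim(1) ql Zl j(3) y0c])
  have ev: "\<forall>\<^sub>F k in sequentially. y k \<in> \<Omega>" using lim(1) open_dom y0 by (rule topological_tendstoD)
  have ineq: "ln (det (M k)) \<le> K (y k) (v (y k)) (- q k) (- Z k)" if k: "y k \<in> \<Omega>" "pos_definite (M k)" for k
  proof -
    have "0 < det (M k)"
      using k(2) unfolding M_def
      by (intro det_pos_definite_pos MA_matrix_sym sym_mats_uminus Z A_sym j(3))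
    moreover have "0 \<le> MA_op \<sigma> A K (y k) (v (y k)) (- q k) (- Z k)"
      unfolding Z_def by (rule visc_supersol_jet[OF bounded_dom k(1) v j(1,2)]) (use k(2) in \<open>simp_all add: M_def Z_def\<close>)
    ultimately show ?thesis by (simp add: M_def MA_op_ge_0_iff)
  qed
  have l1: "(\<lambda>k. ln (det (M k))) \<longlonglongrightarrow> ln (det (MA_matrix \<sigma> A y0 p0 (- Y)))"
    using det by (intro tendsto_ln tendsto_det Ml) simp
  have l2: "(\<lambda>k. K (y k) (v (y k)) (- q k) (- Z k)) \<longlonglongrightarrow> K y0 (v y0) p0 (- Y)"
    by (rule tendsto_K[OF lim(1) vl ql Zl j(3) y0c]) (auto intro: sym_mats_uminus Z Y)
  show ?thesis
  proof (rule tendsto_le[OF sequentially_bot l2 l1])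
    show "\<forall>\<^sub>F k in sequentially. ln (det (M k)) \<le> K (y k) (v (y k)) (- q k) (- Z k)"
      using ev eventually_pos_definite[OF Ml ge \<eta>] by eventually_elim (rule ineq)
  qed
qed

section \<open>Doubling of variables\<close>

text \<open>The two viscosity inequalities are subtracted at a fixed \<epsilon>. In
  \<open>\<delta>\<close> the first term is the joint bound on the two matrices evaluated at
  \<open>\<sigma> x0 *v \<xi>\<close> and \<open>\<sigma> y0 *v \<xi>\<close>, the second the
  variation of \<open>A\<close> at the common slope \<open>p\<close>; the absolute value keeps
  \<open>\<delta>\<close> nonnegative whatever the sign of \<open>C\<^sub>1\<close>.\<close>

lemma doubling_estimate:
  assumes u: "bounded (u ` closure \<Omega>)" "visc_subsol \<Omega> \<sigma> A K u"
    and m: "visc_matrix_subsol \<Omega> (\<lambda>x p X. - MA_matrix \<sigma> A x p X) (- \<gamma> *\<^sub>R mat 1) u" and \<gamma>: "\<gamma> > 0"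
    and v: "bounded (v ` closure \<Omega>)" "visc_supersol \<Omega> \<sigma> A K v"
    and C: "K_increasing \<Omega> K C (max (sup_norm (closure \<Omega>) u) (sup_norm (closure \<Omega>) v))"
    and \<epsilon>: "\<epsilon> > 0" and xy: "x0 \<in> \<Omega>" "y0 \<in> \<Omega>" "v y0 \<le> u x0"
    and mx: "\<And>x y. x \<in> closure \<Omega> \<Longrightarrow> y \<in> closure \<Omega> \<Longrightarrow>
      u x + - v y - (norm (x - y))\<^sup>2 / (2 * \<epsilon>) \<le> u x0 + - v y0 - (norm (x0 - y0))\<^sup>2 / (2 * \<epsilon>)"
    and \<delta>: "\<delta> = 3 * L\<^sup>2 * ((norm (x0 - y0))\<^sup>2 / \<epsilon>) + \<bar>C\<^sub>1\<bar> * (norm (x0 - y0) * (1 + norm (x0 - y0) / \<epsilon>))" "\<delta> < \<gamma>"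
  shows "C * (u x0 - v y0) \<le> \<omega> (norm (x0 - y0) * (1 + norm (x0 - y0) / \<epsilon>)) - real CARD('m) * ln (1 - \<delta> / \<gamma>)"
proof -
  have c0: "x0 \<in> closure \<Omega>" "y0 \<in> closure \<Omega>" using xy dom_subset by auto
  have uu: "usc_on (closure \<Omega>) u" using u(2) by (simp add: visc_subsol_def)
  have vv: "usc_on (closure \<Omega>) (\<lambda>y. - v y)" using v(2) by (intro lsc_on_uminus) (simp add: visc_supersol_def)
  obtain X Y x y ps qs Xs Ys where
    jets: "\<And>k. superjet (closure \<Omega>) u (x k) (ps k) (Xs k)" "\<And>k. superjet (closure \<Omega>) (\<lambda>y. - v y) (y k) (qs k) (Ys k)"
    and lims': "x \<longlonglongrightarrow> x0" "y \<longlonglongrightarrow> y0" "(\<lambda>k. u (x k)) \<longlonglongrightarrow> u x0" "(\<lambda>k. - v (y k)) \<longlonglongrightarrow> - v y0"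
      "ps \<longlonglongrightarrow> (1 / \<epsilon>) *\<^sub>R (x0 - y0)" "qs \<longlonglongrightarrow> - ((1 / \<epsilon>) *\<^sub>R (x0 - y0))" "Xs \<longlonglongrightarrow> X" "Ys \<longlonglongrightarrow> Y"
    and dom: "\<And>k. x k \<in> closure \<Omega>" "\<And>k. y k \<in> closure \<Omega>" "\<And>k. Xs k \<in> sym_mats" "\<And>k. Ys k \<in> sym_mats"
    and XY: "X \<in> sym_mats" "Y \<in> sym_mats"
    and low: "\<And>h. - (3 / \<epsilon>) * (norm h)\<^sup>2 \<le> h \<bullet> (X *v h)" "\<And>h. - (3 / \<epsilon>) * (norm h)\<^sup>2 \<le> h \<bullet> (Y *v h)"
    and up: "\<And>h k. h \<bullet> (X *v h) + k \<bullet> (Y *v k) \<le> 3 / \<epsilon> * (norm (h - k))\<^sup>2"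
    by (rule theorem_on_sums[OF compact_dom c0 uu vv \<epsilon> mx]) (assumption+, rule that, assumption+)
  define p where "p = (1 / \<epsilon>) *\<^sub>R (x0 - y0)"
  note lims = lims'[folded p_def]
  define M where "M = MA_matrix \<sigma> A x0 p X"
  define N where "N = MA_matrix \<sigma> A y0 p (- Y)"
  have subl: "\<gamma> *\<^sub>R mat 1 \<preceq> M" "K x0 (u x0) p X \<le> ln (det M)"
    unfolding M_def by (rule subsol_limit[OF u m \<gamma> jets(1) dom(3,1) lims(1,3,5,7) XY(1) xy(1)])+
  have Ms: "M \<in> sym_mats" unfolding M_def by (intro MA_matrix_sym XY(1) A_sym c0(1))
  have Ns: "N \<in> sym_mats" unfolding N_def by (intro MA_matrix_sym sym_mats_uminus XY(2) A_sym c0(2))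
  have neg: "(- Y) *v h = - (Y *v h)" for h by (simp add: vec_eq_iff matrix_vector_mult_def sum_negf)
  have np: "norm p = norm (x0 - y0) / \<epsilon>" using \<epsilon> by (simp add: p_def)
  have \<delta>0: "0 \<le> \<delta>" unfolding \<delta>(1) using \<epsilon> by (intro add_nonneg_nonneg mult_nonneg_nonneg) auto
  have MN: "M - \<delta> *\<^sub>R mat 1 \<preceq> N"
    unfolding mat_le_def
  proof
    fix \<xi>
    define a b where "a = \<sigma> x0 *v \<xi>" and "b = \<sigma> y0 *v \<xi>"
    have 1: "\<xi> \<bullet> (M *v \<xi>) - \<xi> \<bullet> (N *v \<xi>) = (a \<bullet> (X *v a) + b \<bullet> (Y *v b)) + \<xi> \<bullet> ((A x0 p - A y0 p) *v \<xi>)"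
      by (simp add: M_def N_def MA_matrix_quadratic_form neg a_def b_def matrix_vector_mult_diff_rdistrib inner_diff_right)
    have "norm (a - b) \<le> norm (\<sigma> x0 - \<sigma> y0) * norm \<xi>"
      unfolding a_def b_def by (metis matrix_vector_mult_diff_rdistrib norm_matrix_vector_mult_le)
    also have "\<dots> \<le> (L * norm (x0 - y0)) * norm \<xi>"
      using lipschitz_onD[OF \<sigma>_lip c0] by (intro mult_right_mono) (auto simp: dist_norm)
    finally have "(norm (a - b))\<^sup>2 \<le> ((L * norm (x0 - y0)) * norm \<xi>)\<^sup>2" by (intro power_mono) auto
    then have "3 / \<epsilon> * (norm (a - b))\<^sup>2 \<le> 3 / \<epsilon> * ((L * norm (x0 - y0)) * norm \<xi>)\<^sup>2"
      using \<epsilon> by (intro mult_left_mono) auto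
    also have "\<dots> = 3 * L\<^sup>2 * ((norm (x0 - y0))\<^sup>2 / \<epsilon>) * (norm \<xi>)\<^sup>2" by (simp add: power_mult_distrib)
    finally have 2: "a \<bullet> (X *v a) + b \<bullet> (Y *v b) \<le> 3 * L\<^sup>2 * ((norm (x0 - y0))\<^sup>2 / \<epsilon>) * (norm \<xi>)\<^sup>2"
      using up[of a b] by linarith
    have "\<xi> \<bullet> ((A x0 p - A y0 p) *v \<xi>) \<le> (C\<^sub>1 * norm (x0 - y0) * (1 + norm p)) * (norm \<xi>)\<^sup>2"
      using A_lip[OF c0, of p] by (simp add: mat_le_def scaleR_matrix_vector_assoc[symmetric] power2_norm_eq_inner)
    also have "\<dots> = C\<^sub>1 * ((norm (x0 - y0) * (1 + norm (x0 - y0) / \<epsilon>)) * (norm \<xi>)\<^sup>2)" by (simp add: np)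
    also have "\<dots> \<le> \<bar>C\<^sub>1\<bar> * ((norm (x0 - y0) * (1 + norm (x0 - y0) / \<epsilon>)) * (norm \<xi>)\<^sup>2)"
      using \<epsilon> by (intro mult_right_mono mult_nonneg_nonneg) auto
    finally have 3: "\<xi> \<bullet> ((A x0 p - A y0 p) *v \<xi>) \<le> \<bar>C\<^sub>1\<bar> * (norm (x0 - y0) * (1 + norm (x0 - y0) / \<epsilon>)) * (norm \<xi>)\<^sup>2"
      by (simp add: mult.assoc)
    have "\<delta> * (norm \<xi>)\<^sup>2 = 3 * L\<^sup>2 * ((norm (x0 - y0))\<^sup>2 / \<epsilon>) * (norm \<xi>)\<^sup>2 + \<bar>C\<^sub>1\<bar> * (norm (x0 - y0) * (1 + norm (x0 - y0) / \<epsilon>)) * (norm \<xi>)\<^sup>2"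
      unfolding \<delta>(1) by (rule distrib_right)
    with 1 2 3 have "\<xi> \<bullet> (M *v \<xi>) - \<delta> * (norm \<xi>)\<^sup>2 \<le> \<xi> \<bullet> (N *v \<xi>)" by linarith
    then show "\<xi> \<bullet> ((M - \<delta> *\<^sub>R mat 1) *v \<xi>) \<le> \<xi> \<bullet> (N *v \<xi>)"
      by (simp add: matrix_vector_mult_diff_rdistrib scaleR_matrix_vector_assoc[symmetric] inner_diff_right power2_norm_eq_inner)
  qed
  note pert = ln_det_perturbation[OF Ms subl(1) Ns MN \<delta>0 \<delta>(2)]
  \<comment> \<open>The margin left after the perturbation is the \<open>\<eta>\<close> with which
    the supersolution is tested.\<close>
  have "(\<gamma> - \<delta>) *\<^sub>R mat 1 \<preceq> N"
    unfolding mat_le_def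
  proof
    fix \<xi> :: "real^'m"
    have "\<gamma> * (\<xi> \<bullet> \<xi>) \<le> \<xi> \<bullet> (M *v \<xi>)"
      using subl(1) by (simp add: mat_le_def scaleR_matrix_vector_assoc[symmetric])
    moreover have "\<xi> \<bullet> (M *v \<xi>) - \<delta> * (\<xi> \<bullet> \<xi>) \<le> \<xi> \<bullet> (N *v \<xi>)"
      using MN by (simp add: mat_le_def matrix_vector_mult_diff_rdistrib scaleR_matrix_vector_assoc[symmetric] inner_diff_right)
    ultimately show "\<xi> \<bullet> (((\<gamma> - \<delta>) *\<^sub>R mat 1) *v \<xi>) \<le> \<xi> \<bullet> (N *v \<xi>)"
      by (simp add: scaleR_matrix_vector_assoc[symmetric] left_diff_distrib)
  qed
  then have supl: "ln (det N) \<le> K y0 (v y0) p (- Y)"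
    unfolding N_def using pert(3) \<delta>(2)
    by (intro supersol_limit[OF v jets(2) dom(4,2) lims(2,4,6,8) XY(2) xy(2), where \<eta>="\<gamma> - \<delta>"]) (auto simp: N_def)
  \<comment> \<open>\<open>Y\<close> belongs to the jets of \<open>- v\<close>, so
    \<open>- Y\<close> takes the place of the second matrix in the structure condition.\<close>
  have struct: "K y0 (v y0) p (- Y) - K x0 (v y0) p X \<le> \<omega> (norm (x0 - y0) * (1 + norm (x0 - y0) / \<epsilon>))"
    unfolding p_def
  proof (rule K_struct[OF \<epsilon> c0 XY(1) sym_mats_uminus[OF XY(2)]])
    have m1: "(- mat 1 :: real^'n^'n) *v h = - h" for h
      by (metis matrix_vector_mul_lid minus_zero add.inverse_inverse matrix_vector_mult_diff_rdistrib diff_0 matrix_vector_mult_0)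
    show "- (3 / \<epsilon>) *\<^sub>R block_mat (mat 1) 0 0 (mat 1) \<preceq> block_mat X 0 0 (- (- Y))"
      unfolding mat_le_def
    proof
      fix \<zeta> :: "real^('n + 'n)"
      show "\<zeta> \<bullet> ((- (3 / \<epsilon>) *\<^sub>R block_mat (mat 1) 0 0 (mat 1)) *v \<zeta>) \<le> \<zeta> \<bullet> (block_mat X 0 0 (- (- Y)) *v \<zeta>)"
        using low(1)[of "\<chi> a. \<zeta> $ Inl a"] low(2)[of "\<chi> a. \<zeta> $ Inr a"]
        by (simp only: scaleR_matrix_vector_assoc[symmetric] inner_scaleR_right block_mat_quadratic_form)
           (simp add: power2_norm_eq_inner algebra_simps)
    qed
    show "block_mat X 0 0 (- (- Y)) \<preceq> (3 / \<epsilon>) *\<^sub>R block_mat (mat 1) (- mat 1) (- mat 1) (mat 1)"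
      unfolding mat_le_def
    proof
      fix \<zeta> :: "real^('n + 'n)"
      show "\<zeta> \<bullet> (block_mat X 0 0 (- (- Y)) *v \<zeta>) \<le> \<zeta> \<bullet> (((3 / \<epsilon>) *\<^sub>R block_mat (mat 1) (- mat 1) (- mat 1) (mat 1)) *v \<zeta>)"
        using up[of "\<chi> a. \<zeta> $ Inl a" "\<chi> a. \<zeta> $ Inr a"]
        by (simp only: scaleR_matrix_vector_assoc[symmetric] inner_scaleR_right block_mat_quadratic_form m1)
           (simp add: power2_norm_eq_inner inner_diff_left inner_diff_right inner_commute)
    qed
  qed
  have incr: "C * (u x0 - v y0) \<le> K x0 (u x0) p X - K x0 (v y0) p X"
  proof -
    have "bdd_above ((\<lambda>x. \<bar>u x\<bar>) ` closure \<Omega>)" "bdd_above ((\<lambda>x. \<bar>v x\<bar>) ` closure \<Omega>)"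
      using u(1) v(1) by (auto simp: bounded_iff bdd_above_def)
    then have "\<bar>u x0\<bar> \<le> sup_norm (closure \<Omega>) u" "\<bar>v y0\<bar> \<le> sup_norm (closure \<Omega>) v"
      unfolding sup_norm_def using c0 by (auto intro: cSUP_upper)
    then have "- max (sup_norm (closure \<Omega>) u) (sup_norm (closure \<Omega>) v) \<le> v y0" "u x0 \<le> max (sup_norm (closure \<Omega>) u) (sup_norm (closure \<Omega>) v)"
      by linarith+
    then show ?thesis using C xy(3) c0(1) XY(1) unfolding K_increasing_def by blast
  qed
  \<comment> \<open>The chain starts from the monotonicity of \<open>K\<close> in its second
    argument at \<open>x0\<close>, passes through the subsolution, the determinants and the
    supersolution, and returns from \<open>y0\<close> to \<open>x0\<close> by the structure
    condition at the value \<open>v y0\<close>; in the sum all terms with \<open>K\<close>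
    cancel.\<close>
  show ?thesis using incr subl(2) pert(4) supl struct by linarith
qed

text \<open>Maximizers of the penalized difference cluster at a maximum point \<open>c\<close> of
  \<open>u - v\<close> over the closure. The strict boundary inequality places \<open>c\<close> in
  \<open>\<Omega>\<close>, so the doubling estimate applies from some index on and forces
  \<open>C * M0 \<le> 0\<close>.\<close>

lemma comparison_interior:
  assumes u: "bounded (u ` closure \<Omega>)" "visc_subsol \<Omega> \<sigma> A K u"
    and m: "visc_matrix_subsol \<Omega> (\<lambda>x p X. - MA_matrix \<sigma> A x p X) (- \<gamma> *\<^sub>R mat 1) u" and \<gamma>: "\<gamma> > 0"
    and v: "bounded (v ` closure \<Omega>)" "visc_supersol \<Omega> \<sigma> A K v"
    and C: "C > 0" "K_increasing \<Omega> K C (max (sup_norm (closure \<Omega>) u) (sup_norm (closure \<Omega>) v))"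
    and x1: "x1 \<in> \<Omega>" "0 < u x1 - v x1" and fr: "\<And>z. z \<in> frontier \<Omega> \<Longrightarrow> u z - v z < u x1 - v x1"
  shows False
proof -
  define S where "S = closure \<Omega>"
  have x1S: "x1 \<in> S" using x1(1) dom_subset by (auto simp: S_def)
  have Sc: "compact S" "S \<noteq> {}" using compact_dom x1S by (auto simp: S_def)
  have uu: "usc_on S u" using u(2) by (simp add: visc_subsol_def S_def)
  have vv: "usc_on S (\<lambda>y. - v y)" using v(2) unfolding S_def by (intro lsc_on_uminus) (simp add: visc_supersol_def)
  obtain xm where xm: "xm \<in> S" "\<And>y. y \<in> S \<Longrightarrow> u y + - v y \<le> u xm + - v xm"
    using usc_on_attains_sup[OF Sc usc_on_add[OF uu vv]] by blast
  define M0 where "M0 = u xm - v xm"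
  have M0: "u y - v y \<le> M0" if "y \<in> S" for y using xm(2)[OF that] by (simp add: M0_def)
  have M0pos: "0 < M0" "u x1 - v x1 \<le> M0" using x1(2) M0[OF x1S] by auto
  define e where "e j = inverse (real (Suc j))" for j
  have e: "e j > 0" for j by (simp add: e_def)
  have el: "e \<longlonglongrightarrow> 0" unfolding e_def by (rule LIMSEQ_inverse_real_of_nat)
  have "\<exists>z\<in>S \<times> S. \<forall>w\<in>S \<times> S. u (fst w) + - v (snd w) + - ((norm (fst w - snd w))\<^sup>2 / (2 * e j)) \<le>
      u (fst z) + - v (snd z) + - ((norm (fst z - snd z))\<^sup>2 / (2 * e j))" for j
  proof (rule usc_on_attains_sup)
    show "compact (S \<times> S)" "S \<times> S \<noteq> {}" using Sc by (auto intro: compact_Times)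
    have "usc_on (S \<times> S) (\<lambda>w. u (fst w))" by (rule usc_on_compose[OF uu]) (auto intro!: continuous_intros)
    moreover have "usc_on (S \<times> S) (\<lambda>w. - v (snd w))" by (rule usc_on_compose[OF vv]) (auto intro!: continuous_intros)
    moreover have "usc_on (S \<times> S) (\<lambda>w. - ((norm (fst w - snd w))\<^sup>2 / (2 * e j)))"
      using e[of j] by (intro continuous_imp_usc_on continuous_intros) auto
    ultimately show "usc_on (S \<times> S) (\<lambda>w. u (fst w) + - v (snd w) + - ((norm (fst w - snd w))\<^sup>2 / (2 * e j)))"
      by (intro usc_on_add)
  qed
  then obtain z where z: "\<And>j. z j \<in> S \<times> S" "\<And>j w. w \<in> S \<times> S \<Longrightarrow>
      u (fst w) + - v (snd w) + - ((norm (fst w - snd w))\<^sup>2 / (2 * e j)) \<le>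
      u (fst (z j)) + - v (snd (z j)) + - ((norm (fst (z j) - snd (z j)))\<^sup>2 / (2 * e j))" by metis
  define a b where "a j = fst (z j)" and "b j = snd (z j)" for j
  have ab: "a j \<in> S" "b j \<in> S" for j using z(1)[of j] by (auto simp: a_def b_def mem_Times_iff)
  have mx: "u x + - v y - (norm (x - y))\<^sup>2 / (2 * e j) \<le> u (a j) + - v (b j) - (norm (a j - b j))\<^sup>2 / (2 * e j)"
    if "x \<in> S" "y \<in> S" for x y j
    using z(2)[of "(x, y)" j] that by (simp add: a_def b_def)
  define t where "t j = (norm (a j - b j))\<^sup>2 / e j" for j
  have t0: "0 \<le> t j" for j using e[of j] by (simp add: t_def)
  \<comment> \<open>Comparison with the diagonal pair \<open>(xm, xm)\<close>, where the penalty is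
    zero.\<close>
  have tle: "t j / 2 \<le> u (a j) - v (b j) - M0" for j
    using mx[OF xm(1) xm(1), of j] by (simp add: t_def M0_def)
  have "compact (S \<times> S)" using Sc(1) by (intro compact_Times)
  then have "\<exists>l\<in>S \<times> S. \<exists>s. strict_mono s \<and> (z \<circ> s) \<longlonglongrightarrow> l"
    unfolding compact_def using z(1) by (auto dest!: spec[of _ z])
  then obtain l s where l: "l \<in> S \<times> S" "strict_mono s" "(z \<circ> s) \<longlonglongrightarrow> l" by blast
  have as: "(\<lambda>j. a (s j)) \<longlonglongrightarrow> fst l" using tendsto_fst[OF l(3)] by (simp add: a_def o_def)
  have bs: "(\<lambda>j. b (s j)) \<longlonglongrightarrow> snd l" using tendsto_snd[OF l(3)] by (simp add: b_def o_def)
  have es: "(\<lambda>j. e (s j)) \<longlonglongrightarrow> 0" using LIMSEQ_subseq_LIMSEQ[OF el l(2)] by (simp add: o_def)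
  obtain bu bv where bu: "\<And>y. y \<in> S \<Longrightarrow> \<bar>u y\<bar> \<le> bu" and bv: "\<And>y. y \<in> S \<Longrightarrow> \<bar>v y\<bar> \<le> bv"
    using u(1) v(1) unfolding bounded_iff S_def[symmetric] by auto
  define B where "B = 2 * (bu + bv)"
  have tB: "t j \<le> B" for j using tle[of j] bu[OF ab(1), of j] bv[OF ab(2), of j] M0pos(1) by (simp add: B_def)
  have "(\<lambda>j. (norm (a (s j) - b (s j)))\<^sup>2) \<longlonglongrightarrow> 0"
  proof (rule Lim_null_comparison)
    show "\<forall>\<^sub>F j in sequentially. norm ((norm (a (s j) - b (s j)))\<^sup>2) \<le> B * e (s j)"
    proof (intro always_eventually allI)
      fix j
      have "(norm (a (s j) - b (s j)))\<^sup>2 = t (s j) * e (s j)" using e[of "s j"] by (simp add: t_def)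
      also have "\<dots> \<le> B * e (s j)" using tB[of "s j"] e[of "s j"] by (intro mult_right_mono) auto
      finally show "norm ((norm (a (s j) - b (s j)))\<^sup>2) \<le> B * e (s j)" by simp
    qed
    show "(\<lambda>j. B * e (s j)) \<longlonglongrightarrow> 0" using tendsto_mult_left[OF es, of B] by simp
  qed
  moreover have "(\<lambda>j. (norm (a (s j) - b (s j)))\<^sup>2) \<longlonglongrightarrow> (norm (fst l - snd l))\<^sup>2"
    by (intro tendsto_intros as bs)
  ultimately have "(norm (fst l - snd l))\<^sup>2 = 0" using LIMSEQ_unique by blast
  then have lq: "snd l = fst l" by simp
  define c where "c = fst l"
  have cS: "c \<in> S" using l(1) by (auto simp: c_def)
  have as: "(\<lambda>j. a (s j)) \<longlonglongrightarrow> c" and bs: "(\<lambda>j. b (s j)) \<longlonglongrightarrow> c" using as bs lq by (auto simp: c_def)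
  \<comment> \<open>Semicontinuity keeps the values at the maximizers below nearly
    \<open>u c - v c\<close>. Together with \<open>tle\<close> this both drives the penalty to zero
    and makes \<open>c\<close> a maximum point.\<close>
  have close: "\<forall>\<^sub>F j in sequentially. u (a (s j)) - v (b (s j)) < u c - v c + \<eta>" if "\<eta> > 0" for \<eta>
  proof -
    have "\<forall>\<^sub>F j in sequentially. u (a (s j)) < u c + \<eta> / 2"
      by (rule usc_on_limit_less[OF uu as ab(1) cS]) (use that in auto)
    moreover have "\<forall>\<^sub>F j in sequentially. - v (b (s j)) < - v c + \<eta> / 2"
      by (rule usc_on_limit_less[OF vv bs ab(2) cS]) (use that in auto)
    ultimately show ?thesis by eventually_elim simp
  qed
  have ts: "(\<lambda>j. t (s j)) \<longlonglongrightarrow> 0"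
  proof (rule tendstoI)
    fix \<eta> :: real assume "\<eta> > 0"
    then have "\<forall>\<^sub>F j in sequentially. u (a (s j)) - v (b (s j)) < u c - v c + \<eta> / 2" by (intro close) simp
    then show "\<forall>\<^sub>F j in sequentially. dist (t (s j)) 0 < \<eta>"
    proof eventually_elim
      case (elim j)
      then show ?case using tle[of "s j"] M0[OF cS] t0[of "s j"] by simp
    qed
  qed
  have "M0 \<le> u c - v c"
  proof (rule field_le_epsilon)
    fix \<eta> :: real assume "\<eta> > 0"
    then obtain j where "u (a (s j)) - v (b (s j)) < u c - v c + \<eta>"
      using eventually_happens[OF close] by auto
    then show "M0 \<le> u c - v c + \<eta>" using tle[of "s j"] t0[of "s j"] by linarith
  qed
  then have "c \<notin> frontier \<Omega>" using fr[of c] M0pos(2) by auto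
  then have c\<Omega>: "c \<in> \<Omega>" using cS open_dom by (simp add: S_def frontier_def interior_open)
  define n where "n j = norm (a (s j) - b (s j))" for j
  have nl: "n \<longlonglongrightarrow> 0" unfolding n_def using tendsto_norm[OF tendsto_diff[OF as bs]] by simp
  have nt: "n j * (1 + n j / e (s j)) = n j + t (s j)" "(n j)\<^sup>2 / e (s j) = t (s j)" for j
    by (simp_all add: n_def t_def power2_eq_square algebra_simps)
  define \<delta> where "\<delta> j = 3 * L\<^sup>2 * t (s j) + \<bar>C\<^sub>1\<bar> * (n j + t (s j))" for j
  have "\<delta> \<longlonglongrightarrow> 3 * L\<^sup>2 * 0 + \<bar>C\<^sub>1\<bar> * (0 + 0)" unfolding \<delta>_def by (intro tendsto_intros nl ts)
  then have \<delta>l: "\<delta> \<longlonglongrightarrow> 0" by simp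
  \<comment> \<open>The limit of a modulus is taken over positive arguments only, while
    \<open>n j + t (s j)\<close> may vanish; there \<open>\<omega> 0 = 0\<close> is used.\<close>
  have \<omega>l: "(\<lambda>j. \<omega> (n j + t (s j))) \<longlonglongrightarrow> 0"
  proof (rule tendstoI)
    fix \<eta> :: real assume \<eta>: "\<eta> > 0"
    have "\<forall>\<^sub>F r in at_right 0. dist (\<omega> r) 0 < \<eta>"
      using modulus \<eta> unfolding modulus_def by (blast intro: tendstoD)
    then obtain d where d: "d > 0" "\<And>r. 0 < r \<Longrightarrow> r < d \<Longrightarrow> dist (\<omega> r) 0 < \<eta>"
      by (auto simp: eventually_at_right_field)
    have "(\<lambda>j. n j + t (s j)) \<longlonglongrightarrow> 0 + 0" by (intro tendsto_add nl ts)
    then have "\<forall>\<^sub>F j in sequentially. n j + t (s j) < d" using d(1) by (intro order_tendstoD) auto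
    then show "\<forall>\<^sub>F j in sequentially. dist (\<omega> (n j + t (s j))) 0 < \<eta>"
    proof eventually_elim
      case (elim j)
      have "0 \<le> n j + t (s j)" using t0[of "s j"] by (simp add: n_def)
      then show ?case using d(2)[OF _ elim] modulus \<eta> unfolding modulus_def
        by (cases "n j + t (s j) = 0") auto
    qed
  qed
  have "(\<lambda>j. \<omega> (n j + t (s j)) - real CARD('m) * ln (1 - \<delta> j / \<gamma>)) \<longlonglongrightarrow> 0 - real CARD('m) * ln (1 - 0 / \<gamma>)"
    using \<gamma> by (intro tendsto_intros \<omega>l \<delta>l) auto
  then have rhs: "(\<lambda>j. \<omega> (n j + t (s j)) - real CARD('m) * ln (1 - \<delta> j / \<gamma>)) \<longlonglongrightarrow> 0" by simp
  have "\<forall>\<^sub>F j in sequentially. a (s j) \<in> \<Omega>" "\<forall>\<^sub>F j in sequentially. b (s j) \<in> \<Omega>"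
    using as bs open_dom c\<Omega> by (auto intro: topological_tendstoD)
  moreover have "\<forall>\<^sub>F j in sequentially. \<delta> j < \<gamma>" using \<delta>l \<gamma> by (rule order_tendstoD)
  ultimately have "\<forall>\<^sub>F j in sequentially. C * M0 \<le> \<omega> (n j + t (s j)) - real CARD('m) * ln (1 - \<delta> j / \<gamma>)"
  proof eventually_elim
    case (elim j)
    have ge: "M0 \<le> u (a (s j)) - v (b (s j))" using tle[of "s j"] t0[of "s j"] by linarith
    then have "C * M0 \<le> C * (u (a (s j)) - v (b (s j)))" using C(1) by simp
    also have "\<dots> \<le> \<omega> (n j + t (s j)) - real CARD('m) * ln (1 - \<delta> j / \<gamma>)"
    proof (rule doubling_estimate[OF u m \<gamma> v C(2) e[of "s j"] elim(1,2) _ mx[of _ _ "s j", unfolded S_def], of "\<delta> j", folded n_def, unfolded nt])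
      show "v (b (s j)) \<le> u (a (s j))" using ge M0pos(1) by simp
      show "\<delta> j = 3 * L\<^sup>2 * t (s j) + \<bar>C\<^sub>1\<bar> * (n j + t (s j))" by (simp add: \<delta>_def)
    qed (use elim in auto)
    finally show ?case .
  qed
  then have "C * M0 \<le> 0" by (intro tendsto_lowerbound[OF rhs]) auto
  then show False using C(1) M0pos(1) by (simp add: mult_le_0_iff)
qed

section \<open>Comparison and uniqueness\<close>

text \<open>The boundary maximum is attained by semicontinuity on the compact frontier, which is
  nonempty for a nonempty bounded set. For an empty \<open>\<Omega>\<close> the extended real
  suprema on both sides are -\<infinity>.\<close>

lemma comparison_principle:
  assumes u: "bounded (u ` closure \<Omega>)" "visc_subsol \<Omega> \<sigma> A K u"
    and m: "visc_matrix_subsol \<Omega> (\<lambda>x p X. - MA_matrix \<sigma> A x p X) (- \<gamma> *\<^sub>R mat 1) u" and \<gamma>: "\<gamma> > 0"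
    and v: "bounded (v ` closure \<Omega>)" "visc_supersol \<Omega> \<sigma> A K v"
    and C: "C > 0" "K_increasing \<Omega> K C (max (sup_norm (closure \<Omega>) u) (sup_norm (closure \<Omega>) v))"
  shows "\<Omega> \<noteq> {} \<longrightarrow> (\<exists>z. is_arg_max (\<lambda>x. max (u x - v x) 0) (\<lambda>x. x \<in> frontier \<Omega>) z)"
    and "(SUP x\<in>\<Omega>. ereal (u x - v x)) \<le> (SUP x\<in>frontier \<Omega>. ereal (max (u x - v x) 0))"
proof -
  have arg: "\<exists>z\<in>frontier \<Omega>. \<forall>y\<in>frontier \<Omega>. u y - v y \<le> u z - v z" if "\<Omega> \<noteq> {}"
  proof -
    have "\<Omega> \<noteq> UNIV" using bounded_dom not_bounded_UNIV by auto
    then have ne: "frontier \<Omega> \<noteq> {}" using that frontier_not_empty by blast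
    have cf: "compact (frontier \<Omega>)" using bounded_dom by (rule compact_frontier_bounded)
    have sub: "frontier \<Omega> \<subseteq> closure \<Omega>" by (simp add: frontier_def)
    have "usc_on (closure \<Omega>) (\<lambda>x. u x + - v x)"
      using u(2) v(2) by (intro usc_on_add lsc_on_uminus) (simp_all add: visc_subsol_def visc_supersol_def)
    then have "usc_on (frontier \<Omega>) (\<lambda>x. u x + - v x)" using sub by (rule usc_on_subset)
    from usc_on_attains_sup[OF cf ne this] show ?thesis by simp
  qed
  show "\<Omega> \<noteq> {} \<longrightarrow> (\<exists>z. is_arg_max (\<lambda>x. max (u x - v x) 0) (\<lambda>x. x \<in> frontier \<Omega>) z)"
  proof
    assume "\<Omega> \<noteq> {}"
    then obtain z where "z \<in> frontier \<Omega>" "\<forall>y\<in>frontier \<Omega>. u y - v y \<le> u z - v z" using arg by blast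
    then show "\<exists>z. is_arg_max (\<lambda>x. max (u x - v x) 0) (\<lambda>x. x \<in> frontier \<Omega>) z"
      by (intro exI[of _ z]) (auto simp: is_arg_max_def not_less max_def)
  qed
  show "(SUP x\<in>\<Omega>. ereal (u x - v x)) \<le> (SUP x\<in>frontier \<Omega>. ereal (max (u x - v x) 0))"
  proof (rule SUP_least, rule ccontr)
    fix x assume x: "x \<in> \<Omega>" and "\<not> ereal (u x - v x) \<le> (SUP x\<in>frontier \<Omega>. ereal (max (u x - v x) 0))"
    then have lt: "(SUP x\<in>frontier \<Omega>. ereal (max (u x - v x) 0)) < ereal (u x - v x)" by simp
    have fr: "max (u z - v z) 0 < u x - v x" if "z \<in> frontier \<Omega>" for z
      using le_less_trans[OF SUP_upper[OF that, of "\<lambda>x. ereal (max (u x - v x) 0)"] lt] by simp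
    \<comment> \<open>Some frontier point is needed: the positive part there is at least 0, and this
      makes a value above all of them positive.\<close>
    obtain z where "z \<in> frontier \<Omega>" using arg x by blast
    then have pos: "0 < u x - v x" using fr[of z] by simp
    show False
      by (rule comparison_interior[OF u m \<gamma> v C x pos]) (use fr in fastforce)
  qed
qed

text \<open>Equal boundary values make the right-hand side of the comparison at most 0. In the
  theorem both solutions satisfy the inequality with \<open>\<gamma>\<close>, so the roles can be
  exchanged.\<close>

lemma unique_solution_le:
  assumes u: "continuous_on (closure \<Omega>) u" "visc_sol \<Omega> \<sigma> A K u"
    and v: "continuous_on (closure \<Omega>) v" "visc_sol \<Omega> \<sigma> A K v"
    and m: "visc_matrix_subsol \<Omega> (\<lambda>x p X. - MA_matrix \<sigma> A x p X) (- \<gamma> *\<^sub>R mat 1) u" and \<gamma>: "\<gamma> > 0"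
    and eq: "\<And>x. x \<in> frontier \<Omega> \<Longrightarrow> u x = v x"
    and C: "C > 0" "K_increasing \<Omega> K C (max (sup_norm (closure \<Omega>) u) (sup_norm (closure \<Omega>) v))"
    and x: "x \<in> \<Omega>"
  shows "u x \<le> v x"
proof -
  have b: "bounded (u ` closure \<Omega>)" "bounded (v ` closure \<Omega>)"
    by (intro compact_imp_bounded compact_continuous_image u(1) v(1) compact_dom)+
  have "ereal (u x - v x) \<le> (SUP x\<in>\<Omega>. ereal (u x - v x))" using x by (rule SUP_upper)
  also have "\<dots> \<le> (SUP x\<in>frontier \<Omega>. ereal (max (u x - v x) 0))"
    using u(2) v(2) unfolding visc_sol_def by (intro comparison_principle(2)[OF b(1) _ m \<gamma> b(2) _ C]) auto
  also have "\<dots> \<le> 0" by (rule SUP_least) (simp add: eq)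
  finally show ?thesis by simp
qed

end

theorem theorem2p2:
  fixes \<Omega> :: "(real^'n) set"
    and \<sigma> :: "real^'n \<Rightarrow> real^'m^'n"
    and A :: "real^'n \<Rightarrow> real^'n \<Rightarrow> real^'m^'m"
    and K :: "real^'n \<Rightarrow> real \<Rightarrow> real^'n \<Rightarrow> real^'n^'n \<Rightarrow> real"
    and \<omega> :: "real \<Rightarrow> real" and L C\<^sub>1 :: real
  assumes "bounded \<Omega>" and "open \<Omega>" and "CARD('m) \<le> CARD('n)"
    and K_cont: "continuous_on (closure \<Omega> \<times> UNIV \<times> UNIV \<times> sym_mats) (\<lambda>(x, r, p, X). K x r p X)"
    and K_mono: "\<And>x r s p X Y. x \<in> closure \<Omega> \<Longrightarrow> X \<in> sym_mats \<Longrightarrow> Y \<in> sym_mats \<Longrightarrow>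
      r \<le> s \<Longrightarrow> Y \<preceq> X \<Longrightarrow> K x r p X \<le> K x s p Y"
    and "modulus \<omega>"
    and K_struct: "\<And>\<epsilon> x y r X Y. \<epsilon> > 0 \<Longrightarrow> x \<in> closure \<Omega> \<Longrightarrow> y \<in> closure \<Omega> \<Longrightarrow>
      X \<in> sym_mats \<Longrightarrow> Y \<in> sym_mats \<Longrightarrow>
      - (3 / \<epsilon>) *\<^sub>R block_mat (mat 1) 0 0 (mat 1) \<preceq> block_mat X 0 0 (- Y) \<Longrightarrow>
      block_mat X 0 0 (- Y) \<preceq> (3 / \<epsilon>) *\<^sub>R block_mat (mat 1) (- mat 1) (- mat 1) (mat 1) \<Longrightarrow>
      K y r ((1 / \<epsilon>) *\<^sub>R (x - y)) Y - K x r ((1 / \<epsilon>) *\<^sub>R (x - y)) X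
        \<le> \<omega> (norm (x - y) * (1 + norm (x - y) / \<epsilon>))"
    and \<sigma>_lip: "L-lipschitz_on (closure \<Omega>) \<sigma>"
    and A_sym: "\<And>x p. x \<in> closure \<Omega> \<Longrightarrow> A x p \<in> sym_mats"
    and A_cont: "continuous_on (closure \<Omega> \<times> UNIV) (\<lambda>(x, p). A x p)"
    and A_lip: "\<And>x y p. x \<in> closure \<Omega> \<Longrightarrow> y \<in> closure \<Omega> \<Longrightarrow>
      - (C\<^sub>1 * norm (x - y) * (1 + norm p)) *\<^sub>R mat 1 \<preceq> A x p - A y p \<and>
      A x p - A y p \<preceq> (C\<^sub>1 * norm (x - y) * (1 + norm p)) *\<^sub>R mat 1"
  shows
    "(\<forall>u v \<gamma> C.
        bounded (u ` closure \<Omega>) \<and> visc_subsol \<Omega> \<sigma> A K u \<and>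
        \<gamma> > 0 \<and> visc_matrix_subsol \<Omega> (\<lambda>x p X. - MA_matrix \<sigma> A x p X) (- \<gamma> *\<^sub>R mat 1) u \<and>
        bounded (v ` closure \<Omega>) \<and> visc_supersol \<Omega> \<sigma> A K v \<and>
        C > 0 \<and> K_increasing \<Omega> K C (max (sup_norm (closure \<Omega>) u) (sup_norm (closure \<Omega>) v))
        \<longrightarrow>
        (\<Omega> \<noteq> {} \<longrightarrow> (\<exists>z. is_arg_max (\<lambda>x. max (u x - v x) 0) (\<lambda>x. x \<in> frontier \<Omega>) z)) \<and>
        (SUP x\<in>\<Omega>. ereal (u x - v x)) \<le> (SUP x\<in>frontier \<Omega>. ereal (max (u x - v x) 0)))
     \<and>
     (\<forall>u\<^sub>1 u\<^sub>2 \<gamma> C.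
        continuous_on (closure \<Omega>) u\<^sub>1 \<and> visc_sol \<Omega> \<sigma> A K u\<^sub>1 \<and>
        continuous_on (closure \<Omega>) u\<^sub>2 \<and> visc_sol \<Omega> \<sigma> A K u\<^sub>2 \<and>
        \<gamma> > 0 \<and>
        visc_matrix_subsol \<Omega> (\<lambda>x p X. - MA_matrix \<sigma> A x p X) (- \<gamma> *\<^sub>R mat 1) u\<^sub>1 \<and>
        visc_matrix_subsol \<Omega> (\<lambda>x p X. - MA_matrix \<sigma> A x p X) (- \<gamma> *\<^sub>R mat 1) u\<^sub>2 \<and>
        (\<forall>x\<in>frontier \<Omega>. u\<^sub>1 x = u\<^sub>2 x) \<and>
        C > 0 \<and> K_increasing \<Omega> K C (max (sup_norm (closure \<Omega>) u\<^sub>1) (sup_norm (closure \<Omega>) u\<^sub>2))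
        \<longrightarrow> (\<forall>x\<in>closure \<Omega>. u\<^sub>1 x = u\<^sub>2 x))"
proof -
  interpret comparison_setting \<Omega> \<sigma> A K \<omega> L C\<^sub>1
    by (unfold_locales; (rule assms; assumption | use A_lip in blast))
  show ?thesis
  proof (intro conjI allI impI ballI)
    fix u\<^sub>1 u\<^sub>2 \<gamma> C x
    assume *: "continuous_on (closure \<Omega>) u\<^sub>1 \<and> visc_sol \<Omega> \<sigma> A K u\<^sub>1 \<and>
        continuous_on (closure \<Omega>) u\<^sub>2 \<and> visc_sol \<Omega> \<sigma> A K u\<^sub>2 \<and>
        \<gamma> > 0 \<and>
        visc_matrix_subsol \<Omega> (\<lambda>x p X. - MA_matrix \<sigma> A x p X) (- \<gamma> *\<^sub>R mat 1) u\<^sub>1 \<and>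
        visc_matrix_subsol \<Omega> (\<lambda>x p X. - MA_matrix \<sigma> A x p X) (- \<gamma> *\<^sub>R mat 1) u\<^sub>2 \<and>
        (\<forall>x\<in>frontier \<Omega>. u\<^sub>1 x = u\<^sub>2 x) \<and>
        C > 0 \<and> K_increasing \<Omega> K C (max (sup_norm (closure \<Omega>) u\<^sub>1) (sup_norm (closure \<Omega>) u\<^sub>2))"
      and x: "x \<in> closure \<Omega>"
    show "u\<^sub>1 x = u\<^sub>2 x"
    proof (cases "x \<in> \<Omega>")
      case True
      have "u\<^sub>1 x \<le> u\<^sub>2 x" using * True by (intro unique_solution_le[of u\<^sub>1 u\<^sub>2 \<gamma> C]) auto
      moreover have "u\<^sub>2 x \<le> u\<^sub>1 x"
        using * True by (intro unique_solution_le[of u\<^sub>2 u\<^sub>1 \<gamma> C]) (auto simp: max.commute)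
      ultimately show ?thesis by simp
    next
      case False
      then have "x \<in> frontier \<Omega>" using x open_dom by (simp add: frontier_def interior_open)
      then show ?thesis using * by blast
    qed
  qed (use comparison_principle in blast)+
qed

end
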